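(* Let $V=\operatorname{Spec} A$ be a normal affine surface over $\mathbb{C}$ with an effective $\mathbb{C}^*$-action whose associated grading is $A=\bigoplus_{i\ge 0}A_i$ with $A_0=\mathbb{C}[t]$. Then there is a unique pair $(d,P)$, consisting of an integer $d\ge 1$ and a monic polynomial $P\in\mathbb{C}[t]$, satisfying condition $( * )$ below and such that there exists a $\mathbb{C}^*$-equivariant isomorphism of $A_0$-schemes $$\varphi: V\longrightarrow V^+_{d,P}:=\operatorname{Spec} A^+_{d,P}.$$ Condition $( * )$: writing $P(t)=\prod_{i=1}^n(t-x_i)^{r_i}$ with $x_i\ne x_j$ for $i\neq j$ and $r_i\geq 1$, one has $\gcd(d,r_1,\ldots,r_n)=1$ and $0<r_i<d$ for all $i=1,\ldots,n$ if $d\ge 2$, and $P=1$ if $d=1$.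
   Context: A $\mathbb{C}^*$-action on $V=\operatorname{Spec}A$ corresponds to a grading $A=\bigoplus_{i\in\mathbb{Z}}A_i$, where $A_i$ is the set of elements $f$ on which $\lambda\in\mathbb{C}^*$ acts by $\lambda.f=\lambda^i f$. For a monic polynomial $P\in\mathbb{C}[t]$ and an integer $d\ge1$ let $B^+_{d,P}:=\mathbb{C}[t,u,v]/(u^d-P(t)v)\cong\mathbb{C}[t,u,u^d/P(t)]$, graded by $\deg t=0$, $\deg u=1$, $\deg v=d$, and let $A^+_{d,P}$ be the normalization of $B^+_{d,P}$ with its induced grading; its degree $0$ part is $A_0=\mathbb{C}[t]$. *)

theory Defs
  imports
    "HOL-Analysis.Abstract_Topology"
    "HOL-Library.FuncSet"
    "HOL-Library.Extended_Nat"
    "HOL-Computational_Algebra.Computational_Algebra"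
    "HOL-Computational_Algebra.Field_as_Ring"
begin

section \<open>Integral domains as subrings of a ring type\<close>

text \<open>An integral domain is given as a subring (possibly the whole) of a type of class
  \<^class>\<open>idom\<close>. Homomorphisms are only constrained on their domain.\<close>

definition is_subring :: "'a::idom set \<Rightarrow> bool" where
  "is_subring A \<longleftrightarrow> 1 \<in> A \<and> (\<forall>x\<in>A. \<forall>y\<in>A. x - y \<in> A \<and> x * y \<in> A)"

definition ring_hom_on :: "'b::idom set \<Rightarrow> 'a::idom set \<Rightarrow> ('b \<Rightarrow> 'a) \<Rightarrow> bool" where
  "ring_hom_on B A \<theta> \<longleftrightarrow> \<theta> ` B \<subseteq> A \<and> \<theta> 1 = 1 \<and>
     (\<forall>x\<in>B. \<forall>y\<in>B. \<theta> (x + y) = \<theta> x + \<theta> y \<and> \<theta> (x * y) = \<theta> x * \<theta> y)"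

definition is_ideal :: "'a::idom set \<Rightarrow> 'a set \<Rightarrow> bool" where
  "is_ideal A I \<longleftrightarrow> I \<subseteq> A \<and> 0 \<in> I \<and> (\<forall>x\<in>I. \<forall>y\<in>I. x + y \<in> I) \<and> (\<forall>a\<in>A. \<forall>x\<in>I. a * x \<in> I)"

definition is_prime_ideal :: "'a::idom set \<Rightarrow> 'a set \<Rightarrow> bool" where
  "is_prime_ideal A p \<longleftrightarrow>
     is_ideal A p \<and> 1 \<notin> p \<and> (\<forall>x\<in>A. \<forall>y\<in>A. x * y \<in> p \<longrightarrow> x \<in> p \<or> y \<in> p)"

definition frac_field :: "'a::idom set \<Rightarrow> 'a fract set" where
  "frac_field A = {Fract a b | a b. a \<in> A \<and> b \<in> A \<and> b \<noteq> 0}"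

definition integral_over :: "'a::idom set \<Rightarrow> 'a \<Rightarrow> bool" where
  "integral_over A x \<longleftrightarrow> (\<exists>q. lead_coeff q = 1 \<and> (\<forall>i. coeff q i \<in> A) \<and> poly q x = 0)"

definition normal_domain :: "'a::idom set \<Rightarrow> bool" where
  "normal_domain A \<longleftrightarrow>
     (\<forall>x\<in>frac_field A. integral_over (to_fract ` A) x \<longrightarrow> x \<in> to_fract ` A)"


section \<open>Affine schemes of integral domains\<close>

definition spec :: "'a::idom set \<Rightarrow> 'a set set" where
  "spec A = {p. is_prime_ideal A p}"

definition zariski :: "'a::idom set \<Rightarrow> 'a set topology" where
  "zariski A = topology (\<lambda>U. \<exists>S\<subseteq>A. U = {p \<in> spec A. \<not> S \<subseteq> p})"

lemma openin_zariski:
  assumes "is_subring A"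
  shows "openin (zariski A) U \<longleftrightarrow> (\<exists>S\<subseteq>A. U = {p \<in> spec A. \<not> S \<subseteq> p})"
proof -
  have int: "\<exists>R\<subseteq>A. {p \<in> spec A. \<not> S \<subseteq> p} \<inter> {p \<in> spec A. \<not> T \<subseteq> p} = {p \<in> spec A. \<not> R \<subseteq> p}"
    if ST: "S \<subseteq> A" "T \<subseteq> A" for S T
  proof (intro exI conjI)
    let ?R = "{s * t | s t. s \<in> S \<and> t \<in> T}"
    show "?R \<subseteq> A" using ST assms by (auto simp: is_subring_def subset_iff)
    show "{p \<in> spec A. \<not> S \<subseteq> p} \<inter> {p \<in> spec A. \<not> T \<subseteq> p} = {p \<in> spec A. \<not> ?R \<subseteq> p}"
    proof (intro equalityI subsetI)
      fix p assume "p \<in> {p \<in> spec A. \<not> S \<subseteq> p} \<inter> {p \<in> spec A. \<not> T \<subseteq> p}"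
      then obtain s t where p: "p \<in> spec A" "s \<in> S" "s \<notin> p" "t \<in> T" "t \<notin> p" by blast
      then have "s * t \<notin> p"
        using ST unfolding spec_def is_prime_ideal_def by blast
      then show "p \<in> {p \<in> spec A. \<not> ?R \<subseteq> p}" using p by blast
    next
      fix p assume "p \<in> {p \<in> spec A. \<not> ?R \<subseteq> p}"
      then obtain s t where p: "p \<in> spec A" "s \<in> S" "t \<in> T" "s * t \<notin> p" by blast
      then have I: "is_ideal A p" "s \<in> A" "t \<in> A"
        using ST unfolding spec_def is_prime_ideal_def by auto
      have "s \<notin> p" "t \<notin> p"
        using I p(4) unfolding is_ideal_def by (auto, metis mult.commute)
      then show "p \<in> {p \<in> spec A. \<not> S \<subseteq> p} \<inter> {p \<in> spec A. \<not> T \<subseteq> p}" using p by blast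
    qed
  qed
  have un: "\<exists>R\<subseteq>A. \<Union>\<K> = {p \<in> spec A. \<not> R \<subseteq> p}"
    if K: "\<forall>U\<in>\<K>. \<exists>S\<subseteq>A. U = {p \<in> spec A. \<not> S \<subseteq> p}" for \<K>
  proof -
    obtain f where f: "\<And>U. U \<in> \<K> \<Longrightarrow> f U \<subseteq> A \<and> U = {p \<in> spec A. \<not> f U \<subseteq> p}"
      using K by metis
    have "(\<Union>U\<in>\<K>. f U) \<subseteq> A" using f by blast
    moreover have "\<Union>\<K> = {p \<in> spec A. \<not> (\<Union>U\<in>\<K>. f U) \<subseteq> p}"
    proof (intro equalityI subsetI)
      fix p assume "p \<in> \<Union>\<K>"
      then obtain U where "U \<in> \<K>" "p \<in> U" by blast
      then show "p \<in> {p \<in> spec A. \<not> (\<Union>U\<in>\<K>. f U) \<subseteq> p}" using f[of U] by blast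
    next
      fix p assume "p \<in> {p \<in> spec A. \<not> (\<Union>U\<in>\<K>. f U) \<subseteq> p}"
      then obtain U where "U \<in> \<K>" "p \<in> spec A" "\<not> f U \<subseteq> p" by blast
      then show "p \<in> \<Union>\<K>" using f[of U] by blast
    qed
    ultimately show ?thesis by blast
  qed
  have "istopology (\<lambda>U. \<exists>S\<subseteq>A. U = {p \<in> spec A. \<not> S \<subseteq> p})"
    unfolding istopology_def
  proof (intro conjI allI impI)
    fix U W
    assume "\<exists>S\<subseteq>A. U = {p \<in> spec A. \<not> S \<subseteq> p}" "\<exists>S\<subseteq>A. W = {p \<in> spec A. \<not> S \<subseteq> p}"
    then obtain S T where ST: "S \<subseteq> A" "U = {p \<in> spec A. \<not> S \<subseteq> p}"
        "T \<subseteq> A" "W = {p \<in> spec A. \<not> T \<subseteq> p}"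
      by (elim exE conjE)
    show "\<exists>S\<subseteq>A. U \<inter> W = {p \<in> spec A. \<not> S \<subseteq> p}"
      unfolding ST(2,4) by (rule int[OF ST(1,3)])
  next
    fix \<K>
    assume "\<forall>U\<in>\<K>. \<exists>S\<subseteq>A. U = {p \<in> spec A. \<not> S \<subseteq> p}"
    then show "\<exists>S\<subseteq>A. \<Union>\<K> = {p \<in> spec A. \<not> S \<subseteq> p}" by (rule un)
  qed
  then show ?thesis unfolding zariski_def by simp
qed

text \<open>The structure sheaf: a section over \<open>U\<close> sends each \<open>p \<in> U\<close> to an element of the
  localization \<open>A\<^sub>p\<close>, which for a domain is a subring of the fraction field, and is locally a
  quotient of elements of \<open>A\<close>. Ring operations on sections are pointwise, and sections are
  \<^const>\<open>undefined\<close> off \<open>U\<close>, so that there is exactly one section over the empty set.\<close>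

definition sections :: "'a::idom set \<Rightarrow> 'a set set \<Rightarrow> ('a set \<Rightarrow> 'a fract) set" where
  "sections A U = {s \<in> extensional U. \<forall>p\<in>U. \<exists>W. openin (zariski A) W \<and> p \<in> W \<and> W \<subseteq> U \<and>
     (\<exists>a\<in>A. \<exists>b\<in>A. \<forall>q\<in>W. b \<notin> q \<and> s q = Fract a b)}"

definition local_max_ideal :: "'a::idom set \<Rightarrow> 'a set \<Rightarrow> 'a fract set" where
  "local_max_ideal A p = {Fract a b | a b. a \<in> p \<and> b \<in> A \<and> b \<notin> p}"

text \<open>A morphism \<open>Spec A \<rightarrow> Spec B\<close> is a pair of a map on points and a family of maps from
  the sections over \<open>U\<close> to the sections over the preimage of \<open>U\<close>.\<close>

type_synonym ('a, 'b) morph =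
  "('a set \<Rightarrow> 'b set) \<times> ('b set set \<Rightarrow> ('b set \<Rightarrow> 'b fract) \<Rightarrow> ('a set \<Rightarrow> 'a fract))"

definition preim :: "'a::idom set \<Rightarrow> ('a, 'b::idom) morph \<Rightarrow> 'b set set \<Rightarrow> 'a set set" where
  "preim A \<phi> U = {p \<in> spec A. fst \<phi> p \<in> U}"

text \<open>Morphisms of locally ringed spaces. The value of a section at a point is its germ there, so
  the last conjunct says that the maps on stalks are local.\<close>

definition scheme_morphism :: "'a::idom set \<Rightarrow> 'b::idom set \<Rightarrow> ('a, 'b) morph \<Rightarrow> bool" where
  "scheme_morphism A B \<phi> \<longleftrightarrow>
     continuous_map (zariski A) (zariski B) (fst \<phi>) \<and>
     (\<forall>U. openin (zariski B) U \<longrightarrow>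
        snd \<phi> U ` sections B U \<subseteq> sections A (preim A \<phi> U) \<and>
        snd \<phi> U (\<lambda>q\<in>U. 1) = (\<lambda>p\<in>preim A \<phi> U. 1) \<and>
        (\<forall>s\<in>sections B U. \<forall>t\<in>sections B U.
           snd \<phi> U (\<lambda>q\<in>U. s q + t q) = (\<lambda>p\<in>preim A \<phi> U. snd \<phi> U s p + snd \<phi> U t p) \<and>
           snd \<phi> U (\<lambda>q\<in>U. s q * t q) = (\<lambda>p\<in>preim A \<phi> U. snd \<phi> U s p * snd \<phi> U t p)) \<and>
        (\<forall>W. openin (zariski B) W \<and> W \<subseteq> U \<longrightarrow> (\<forall>s\<in>sections B U.
           snd \<phi> W (restrict s W) = restrict (snd \<phi> U s) (preim A \<phi> W))) \<and>
        (\<forall>p\<in>preim A \<phi> U. \<forall>s\<in>sections B U.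
           snd \<phi> U s p \<in> local_max_ideal A p \<longleftrightarrow> s (fst \<phi> p) \<in> local_max_ideal B (fst \<phi> p)))"

definition morph_eq :: "'a::idom set \<Rightarrow> 'b::idom set \<Rightarrow> ('a, 'b) morph \<Rightarrow> ('a, 'b) morph \<Rightarrow> bool" where
  "morph_eq A B \<phi> \<psi> \<longleftrightarrow> (\<forall>p\<in>spec A. fst \<phi> p = fst \<psi> p) \<and>
     (\<forall>U. openin (zariski B) U \<longrightarrow> (\<forall>s\<in>sections B U. snd \<phi> U s = snd \<psi> U s))"

definition morph_id :: "('a::idom, 'a) morph" where
  "morph_id = ((\<lambda>p. p), (\<lambda>U s. s))"

text \<open>\<open>morph_comp B \<psi> \<phi>\<close> is the composition of \<open>\<phi>\<close> with target \<open>Spec B\<close> and \<open>\<psi>\<close> with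
  source \<open>Spec B\<close>.\<close>

definition morph_comp ::
  "'b::idom set \<Rightarrow> ('b, 'c::idom) morph \<Rightarrow> ('a::idom, 'b) morph \<Rightarrow> ('a, 'c) morph" where
  "morph_comp B \<psi> \<phi> =
     (fst \<psi> \<circ> fst \<phi>, (\<lambda>U s. snd \<phi> (preim B \<psi> U) (snd \<psi> U s)))"

definition scheme_iso :: "'a::idom set \<Rightarrow> 'b::idom set \<Rightarrow> ('a, 'b) morph \<Rightarrow> bool" where
  "scheme_iso A B \<phi> \<longleftrightarrow> scheme_morphism A B \<phi> \<and>
     (\<exists>\<psi>. scheme_morphism B A \<psi> \<and>
       morph_eq A A (morph_comp B \<psi> \<phi>) morph_id \<and> morph_eq B B (morph_comp A \<phi> \<psi>) morph_id)"

text \<open>The map \<open>a / b \<mapsto> \<theta> a / \<theta> b\<close> from the localization of \<open>B\<close> at the inverse image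
  of the prime ideal \<open>p\<close> to the localization at \<open>p\<close>.\<close>

definition local_map :: "'b::idom set \<Rightarrow> 'a::idom set \<Rightarrow> ('b \<Rightarrow> 'a) \<Rightarrow> 'b fract \<Rightarrow> 'a fract" where
  "local_map B p \<theta> x =
     (THE y. \<exists>a\<in>B. \<exists>b\<in>B. \<theta> b \<notin> p \<and> x = Fract a b \<and> y = Fract (\<theta> a) (\<theta> b))"

text \<open>The morphism \<open>Spec A \<rightarrow> Spec B\<close> induced by a ring homomorphism \<open>\<theta>\<close> from \<open>B\<close> to \<open>A\<close>.\<close>

definition spec_map :: "'a::idom set \<Rightarrow> 'b::idom set \<Rightarrow> ('b \<Rightarrow> 'a) \<Rightarrow> ('a, 'b) morph" where
  "spec_map A B \<theta> = (let f = (\<lambda>p. {b \<in> B. \<theta> b \<in> p}) in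
     (f, (\<lambda>U s. \<lambda>p \<in> {p \<in> spec A. f p \<in> U}. local_map B p \<theta> (s (f p)))))"


section \<open>Affine surfaces with a torus action\<close>

definition krull_dim :: "'a::idom set \<Rightarrow> enat" where
  "krull_dim A =
     (SUP n \<in> {n. \<exists>c. (\<forall>i\<le>n. c i \<in> spec A) \<and> (\<forall>i<n. c i \<subset> c (Suc i))}. enat n)"

text \<open>The structure of a \<open>\<complex>\<close>-algebra on \<open>A\<close> is given by a ring homomorphism \<open>\<iota>\<close>.\<close>

definition normal_affine_surface :: "(complex \<Rightarrow> 'a::idom) \<Rightarrow> 'a set \<Rightarrow> bool" where
  "normal_affine_surface \<iota> A \<longleftrightarrow>
     is_subring A \<and> ring_hom_on UNIV A \<iota> \<and>
     (\<exists>S. finite S \<and> A = is_subring hull (range \<iota> \<union> S)) \<and>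
     normal_domain A \<and> krull_dim A = 2"

text \<open>An algebraic action of \<open>\<complex>\<^sup>*\<close> on \<open>Spec A\<close>, given by automorphisms of \<open>A\<close>. Algebraicity
  (the last conjunct) says that \<open>\<lambda> \<mapsto> \<lambda>.f\<close> comes from an element of \<open>A[z, 1/z]\<close>.
  The action at \<open>0\<close> is irrelevant.\<close>

definition torus_action :: "(complex \<Rightarrow> 'a::idom) \<Rightarrow> 'a set \<Rightarrow> (complex \<Rightarrow> 'a \<Rightarrow> 'a) \<Rightarrow> bool" where
  "torus_action \<iota> A act \<longleftrightarrow>
     (\<forall>c. c \<noteq> 0 \<longrightarrow> ring_hom_on A A (act c) \<and> (\<forall>z. act c (\<iota> z) = \<iota> z)) \<and>
     (\<forall>f\<in>A. act 1 f = f) \<and>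
     (\<forall>c d. c \<noteq> 0 \<and> d \<noteq> 0 \<longrightarrow> (\<forall>f\<in>A. act (c * d) f = act c (act d f))) \<and>
     (\<forall>f\<in>A. \<exists>(I::int set) g. finite I \<and> (\<forall>i\<in>I. g i \<in> A) \<and>
        (\<forall>c. c \<noteq> 0 \<longrightarrow> act c f = (\<Sum>i\<in>I. \<iota> (c powi i) * g i)))"

definition effective_action :: "'a::idom set \<Rightarrow> (complex \<Rightarrow> 'a \<Rightarrow> 'a) \<Rightarrow> bool" where
  "effective_action A act \<longleftrightarrow>
     (\<forall>c. c \<noteq> 0 \<and> morph_eq A A (spec_map A A (act c)) morph_id \<longrightarrow> c = 1)"

definition weight_space ::
  "(complex \<Rightarrow> 'a::idom) \<Rightarrow> 'a set \<Rightarrow> (complex \<Rightarrow> 'a \<Rightarrow> 'a) \<Rightarrow> int \<Rightarrow> 'a set" where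
  "weight_space \<iota> A act i = {f \<in> A. \<forall>c. c \<noteq> 0 \<longrightarrow> act c f = \<iota> (c powi i) * f}"

text \<open>The homomorphism \<open>\<complex>[t] \<rightarrow> A\<close> of \<open>\<complex>\<close>-algebras that sends the variable to \<open>t\<close>.\<close>

definition poly_embed :: "(complex \<Rightarrow> 'a::idom) \<Rightarrow> 'a \<Rightarrow> complex poly \<Rightarrow> 'a" where
  "poly_embed \<iota> t p = poly (map_poly \<iota> p) t"

definition equivariant ::
  "'a::idom set \<Rightarrow> (complex \<Rightarrow> 'a \<Rightarrow> 'a) \<Rightarrow> 'b::idom set \<Rightarrow> (complex \<Rightarrow> 'b \<Rightarrow> 'b) \<Rightarrow>
   ('a, 'b) morph \<Rightarrow> bool" where
  "equivariant A actA B actB \<phi> \<longleftrightarrow> (\<forall>c. c \<noteq> 0 \<longrightarrow>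
     morph_eq A B (morph_comp A \<phi> (spec_map A A (actA c)))
                  (morph_comp B (spec_map B B (actB c)) \<phi>))"

text \<open>For \<open>A\<close> and \<open>B\<close> over \<open>\<complex>[t]\<close> through \<open>\<alpha>\<close> and \<open>\<beta>\<close>: morphisms
  \<open>Spec A \<rightarrow> Spec B\<close> of schemes over \<open>Spec \<complex>[t]\<close>.\<close>

definition over_affine_line ::
  "'a::idom set \<Rightarrow> (complex poly \<Rightarrow> 'a) \<Rightarrow> 'b::idom set \<Rightarrow> (complex poly \<Rightarrow> 'b) \<Rightarrow>
   ('a, 'b) morph \<Rightarrow> bool" where
  "over_affine_line A \<alpha> B \<beta> \<phi> \<longleftrightarrow>
     morph_eq A (UNIV :: complex poly set)
       (morph_comp B (spec_map B UNIV \<beta>) \<phi>) (spec_map A UNIV \<alpha>)"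


section \<open>The surfaces \<open>V\<^sup>+\<^sub>d\<^sub>,\<^sub>P\<close>\<close>

text \<open>\<open>\<complex>(t, u)\<close> is the fraction field of \<open>\<complex>[t][u]\<close>: the inner variable is \<open>t\<close>.\<close>

type_synonym ratfun = "complex poly poly fract"

definition const_tu :: "complex \<Rightarrow> ratfun" where
  "const_tu c = to_fract [:[:c:]:]"

definition t_var :: ratfun where
  "t_var = to_fract [:[:0, 1:]:]"

definition u_var :: ratfun where
  "u_var = to_fract [:0, 1:]"

text \<open>The homomorphism \<open>\<complex>[t, u, v] \<rightarrow> \<complex>(t, u)\<close> over \<open>\<complex>[t, u]\<close> with
  \<open>v \<mapsto> u\<^sup>d / P(t)\<close>, where \<open>\<complex>[t, u, v] = \<complex>[t][u][v]\<close>.\<close>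

definition eval_v :: "nat \<Rightarrow> complex poly \<Rightarrow> complex poly poly poly \<Rightarrow> ratfun" where
  "eval_v d P q = poly (fract_poly q) (u_var ^ d / poly_embed const_tu t_var P)"

definition B_plus :: "nat \<Rightarrow> complex poly \<Rightarrow> ratfun set" where
  "B_plus d P = range (eval_v d P)"

lemma poly_embed_tu: "poly_embed const_tu t_var P = to_fract [:P:]"
proof (induction P)
  case 0
  show ?case by (simp add: poly_embed_def)
next
  case (pCons a P)
  have "const_tu 0 = 0" by (simp add: const_tu_def)
  then have "poly_embed const_tu t_var (pCons a P) = const_tu a + t_var * poly_embed const_tu t_var P"
    using pCons.hyps by (simp add: poly_embed_def map_poly_pCons)
  also have "\<dots> = to_fract [:pCons a P:]"
    unfolding pCons.IH by (simp add: const_tu_def t_var_def del: to_fract_add to_fract_mult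
      flip: to_fract_add to_fract_mult)
  finally show ?case .
qed

text \<open>The kernel of \<^const>\<open>eval_v\<close> is the ideal of \<open>\<complex>[t, u, v]\<close> generated by
  \<open>u\<^sup>d - P(t) v\<close>, so \<^const>\<open>B_plus\<close> is \<open>\<complex>[t, u, v] / (u\<^sup>d - P(t) v)\<close>.\<close>

lemma eval_v_eq_0_iff:
  assumes "lead_coeff P = 1"
  shows "eval_v d P q = 0 \<longleftrightarrow> [:[:0, 1:] ^ d, - [:P:]:] dvd q"
proof -
  define L :: "complex poly poly poly" where "L = [:[:0, 1:] ^ d, - [:P:]:]"
  have P0: "P \<noteq> 0" using assms by auto
  let ?w = "u_var ^ d / poly_embed const_tu t_var P"
  have pow: "to_fract (x ^ n) = to_fract x ^ n" for x :: "complex poly poly" and n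
    by (induction n) auto
  have fl: "fract_poly L = smult (- to_fract [:P:]) [:- ?w, 1:]"
    using P0 by (simp add: L_def poly_embed_tu u_var_def map_poly_pCons pow del: minus_pCons)
  have "eval_v d P q = 0 \<longleftrightarrow> [:- ?w, 1:] dvd fract_poly q"
    by (simp add: eval_v_def poly_eq_0_iff_dvd)
  also have "\<dots> \<longleftrightarrow> fract_poly L dvd fract_poly q"
    unfolding fl using P0 by (simp add: smult_dvd_iff del: smult_pCons minus_pCons)
  also have "\<dots> \<longleftrightarrow> L dvd q"
  proof
    have "content L dvd coeff L 0" "content L dvd coeff L 1"
      by (rule content_dvd_coeff)+
    then have c: "content L dvd [:0, 1:] ^ d" "content L dvd [:P:]"
      by (auto simp: L_def simp del: minus_pCons)
    from c(2) P0 have "degree (content L) = 0"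
      using dvd_imp_degree_le[of "content L" "[:P:]"] by simp
    then obtain h where h: "content L = [:h:]" by (rule degree_eq_zeroE)
    have "h dvd coeff ([:0, 1:] ^ d) d" using c(1) unfolding h const_poly_dvd_iff by blast
    also have "coeff ([:0, 1 :: complex poly:] ^ d) d = 1"
      by (metis coeff_monom monom_altdef smult_1_left)
    finally have "content L dvd 1" unfolding h by (simp add: is_unit_const_poly_iff)
    then have "content L = 1"
      by (metis is_unit_normalize normalize_content)
    then show "fract_poly L dvd fract_poly q \<Longrightarrow> L dvd q"
      using fract_poly_dvdD by blast
  next
    assume "L dvd q"
    then show "fract_poly L dvd fract_poly q" by (auto elim!: dvdE simp: fract_poly_mult)
  qed
  finally show ?thesis unfolding L_def .
qed

text \<open>The normalization of \<^const>\<open>B_plus\<close>: its fraction field is \<open>\<complex>(t, u)\<close>, since it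
  contains \<open>t\<close> and \<open>u\<close>.\<close>

definition A_plus :: "nat \<Rightarrow> complex poly \<Rightarrow> ratfun set" where
  "A_plus d P = {x. integral_over (B_plus d P) x}"

text \<open>The action of \<open>\<complex>\<^sup>*\<close> on \<open>\<complex>(t, u)\<close> with \<open>deg t = 0\<close> and \<open>deg u = 1\<close>, hence
  \<open>deg v = d\<close>: the substitution \<open>u \<mapsto> \<lambda> u\<close>. It preserves both rings above and induces
  their gradings.\<close>

definition scale_u :: "complex \<Rightarrow> ratfun \<Rightarrow> ratfun" where
  "scale_u c = local_map UNIV {0} (\<lambda>f. f \<circ>\<^sub>p [:0, [:c:]:])"

definition condition_star :: "nat \<Rightarrow> complex poly \<Rightarrow> bool" where
  "condition_star d P \<longleftrightarrow>
     (if d = 1 then P = 1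
      else Gcd (insert d ((\<lambda>x. order x P) ` {x. poly P x = 0})) = 1 \<and>
           (\<forall>x. poly P x = 0 \<longrightarrow> 0 < order x P \<and> order x P < d))"

end

(*
The weights of the action turn A into a graded ring. Since dim A = 2, two homogeneous elements of
the same degree are proportional over C(t): otherwise a homogeneous prime ideal would fit strictly
between 0 and the irrelevant ideal A_+. Effectivity gives a homogeneous fraction w of degree one, so
the part of degree n of A is M_n w^n for a C[t]-submodule M_n of C(t). As A is finitely generated
and normal, there are N and q with M_n = {r. r^N q^(-n) in C[t]}; replacing w by s w for a
suitable s in C(t) and taking a root turns this into {r. r^d P^n in C[t]} with (d, P)
satisfying condition_star. The same modules describe A^+_{d,P}, with u in place of w.

For uniqueness, a graded isomorphism over C[t] multiplies u by a constant, so that it preserves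
these modules; the inequality of orders read off from n = d d' then gives d' ord P = d ord P'.
*)
theory Submission
  imports Defs "Jordan_Normal_Form.Char_Poly"
begin

section \<open>Integral elements\<close>

unbundle no fps_syntax

text \<open>Dimension enters only through chains of primes, and these give less than
  proportionality: up to a denominator in C[t], every homogeneous element of positive degree has a
  power in f A. Normality closes the gap between this and g in C(t) f. The number N is the product
  of the degrees of homogeneous generators, so that each generator has a power of degree N; q turns
  out to generate M_N. Generators make the condition r^N q^(-n) in C[t] necessary, normality makes
  it sufficient. Both rings are compared with one model, the polynomials over C(t) whose n-th
  coefficient lies in M_n; its variable is evaluated at u and at w. Isomorphisms of schemes are
  translated into isomorphisms of rings by global sections. The two halves of the normalization of
  (d, P) have different tasks. Orders below d make the part of degree one equal to C[t] w, which
  fixes w up to a constant; the coprimality recovers d itself from the ratios ord P / d, which are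
  all that the modules M_n remember.\<close>

lemma subring_zero: "is_subring A \<Longrightarrow> 0 \<in> A"
  unfolding is_subring_def by (metis diff_self)

lemma subring_one: "is_subring A \<Longrightarrow> 1 \<in> A"
  unfolding is_subring_def by blast

lemma subring_diff: "is_subring A \<Longrightarrow> x \<in> A \<Longrightarrow> y \<in> A \<Longrightarrow> x - y \<in> A"
  unfolding is_subring_def by blast

lemma subring_mult: "is_subring A \<Longrightarrow> x \<in> A \<Longrightarrow> y \<in> A \<Longrightarrow> x * y \<in> A"
  unfolding is_subring_def by blast

lemma subring_uminus: "is_subring A \<Longrightarrow> x \<in> A \<Longrightarrow> - x \<in> A"
  using subring_diff[of A 0 x] subring_zero[of A] by simp

lemma subring_add: "is_subring A \<Longrightarrow> x \<in> A \<Longrightarrow> y \<in> A \<Longrightarrow> x + y \<in> A"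
  using subring_diff[of A x "- y"] subring_uminus[of A y] by simp

lemma subring_sum: "is_subring A \<Longrightarrow> (\<And>i. i \<in> I \<Longrightarrow> f i \<in> A) \<Longrightarrow> sum f I \<in> A"
  by (induction I rule: infinite_finite_induct) (auto intro: subring_zero subring_add)

lemma subring_prod: "is_subring A \<Longrightarrow> (\<And>i. i \<in> I \<Longrightarrow> f i \<in> A) \<Longrightarrow> prod f I \<in> A"
  by (induction I rule: infinite_finite_induct) (auto intro: subring_one subring_mult)

lemma subring_power: "is_subring A \<Longrightarrow> x \<in> A \<Longrightarrow> x ^ n \<in> A"
  by (induction n) (auto intro: subring_one subring_mult)

text \<open>Lets a Leibniz expansion over polynomials with coefficients in \<open>A\<close> be
  treated by closure properties alone.\<close>

lemma subring_coeffs: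
  fixes A :: "'a::idom set"
  assumes "is_subring A"
  shows "is_subring {p. \<forall>i. coeff p i \<in> A}"
  unfolding is_subring_def
  using assms by (auto simp: coeff_mult coeff_1 intro!: subring_sum subring_mult subring_diff subring_one subring_zero)

text \<open>The determinant trick: \<open>x\<close> is a root of the characteristic polynomial of the matrix
  by which it acts on a finitely generated module.\<close>

lemma integral_over_family:
  fixes B :: "'f::field set" and v :: "'i \<Rightarrow> 'f"
  assumes B: "is_subring B" and I: "finite I" and nz: "\<exists>i\<in>I. v i \<noteq> 0"
    and c: "\<And>i j. i \<in> I \<Longrightarrow> j \<in> I \<Longrightarrow> c i j \<in> B"
    and x: "\<And>i. i \<in> I \<Longrightarrow> x * v i = (\<Sum>j\<in>I. c i j * v j)"
  shows "integral_over B x"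
proof -
  let ?n = "card I"
  obtain h where h: "bij_betw h {0..<?n} I"
    using I ex_bij_betw_nat_finite by blast
  have hI: "h i \<in> I" if "i < ?n" for i using h that by (auto simp: bij_betw_def)
  \<comment> \<open>The relations say that \<open>w\<close>, the vector of the \<open>v i\<close>,
    is an eigenvector of \<open>M\<close> for \<open>x\<close>; it is nonzero by
    \<open>nz\<close>.\<close>
  define M where "M = mat ?n ?n (\<lambda>(i, j). c (h i) (h j))"
  define w where "w = vec ?n (\<lambda>i. v (h i))"
  have M: "M \<in> carrier_mat ?n ?n" by (simp add: M_def)
  have w: "w \<in> carrier_vec ?n" by (simp add: w_def)
  have "M *\<^sub>v w = x \<cdot>\<^sub>v w"
  proof (rule eq_vecI)
    show "dim_vec (M *\<^sub>v w) = dim_vec (x \<cdot>\<^sub>v w)" by (simp add: M_def w_def)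
    fix i assume "i < dim_vec (x \<cdot>\<^sub>v w)"
    then have i: "i < ?n" by (simp add: w_def)
    have "(M *\<^sub>v w) $ i = (\<Sum>j\<in>{0..<?n}. c (h i) (h j) * v (h j))"
      using i by (simp add: M_def w_def scalar_prod_def)
    also have "\<dots> = (\<Sum>j\<in>I. c (h i) j * v j)"
      by (rule sum.reindex_bij_betw[OF h])
    also have "\<dots> = (x \<cdot>\<^sub>v w) $ i" using x[OF hI[OF i]] i by (simp add: w_def)
    finally show "(M *\<^sub>v w) $ i = (x \<cdot>\<^sub>v w) $ i" .
  qed
  moreover have "w \<noteq> 0\<^sub>v ?n"
  proof
    assume w0: "w = 0\<^sub>v ?n"
    obtain i where i: "i \<in> I" "v i \<noteq> 0" using nz by blast
    then obtain k where "k < ?n" "h k = i" using h by (force simp: bij_betw_def)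
    then show False using w0 i by (metis index_vec index_zero_vec(1) w_def)
  qed
  ultimately have "eigenvalue M x"
    using M w unfolding eigenvalue_def eigenvector_def by auto
  then have root: "poly (char_poly M) x = 0"
    using eigenvalue_root_char_poly[OF M] by blast
  let ?PB = "{p. \<forall>i. coeff p i \<in> B}"
  have PB: "is_subring ?PB" by (rule subring_coeffs[OF B])
  have C: "char_poly_matrix M \<in> carrier_mat ?n ?n" using M by simp
  have entry: "char_poly_matrix M $$ (i, j) \<in> ?PB" if "i < ?n" "j < ?n" for i j
    using that M c[OF hI hI, of i j] subring_zero[OF B] subring_one[OF B]
    by (auto simp: char_poly_matrix_def M_def coeff_pCons split: nat.split intro!: subring_uminus[OF B])
  \<comment> \<open>Leibniz formula: a signed sum of products of entries that are polynomials over
    \<open>B\<close>.\<close>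
  have "char_poly M \<in> ?PB"
    unfolding char_poly_def det_def'[OF C]
  proof (intro subring_sum[OF PB] subring_mult[OF PB] subring_prod[OF PB])
    fix p i assume p: "p \<in> {p. p permutes {0..<?n}}" and i: "i \<in> {0..<?n}"
    then show "char_poly_matrix M $$ (i, p i) \<in> ?PB"
      by (intro entry) (auto simp: permutes_in_image[of p "{0..<?n}" i] dest: permutes_in_image[of p "{0..<?n}" i])
  next
    fix p show "signof p \<in> ?PB"
      using subring_one[OF PB] subring_uminus[OF PB, of 1] by (auto simp: sign_def)
  qed
  moreover have "lead_coeff (char_poly M) = 1"
    using degree_monic_char_poly[OF M] by simp
  ultimately show ?thesis using root unfolding integral_over_def by auto
qed

lemma integral_over_power_eq:
  fixes B :: "'f::idom set"
  assumes "is_subring B" "integral_over B x"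
  obtains n b where "0 < n" "\<And>i. b i \<in> B" "x ^ n = (\<Sum>i<n. b i * x ^ i)"
proof -
  obtain q where q: "lead_coeff q = 1" "\<And>i. coeff q i \<in> B" "poly q x = 0"
    using assms unfolding integral_over_def by blast
  have "0 < degree q"
  proof (rule ccontr)
    assume "\<not> 0 < degree q"
    then obtain c where "q = [:c:]" using degree_eq_zeroE by blast
    then show False using q by simp
  qed
  moreover have "x ^ degree q = (\<Sum>i<degree q. - coeff q i * x ^ i)"
    using q(1,3) by (simp add: poly_altdef lessThan_Suc_atMost[symmetric] sum_negf eq_neg_iff_add_eq_0 add.commute)
  ultimately show ?thesis using that[of "degree q" "\<lambda>i. - coeff q i"] q(2) assms(1)
    by (auto intro: subring_uminus)
qed

text \<open>\<open>c\<close> is the companion matrix of an integral equation: multiplication by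
  \<open>x\<close> shifts the powers below \<open>n\<close>, and only the top power needs the
  equation.\<close>

lemma power_basis_matrix:
  fixes B :: "'f::idom set"
  assumes B: "is_subring B" and x: "integral_over B x"
  obtains n c where "0 < n" "\<And>i k. c i k \<in> B" "\<And>i. i < n \<Longrightarrow> x * x ^ i = (\<Sum>k<n. c i k * x ^ k)"
proof -
  obtain n b where n: "0 < n" "\<And>i. b i \<in> B" "x ^ n = (\<Sum>i<n. b i * x ^ i)"
    using integral_over_power_eq[OF B x] by metis
  define c :: "nat \<Rightarrow> nat \<Rightarrow> 'f" where "c i k = (if Suc i = n then b k else of_bool (k = Suc i))" for i k
  have "x * x ^ i = (\<Sum>k<n. c i k * x ^ k)" if "i < n" for i
  proof (cases "Suc i = n")
    case True
    then have "x * x ^ i = x ^ n" by auto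
    then show ?thesis using True by (simp add: c_def n(3))
  next
    case False
    then show ?thesis using that by (simp add: c_def of_bool_def if_distrib[of "\<lambda>z. z * _"] cong: if_cong)
  qed
  moreover have "c i k \<in> B" for i k using n(2) subring_zero[OF B] subring_one[OF B] by (simp add: c_def)
  ultimately show ?thesis using that n(1) by blast
qed

text \<open>The products of a power of \<open>x\<close> below \<open>n\<close> and a power of
  \<open>y\<close> below \<open>m\<close> span a module containing 1 on which \<open>x + y\<close>
  acts with coefficients in \<open>B\<close>.\<close>

lemma integral_over_add:
  fixes B :: "'f::field set"
  assumes B: "is_subring B" and "integral_over B x" "integral_over B y"
  shows "integral_over B (x + y)"
proof -
  obtain n c where x: "0 < n" "\<And>i k. c i k \<in> B" "\<And>i. i < n \<Longrightarrow> x * x ^ i = (\<Sum>k<n. c i k * x ^ k)"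
    using power_basis_matrix[OF B assms(2)] by metis
  obtain m e where y: "0 < m" "\<And>i k. e i k \<in> B" "\<And>i. i < m \<Longrightarrow> y * y ^ i = (\<Sum>k<m. e i k * y ^ k)"
    using power_basis_matrix[OF B assms(3)] by metis
  let ?I = "{..<n} \<times> {..<m}"
  define v where "v l = x ^ fst l * y ^ snd l" for l
  \<comment> \<open>The Kronecker sum of the two matrices: \<open>c\<close> acts on the exponent of
    \<open>x\<close>, \<open>e\<close> on that of \<open>y\<close>.\<close>
  define z where "z l k = (if snd l = snd k then c (fst l) (fst k) else 0) +
    (if fst l = fst k then e (snd l) (snd k) else 0)" for l k
  show ?thesis
  proof (rule integral_over_family[OF B, where I = ?I and v = v and c = z])
    show "\<exists>i\<in>?I. v i \<noteq> 0"
      using x(1) y(1) by (intro bexI[of _ "(0, 0)"]) (auto simp: v_def)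
    show "z l k \<in> B" for l k
      unfolding z_def using x(2) y(2) subring_zero[OF B] by (intro subring_add[OF B]) auto
    fix l assume "l \<in> ?I"
    then obtain i j where l: "l = (i, j)" "i < n" "j < m" by auto
    have "(\<Sum>k\<in>?I. z l k * v k) =
        (\<Sum>i'<n. \<Sum>j'<m. if j' = j then c i i' * (x ^ i' * y ^ j') else 0) +
        (\<Sum>i'<n. \<Sum>j'<m. if i' = i then e j j' * (x ^ i' * y ^ j') else 0)"
      unfolding sum.cartesian_product sum.distrib[symmetric]
      by (rule sum.cong) (auto simp: z_def v_def l(1) distrib_right)
    also have "\<dots> = (\<Sum>i'<n. c i i' * x ^ i') * y ^ j + x ^ i * (\<Sum>j'<m. e j j' * y ^ j')"
      using l by (subst (2) sum.swap) (simp add: sum_distrib_left sum_distrib_right mult_ac)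
    also have "\<dots> = (x + y) * v l"
      unfolding x(3)[OF l(2), symmetric] y(3)[OF l(3), symmetric] by (simp add: v_def l(1) algebra_simps)
    finally show "(x + y) * v l = (\<Sum>k\<in>?I. z l k * v k)" by simp
  qed simp
qed

lemma integral_over_root:
  assumes "is_subring B" "0 < n" "x ^ n \<in> B"
  shows "integral_over B x"
proof -
  let ?q = "monom 1 n - [:x ^ n:]"
  have deg: "degree ?q = n"
    using degree_add_eq_left[of "- [:x ^ n:]" "monom 1 n"] assms(2)
    by (simp add: degree_monom_eq del: minus_pCons)
  have "coeff ?q i \<in> B" for i
    using assms subring_zero[of B] subring_one[of B] subring_uminus[of B]
    by (auto simp: coeff_pCons split: nat.split)
  moreover have "lead_coeff ?q = 1"
    using assms(2) unfolding deg by (simp add: coeff_pCons split: nat.split)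
  moreover have "poly ?q x = 0" by (simp add: poly_monom)
  ultimately show ?thesis unfolding integral_over_def by blast
qed

lemma fract_coprimeE:
  fixes z :: "'a::{factorial_ring_gcd, semiring_gcd_mult_normalize} fract"
  obtains a b where "z = to_fract a / to_fract b" "b \<noteq> 0" "coprime a b"
proof (rule that[of "fst (quot_of_fract z)" "snd (quot_of_fract z)"])
  show "z = to_fract (fst (quot_of_fract z)) / to_fract (snd (quot_of_fract z))"
    by (simp flip: Fract_conv_to_fract)
qed (simp_all add: coprime_quot_of_fract)

text \<open>With z = a/b in lowest terms, every power of \<open>b\<close> divides \<open>c\<close>,
  so the degrees of these powers are bounded and \<open>b\<close> is constant. The hypothesis is a
  common denominator of all powers because this is what passes from a graded element to its leading
  coefficient later.\<close>

lemma poly_completely_integrally_closed: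
  fixes z :: "complex poly fract"
  assumes "c \<noteq> 0" "\<And>m. to_fract c * z ^ m \<in> range to_fract"
  shows "z \<in> range to_fract"
proof -
  obtain a b where z: "z = to_fract a / to_fract b" "b \<noteq> 0" "coprime a b"
    by (rule fract_coprimeE)
  have pow: "to_fract (x ^ n) = to_fract x ^ n" for x :: "complex poly" and n
    by (induction n) auto
  have "b ^ m dvd c" for m
  proof -
    obtain y where "to_fract c * z ^ m = to_fract y" using assms(2) by blast
    then have "to_fract (c * a ^ m) = to_fract (y * b ^ m)"
      using z(2) by (simp add: z(1) power_divide field_simps pow)
    then have "b ^ m dvd c * a ^ m" unfolding to_fract_eq_iff by simp
    then show ?thesis
      using z(3) by (metis coprime_commute coprime_dvd_mult_left_iff coprime_power_left_iff coprime_power_right_iff)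
  qed
  then have "degree (b ^ Suc (degree c)) \<le> degree c"
    using assms(1) dvd_imp_degree_le by blast
  then have "Suc (degree c) * degree b \<le> degree c" by (simp only: Polynomial.degree_power_eq[OF z(2)])
  then have "degree b = 0" by (cases "degree b") auto
  then have "b dvd a" using z(2) by (metis coprime_iff_gcd_eq_1 is_unit_iff_degree unit_imp_dvd)
  then show ?thesis using z by (auto elim!: dvdE)
qed

section \<open>Schemes of integral domains\<close>

lemma topspace_zariski:
  assumes "is_subring A"
  shows "topspace (zariski A) = spec A"
proof -
  have "\<not> A \<subseteq> p" if "p \<in> spec A" for p
    using that subring_one[OF assms] unfolding spec_def is_prime_ideal_def by blast
  then have "openin (zariski A) (spec A)"
    unfolding openin_zariski[OF assms] by blast
  moreover have "U \<subseteq> spec A" if "openin (zariski A) U" for U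
    using that unfolding openin_zariski[OF assms] by blast
  ultimately show ?thesis unfolding topspace_def by blast
qed

lemma openin_spec: "is_subring A \<Longrightarrow> openin (zariski A) (spec A)"
  by (metis topspace_zariski openin_topspace)

lemma openin_zariski_subset: "is_subring A \<Longrightarrow> openin (zariski A) U \<Longrightarrow> U \<subseteq> spec A"
  by (metis topspace_zariski openin_subset)

lemma specD:
  assumes "p \<in> spec A"
  shows "p \<subseteq> A" "0 \<in> p" "1 \<notin> p"
    "x \<in> p \<Longrightarrow> y \<in> p \<Longrightarrow> x + y \<in> p"
    "x \<in> A \<Longrightarrow> y \<in> p \<Longrightarrow> x * y \<in> p"
    "x \<in> A \<Longrightarrow> y \<in> A \<Longrightarrow> x * y \<in> p \<longleftrightarrow> x \<in> p \<or> y \<in> p"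
proof -
  have id: "is_ideal A p" and pr: "1 \<notin> p" "\<forall>x\<in>A. \<forall>y\<in>A. x * y \<in> p \<longrightarrow> x \<in> p \<or> y \<in> p"
    using assms unfolding spec_def is_prime_ideal_def by auto
  show "p \<subseteq> A" "0 \<in> p" "x \<in> p \<Longrightarrow> y \<in> p \<Longrightarrow> x + y \<in> p"
    using id unfolding is_ideal_def by auto
  show 1: "x \<in> A \<Longrightarrow> y \<in> p \<Longrightarrow> x * y \<in> p" for x y
    using id unfolding is_ideal_def by auto
  show "1 \<notin> p" by fact
  show "x \<in> A \<Longrightarrow> y \<in> A \<Longrightarrow> x * y \<in> p \<longleftrightarrow> x \<in> p \<or> y \<in> p"
    using 1[of x y] 1[of y x] pr(2) by (auto simp: mult.commute)
qed

section \<open>The generic point and prime ideals that avoid a multiplicative set\<close>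

lemma zero_in_spec: "is_subring A \<Longrightarrow> {0} \<in> spec A"
  unfolding spec_def is_prime_ideal_def is_ideal_def by (auto simp: subring_zero)

text \<open>\<open>{0}\<close> is the generic point of the spectrum of a domain; values of sections
  can be compared there.\<close>

lemma zero_in_open:
  assumes "is_subring A" "openin (zariski A) U" "p \<in> U"
  shows "{0} \<in> U"
proof -
  obtain S where S: "S \<subseteq> A" "U = {p \<in> spec A. \<not> S \<subseteq> p}"
    using assms(1,2) unfolding openin_zariski[OF assms(1)] by blast
  then show ?thesis using assms(3) specD(2)[of p A] zero_in_spec[OF assms(1)] by blast
qed

text \<open>An ideal maximal among those that contain \<open>I\<close> and miss \<open>S\<close> is
  prime: if it contains neither \<open>x\<close> nor \<open>y\<close>, adjoining either one makes it
  meet \<open>S\<close>, and the product of the two elements of \<open>S\<close> so found lies in it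
  as soon as \<open>x * y\<close> does.\<close>

lemma prime_ideal_avoiding:
  assumes A: "is_subring A" and I: "is_ideal A I"
    and S: "S \<subseteq> A" "1 \<in> S" "\<And>x y. x \<in> S \<Longrightarrow> y \<in> S \<Longrightarrow> x * y \<in> S" and IS: "I \<inter> S = {}"
  obtains p where "p \<in> spec A" "I \<subseteq> p" "p \<inter> S = {}"
proof -
  let ?\<A> = "{J. is_ideal A J \<and> I \<subseteq> J \<and> J \<inter> S = {}}"
  have "\<exists>M\<in>?\<A>. \<forall>X\<in>?\<A>. M \<subseteq> X \<longrightarrow> X = M"
  proof (rule subset_Zorn_nonempty)
    show "?\<A> \<noteq> {}" using I IS by blast
  next
    fix \<C> assume ne: "\<C> \<noteq> {}" and ch: "subset.chain ?\<A> \<C>"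
    have C: "is_ideal A J" "I \<subseteq> J" "J \<inter> S = {}" if "J \<in> \<C>" for J
      using that ch unfolding subset.chain_def by auto
    have add: "x + y \<in> \<Union>\<C>" if xy: "x \<in> J" "J \<in> \<C>" "y \<in> J'" "J' \<in> \<C>" for x y J J'
    proof -
      have "J \<subseteq> J' \<or> J' \<subseteq> J" using xy ch unfolding subset.chain_def by blast
      then obtain K where "K \<in> \<C>" "x \<in> K" "y \<in> K" using xy by blast
      then show ?thesis using C(1)[of K] unfolding is_ideal_def by blast
    qed
    have "is_ideal A (\<Union>\<C>)"
      unfolding is_ideal_def
    proof (intro conjI ballI)
      show "\<Union>\<C> \<subseteq> A" "0 \<in> \<Union>\<C>" using C(1) ne unfolding is_ideal_def by blast+
      show "x + y \<in> \<Union>\<C>" if "x \<in> \<Union>\<C>" "y \<in> \<Union>\<C>" for x y using that add by blast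
      show "a * x \<in> \<Union>\<C>" if "a \<in> A" "x \<in> \<Union>\<C>" for a x
        using that C(1) unfolding is_ideal_def by blast
    qed
    moreover have "I \<subseteq> \<Union>\<C>" "\<Union>\<C> \<inter> S = {}" using C(2,3) ne by blast+
    ultimately show "\<Union>\<C> \<in> ?\<A>" by blast
  qed
  then obtain p where p': "p \<in> ?\<A>" and max': "\<forall>X\<in>?\<A>. p \<subseteq> X \<longrightarrow> X = p" by (elim bexE)
  have p: "is_ideal A p" "I \<subseteq> p" "p \<inter> S = {}" using p' by auto
  have max: "J = p" if "is_ideal A J" "p \<subseteq> J" "J \<inter> S = {}" for J
    using max' that p(2) by auto
  have pA: "p \<subseteq> A" "0 \<in> p" and padd: "\<And>x y. x \<in> p \<Longrightarrow> y \<in> p \<Longrightarrow> x + y \<in> p"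
    and pmul: "\<And>a x. a \<in> A \<Longrightarrow> x \<in> p \<Longrightarrow> a * x \<in> p"
    using p(1) unfolding is_ideal_def by auto
  have meet: "\<exists>m\<in>p. \<exists>a\<in>A. m + a * x \<in> S" if x: "x \<in> A" "x \<notin> p" for x
  proof -
    let ?J = "{m + a * x | m a. m \<in> p \<and> a \<in> A}"
    have "is_ideal A ?J"
      unfolding is_ideal_def
    proof (intro conjI ballI)
      show "?J \<subseteq> A" using pA x by (auto intro: subring_add[OF A] subring_mult[OF A])
      show "0 \<in> ?J" using pA subring_zero[OF A] by (auto intro!: exI[of _ 0])
      fix u assume "u \<in> ?J"
      then obtain m a where u: "u = m + a * x" "m \<in> p" "a \<in> A" by blast
      show "v \<in> ?J \<Longrightarrow> u + v \<in> ?J" for v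
      proof -
        assume "v \<in> ?J"
        then obtain m' a' where v: "v = m' + a' * x" "m' \<in> p" "a' \<in> A" by blast
        have "u + v = (m + m') + (a + a') * x" using u v by (simp add: algebra_simps)
        then show "u + v \<in> ?J" using u v padd subring_add[OF A] by blast
      qed
      show "c * u \<in> ?J" if "c \<in> A" for c
      proof -
        have "c * u = c * m + (c * a) * x" using u by (simp add: algebra_simps)
        then show ?thesis using that u pmul subring_mult[OF A] by blast
      qed
    qed
    moreover have "p \<subseteq> ?J" using subring_zero[OF A] by force
    moreover have "x \<in> ?J" using pA(2) subring_one[OF A] by force
    ultimately show ?thesis using max[of ?J] x(2) by blast
  qed
  have "x \<in> p \<or> y \<in> p" if xy: "x \<in> A" "y \<in> A" "x * y \<in> p" for x y
  proof (rule ccontr)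
    assume "\<not> (x \<in> p \<or> y \<in> p)"
    then obtain m a n b where m: "m \<in> p" "a \<in> A" "m + a * x \<in> S" and n: "n \<in> p" "b \<in> A" "n + b * y \<in> S"
      using meet[of x] meet[of y] xy by blast
    have "(m + a * x) * (n + b * y) = (n + b * y) * m + ((a * x) * n + (a * b) * (x * y))"
      by (simp add: algebra_simps)
    moreover have "(n + b * y) * m \<in> p" using n(3) S(1) m(1) by (blast intro: pmul)
    moreover have "(a * x) * n \<in> p" using m(2) xy(1) n(1) by (blast intro: pmul subring_mult[OF A])
    moreover have "(a * b) * (x * y) \<in> p" using m(2) n(2) xy(3) by (blast intro: pmul subring_mult[OF A])
    ultimately have "(m + a * x) * (n + b * y) \<in> p" by (auto intro: padd)
    then show False using S(3)[OF m(3) n(3)] p(3) by blast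
  qed
  then have "p \<in> spec A"
    unfolding spec_def is_prime_ideal_def using p(1,3) S(2) by blast
  then show ?thesis using that p by blast
qed

section \<open>Sections of the structure sheaf\<close>

lemma sectionsD:
  assumes "s \<in> sections A U" "p \<in> U"
  obtains W a b where "openin (zariski A) W" "p \<in> W" "W \<subseteq> U" "a \<in> A" "b \<in> A"
    "\<forall>q\<in>W. b \<notin> q \<and> s q = Fract a b"
  using assms unfolding sections_def by blast

lemma const_in_sections:
  assumes A: "is_subring A" and "openin (zariski A) U" "a \<in> A"
  shows "(\<lambda>q\<in>U. to_fract a) \<in> sections A U"
proof -
  have "1 \<notin> q \<and> (\<lambda>q\<in>U. to_fract a) q = Fract a 1" if "q \<in> U" for q
    using that openin_zariski_subset[OF assms(1,2)] specD(3)[of q A] by (auto simp: to_fract_def)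
  then show ?thesis
    unfolding sections_def using assms subring_one[OF A] by (auto intro!: exI[of _ U])
qed

abbreviation const_section :: "'a::idom set \<Rightarrow> 'a \<Rightarrow> 'a set \<Rightarrow> 'a fract" where
  "const_section A a \<equiv> (\<lambda>q\<in>spec A. to_fract a)"

text \<open>Sections are constant because any two nonempty open sets meet in the generic point; a
  constant \<open>x\<close> is in the ring because the ideal of its denominators lies in no prime ideal.\<close>

lemma global_sectionE:
  assumes A: "is_subring A" and s: "s \<in> sections A (spec A)"
  obtains a where "a \<in> A" "s = const_section A a"
proof -
  define x where "x = s {0}"
  have loc: "\<exists>a\<in>A. \<exists>b\<in>A. b \<notin> p \<and> x = Fract a b \<and> s p = x" if pA: "p \<in> spec A" for p
  proof -
    obtain W a b where W: "openin (zariski A) W" "p \<in> W" "W \<subseteq> spec A" "a \<in> A" "b \<in> A"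
      "\<forall>q\<in>W. b \<notin> q \<and> s q = Fract a b"
      by (rule sectionsD[OF s pA])
    have "{0} \<in> W" by (rule zero_in_open[OF A W(1,2)])
    then show ?thesis using W(2,4,5) bspec[OF W(6) W(2)] bspec[OF W(6), of "{0}"] unfolding x_def by metis
  qed
  define I where "I = {b \<in> A. \<exists>a\<in>A. to_fract b * x = to_fract a}"
  have I: "is_ideal A I"
    unfolding is_ideal_def
  proof (intro conjI ballI)
    show "I \<subseteq> A" "0 \<in> I" unfolding I_def using subring_zero[OF A] by (auto intro!: bexI[of _ 0])
    fix u assume u: "u \<in> I"
    then obtain a where a: "u \<in> A" "a \<in> A" "to_fract u * x = to_fract a" unfolding I_def by blast
    show "u + v \<in> I" if v: "v \<in> I" for v
    proof -
      obtain b where b: "v \<in> A" "b \<in> A" "to_fract v * x = to_fract b" using v unfolding I_def by blast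
      have "to_fract (u + v) * x = to_fract (a + b)" using a b by (simp add: algebra_simps)
      then show ?thesis using a b subring_add[OF A] unfolding I_def by blast
    qed
    show "c * u \<in> I" if "c \<in> A" for c
    proof -
      have "to_fract (c * u) * x = to_fract (c * a)" using a by (simp add: mult.assoc)
      then show ?thesis using a that subring_mult[OF A] unfolding I_def by blast
    qed
  qed
  have "1 \<in> I"
  proof (rule ccontr)
    assume "1 \<notin> I"
    then obtain p where p: "p \<in> spec A" "I \<subseteq> p"
      using prime_ideal_avoiding[OF A I, of "{1}"] subring_one[OF A] by auto
    obtain a b where ab: "a \<in> A" "b \<in> A" "b \<notin> p" "x = Fract a b" using loc[OF p(1)] by blast
    then have "b \<noteq> 0" using specD(2)[OF p(1)] by auto
    then have "to_fract b * x = to_fract a" using ab by (simp add: Fract_conv_to_fract)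
    then show False using ab p(2) unfolding I_def by blast
  qed
  then obtain a where a: "a \<in> A" "x = to_fract a" unfolding I_def by auto
  have "s = const_section A a"
  proof
    fix q show "s q = const_section A a q"
      using s loc[of q] a(2) unfolding sections_def extensional_def by (cases "q \<in> spec A") auto
  qed
  then show ?thesis using that a by blast
qed

section \<open>Ring homomorphisms and the morphisms that they induce\<close>

lemma ring_hom_onD:
  assumes "ring_hom_on B A \<theta>"
  shows "x \<in> B \<Longrightarrow> \<theta> x \<in> A" "\<theta> 1 = 1"
    "x \<in> B \<Longrightarrow> y \<in> B \<Longrightarrow> \<theta> (x + y) = \<theta> x + \<theta> y"
    "x \<in> B \<Longrightarrow> y \<in> B \<Longrightarrow> \<theta> (x * y) = \<theta> x * \<theta> y"
  using assms unfolding ring_hom_on_def by auto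

lemma ring_hom_on_zero: "is_subring B \<Longrightarrow> ring_hom_on B A \<theta> \<Longrightarrow> \<theta> 0 = 0"
  using ring_hom_onD(3)[of B A \<theta> 0 0] subring_zero[of B]
  by (metis add_cancel_right_right add.right_neutral)

lemma ring_hom_on_uminus: "is_subring B \<Longrightarrow> ring_hom_on B A \<theta> \<Longrightarrow> x \<in> B \<Longrightarrow> \<theta> (- x) = - \<theta> x"
  using ring_hom_onD(3)[of B A \<theta> x "- x"] subring_uminus[of B x] ring_hom_on_zero[of B A \<theta>]
  by (simp add: add_eq_0_iff)

lemma ring_hom_on_power: "is_subring B \<Longrightarrow> ring_hom_on B A \<theta> \<Longrightarrow> x \<in> B \<Longrightarrow> \<theta> (x ^ n) = \<theta> x ^ n"
  by (induction n) (simp_all add: ring_hom_onD(2,4) subring_power)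

lemma ring_hom_on_comp:
  "ring_hom_on C B \<eta> \<Longrightarrow> ring_hom_on B A \<theta> \<Longrightarrow> ring_hom_on C A (\<lambda>x. \<theta> (\<eta> x))"
  unfolding ring_hom_on_def by (auto simp: image_subset_iff)

lemma ring_hom_on_inv_into:
  assumes B: "is_subring B" and \<theta>: "ring_hom_on B A \<theta>" and bij: "bij_betw \<theta> B A"
  shows "ring_hom_on A B (inv_into B \<theta>)"
proof -
  have inB: "inv_into B \<theta> x \<in> B" and inv: "\<theta> (inv_into B \<theta> x) = x" if "x \<in> A" for x
    using that bij by (auto simp: bij_betw_def inv_into_into f_inv_into_f)
  have eq: "inv_into B \<theta> (\<theta> y) = y" if "y \<in> B" for y
    using that bij by (auto simp: bij_betw_def)
  show ?thesis unfolding ring_hom_on_def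
  proof (intro conjI ballI)
    show "inv_into B \<theta> ` A \<subseteq> B" using inB by blast
    show "inv_into B \<theta> 1 = 1" using eq[OF subring_one[OF B]] ring_hom_onD(2)[OF \<theta>] by simp
    fix x y assume xy: "x \<in> A" "y \<in> A"
    show "inv_into B \<theta> (x + y) = inv_into B \<theta> x + inv_into B \<theta> y"
      using eq[OF subring_add[OF B inB inB], OF xy] ring_hom_onD(3)[OF \<theta> inB inB, OF xy]
      by (simp add: inv xy)
    show "inv_into B \<theta> (x * y) = inv_into B \<theta> x * inv_into B \<theta> y"
      using eq[OF subring_mult[OF B inB inB], OF xy] ring_hom_onD(4)[OF \<theta> inB inB, OF xy]
      by (simp add: inv xy)
  qed
qed

lemma spec_pullback:
  assumes B: "is_subring B" and \<theta>: "ring_hom_on B A \<theta>" and p: "p \<in> spec A"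
  shows "{b \<in> B. \<theta> b \<in> p} \<in> spec B"
  unfolding spec_def is_prime_ideal_def is_ideal_def
  using specD[OF p] ring_hom_onD[OF \<theta>] subring_zero[OF B] ring_hom_on_zero[OF B \<theta>]
  by (auto intro: subring_add[OF B] subring_mult[OF B])

text \<open>Two representatives of a fraction cross-multiply in \<open>B\<close>, and
  \<open>\<theta>\<close> carries this identity to \<open>A\<close>; the denominators are nonzero
  because their images avoid \<open>p\<close>.\<close>

lemma local_map_eq:
  assumes \<theta>: "ring_hom_on B A \<theta>" and B: "is_subring B" and p: "p \<in> spec A"
    and ab: "a \<in> B" "b \<in> B" "\<theta> b \<notin> p"
  shows "local_map B p \<theta> (Fract a b) = Fract (\<theta> a) (\<theta> b)"
  unfolding local_map_def
proof (rule the_equality)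
  show "\<exists>a'\<in>B. \<exists>b'\<in>B. \<theta> b' \<notin> p \<and> Fract a b = Fract a' b' \<and> Fract (\<theta> a) (\<theta> b) = Fract (\<theta> a') (\<theta> b')"
    using ab by blast
  fix y assume "\<exists>a'\<in>B. \<exists>b'\<in>B. \<theta> b' \<notin> p \<and> Fract a b = Fract a' b' \<and> y = Fract (\<theta> a') (\<theta> b')"
  then obtain a' b' where ab': "a' \<in> B" "b' \<in> B" "\<theta> b' \<notin> p" "Fract a b = Fract a' b'" "y = Fract (\<theta> a') (\<theta> b')"
    by blast
  have nz: "\<theta> b \<noteq> 0" "\<theta> b' \<noteq> 0" using ab(3) ab'(3) specD(2)[OF p] by auto
  then have "b \<noteq> 0" "b' \<noteq> 0" using ring_hom_on_zero[OF B \<theta>] by auto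
  then have "a * b' = a' * b" using ab'(4) by (simp add: eq_fract)
  then have "\<theta> a * \<theta> b' = \<theta> a' * \<theta> b" using ring_hom_onD(4)[OF \<theta>] ab ab' by metis
  then show "y = Fract (\<theta> a) (\<theta> b)" using nz ab'(5) by (simp add: eq_fract)
qed

lemma fst_spec_map: "fst (spec_map A B \<theta>) p = {b \<in> B. \<theta> b \<in> p}"
  by (simp add: spec_map_def Let_def)

lemma preim_spec_map: "preim A (spec_map A B \<theta>) U = {p \<in> spec A. {b \<in> B. \<theta> b \<in> p} \<in> U}"
  by (simp add: preim_def fst_spec_map)

lemma snd_spec_map:
  "snd (spec_map A B \<theta>) U s =
     (\<lambda>p\<in>{p \<in> spec A. {b \<in> B. \<theta> b \<in> p} \<in> U}. local_map B p \<theta> (s {b \<in> B. \<theta> b \<in> p}))"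
  by (simp add: spec_map_def Let_def)

lemma openin_pullback:
  assumes A: "is_subring A" and B: "is_subring B" and \<theta>: "ring_hom_on B A \<theta>" and U: "openin (zariski B) U"
  shows "openin (zariski A) {p \<in> spec A. {b \<in> B. \<theta> b \<in> p} \<in> U}"
proof -
  obtain S where S: "S \<subseteq> B" "U = {p \<in> spec B. \<not> S \<subseteq> p}"
    using U unfolding openin_zariski[OF B] by blast
  have "{p \<in> spec A. {b \<in> B. \<theta> b \<in> p} \<in> U} = {p \<in> spec A. \<not> \<theta> ` S \<subseteq> p}"
  proof (intro Collect_cong conj_cong refl)
    fix p assume "p \<in> spec A"
    then have "{b \<in> B. \<theta> b \<in> p} \<in> U \<longleftrightarrow> \<not> S \<subseteq> {b \<in> B. \<theta> b \<in> p}"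
      using S(2) spec_pullback[OF B \<theta>, of p] by simp
    also have "\<dots> \<longleftrightarrow> \<not> \<theta> ` S \<subseteq> p" using S(1) by auto
    finally show "{b \<in> B. \<theta> b \<in> p} \<in> U \<longleftrightarrow> \<not> \<theta> ` S \<subseteq> p" .
  qed
  moreover have "\<theta> ` S \<subseteq> A" using S(1) ring_hom_onD(1)[OF \<theta>] by blast
  ultimately show ?thesis unfolding openin_zariski[OF A] by (intro exI[of _ "\<theta> ` S"] conjI)
qed

text \<open>Near a point a section is a single fraction, so each condition reduces to
  \<open>local_map_eq\<close> for that fraction.\<close>

lemma scheme_morphism_spec_map:
  assumes A: "is_subring A" and B: "is_subring B" and \<theta>: "ring_hom_on B A \<theta>"
  shows "scheme_morphism A B (spec_map A B \<theta>)"
proof -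
  let ?f = "\<lambda>p. {b \<in> B. \<theta> b \<in> p}"
  note pb = spec_pullback[OF B \<theta>]
  note lm = local_map_eq[OF \<theta> B]
  have germ: "\<exists>a\<in>B. \<exists>b\<in>B. \<theta> b \<notin> p \<and> \<theta> b \<noteq> 0 \<and> b \<noteq> 0 \<and> s (?f p) = Fract a b"
    if sU: "s \<in> sections B U" "p \<in> spec A" "?f p \<in> U" for s U p
  proof -
    obtain W a b where W: "openin (zariski B) W" "?f p \<in> W" "W \<subseteq> U" "a \<in> B" "b \<in> B"
      "\<forall>q\<in>W. b \<notin> q \<and> s q = Fract a b"
      by (rule sectionsD[OF sU(1,3)])
    then have "a \<in> B" "b \<in> B" "\<theta> b \<notin> p" "s (?f p) = Fract a b" using bspec[OF W(6) W(2)] by auto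
    moreover have "\<theta> b \<noteq> 0" using \<open>\<theta> b \<notin> p\<close> specD(2)[OF sU(2)] by auto
    ultimately show ?thesis using ring_hom_on_zero[OF B \<theta>] by metis
  qed
  show ?thesis
    unfolding scheme_morphism_def preim_spec_map
  proof (intro conjI allI impI ballI)
    show "continuous_map (zariski A) (zariski B) (fst (spec_map A B \<theta>))"
      unfolding continuous_map_def topspace_zariski[OF A] topspace_zariski[OF B] fst_spec_map
    proof (intro conjI allI impI)
      show "(\<lambda>p. ?f p) \<in> spec A \<rightarrow> spec B" using pb by blast
      show "openin (zariski A) {p \<in> spec A. ?f p \<in> U}" if "openin (zariski B) U" for U
        by (rule openin_pullback[OF A B \<theta> that])
    qed
  next
    fix U assume U: "openin (zariski B) U"
    let ?V = "{p \<in> spec A. ?f p \<in> U}"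
    show "snd (spec_map A B \<theta>) U ` sections B U \<subseteq> sections A ?V"
    proof (rule image_subsetI)
      fix s assume s: "s \<in> sections B U"
      show "snd (spec_map A B \<theta>) U s \<in> sections A ?V"
        unfolding sections_def mem_Collect_eq
      proof (intro conjI ballI)
        show "snd (spec_map A B \<theta>) U s \<in> extensional ?V" by (simp add: snd_spec_map)
        fix p assume p: "p \<in> ?V"
        then have fp: "?f p \<in> U" by simp
        obtain W a b where W: "openin (zariski B) W" "?f p \<in> W" "W \<subseteq> U" "a \<in> B" "b \<in> B"
      "\<forall>q\<in>W. b \<notin> q \<and> s q = Fract a b"
      by (rule sectionsD[OF s fp])
        have "\<theta> b \<notin> q \<and> snd (spec_map A B \<theta>) U s q = Fract (\<theta> a) (\<theta> b)"
          if "q \<in> {p \<in> spec A. ?f p \<in> W}" for q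
        proof -
          have q: "q \<in> spec A" "?f q \<in> W" "?f q \<in> U" using that W(3) by auto
          then have "\<theta> b \<notin> q" "s (?f q) = Fract a b" using bspec[OF W(6) q(2)] W(5) by auto
          then show ?thesis using q lm[OF q(1) W(4,5)] by (simp add: snd_spec_map)
        qed
        moreover have "{p \<in> spec A. ?f p \<in> W} \<subseteq> ?V" using W(3) by blast
        ultimately show "\<exists>W. openin (zariski A) W \<and> p \<in> W \<and> W \<subseteq> ?V \<and>
            (\<exists>a\<in>A. \<exists>b\<in>A. \<forall>q\<in>W. b \<notin> q \<and> snd (spec_map A B \<theta>) U s q = Fract a b)"
          using openin_pullback[OF A B \<theta> W(1)] p W(2) ring_hom_onD(1)[OF \<theta> W(4)] ring_hom_onD(1)[OF \<theta> W(5)]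
          by (intro exI[of _ "{p \<in> spec A. ?f p \<in> W}"] conjI bexI[of _ "\<theta> a"] bexI[of _ "\<theta> b"] ballI) simp_all
      qed
    qed
    have "local_map B p \<theta> 1 = 1" if "p \<in> spec A" for p
      using lm[OF that, of 1 1] specD(3)[OF that] subring_one[OF B] ring_hom_onD(2)[OF \<theta>]
      by (simp add: One_fract_def)
    then show "snd (spec_map A B \<theta>) U (\<lambda>q\<in>U. 1) = (\<lambda>p\<in>?V. 1)"
      by (auto simp: snd_spec_map fun_eq_iff)
    fix s assume s: "s \<in> sections B U"
    {
      fix t assume t: "t \<in> sections B U"
      have "local_map B p \<theta> (s (?f p) + t (?f p)) = local_map B p \<theta> (s (?f p)) + local_map B p \<theta> (t (?f p))
        \<and> local_map B p \<theta> (s (?f p) * t (?f p)) = local_map B p \<theta> (s (?f p)) * local_map B p \<theta> (t (?f p))"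
        if p: "p \<in> spec A" "?f p \<in> U" for p
      proof -
        obtain a b where ab: "a \<in> B" "b \<in> B" "\<theta> b \<notin> p" "\<theta> b \<noteq> 0" "b \<noteq> 0" "s (?f p) = Fract a b"
          using germ[OF s p] by blast
        obtain c d where cd: "c \<in> B" "d \<in> B" "\<theta> d \<notin> p" "\<theta> d \<noteq> 0" "d \<noteq> 0" "t (?f p) = Fract c d"
          using germ[OF t p] by blast
        have in_B: "a * d + c * b \<in> B" "b * d \<in> B" "a * c \<in> B" "a * d \<in> B" "c * b \<in> B"
          using ab cd by (auto intro: subring_add[OF B] subring_mult[OF B])
        have "\<theta> (b * d) \<notin> p"
          using ab cd specD(6)[OF p(1)] ring_hom_onD(1,4)[OF \<theta>] by metis
        then have "local_map B p \<theta> (Fract (a * d + c * b) (b * d)) = Fract (\<theta> (a * d + c * b)) (\<theta> (b * d))"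
          "local_map B p \<theta> (Fract (a * c) (b * d)) = Fract (\<theta> (a * c)) (\<theta> (b * d))"
          using lm[OF p(1)] in_B by auto
        then show ?thesis using ab cd in_B lm[OF p(1)] ring_hom_onD(3,4)[OF \<theta>] by simp
      qed
      then show "snd (spec_map A B \<theta>) U (\<lambda>q\<in>U. s q + t q) =
            (\<lambda>p\<in>?V. snd (spec_map A B \<theta>) U s p + snd (spec_map A B \<theta>) U t p)"
        "snd (spec_map A B \<theta>) U (\<lambda>q\<in>U. s q * t q) =
            (\<lambda>p\<in>?V. snd (spec_map A B \<theta>) U s p * snd (spec_map A B \<theta>) U t p)"
        by (auto simp: snd_spec_map fun_eq_iff)
    next
      fix W assume "openin (zariski B) W \<and> W \<subseteq> U"
      then show "snd (spec_map A B \<theta>) W (restrict s W) =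
          restrict (snd (spec_map A B \<theta>) U s) {p \<in> spec A. ?f p \<in> W}"
        by (auto simp: snd_spec_map fun_eq_iff)
    next
      fix p assume "p \<in> ?V"
      then have p: "p \<in> spec A" "?f p \<in> U" by auto
      obtain a b where ab: "a \<in> B" "b \<in> B" "\<theta> b \<notin> p" "\<theta> b \<noteq> 0" "b \<noteq> 0" "s (?f p) = Fract a b"
        using germ[OF s p] by blast
      \<comment> \<open>The numerator alone decides membership in the maximal ideal. The ring
        \<open>R\<close> is arbitrary because the claim is applied in \<open>A\<close> and in
        \<open>B\<close>.\<close>
      have loc: "Fract c d \<in> local_max_ideal R q \<longleftrightarrow> c \<in> q"
        if q: "q \<in> spec R" "c \<in> R" "d \<in> R" "d \<notin> q" for c d q and R :: "'z::idom set"
      proof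
        assume "Fract c d \<in> local_max_ideal R q"
        then obtain c' d' where cd: "Fract c d = Fract c' d'" "c' \<in> q" "d' \<in> R" "d' \<notin> q"
          unfolding local_max_ideal_def by blast
        then have "d \<noteq> 0" "d' \<noteq> 0" using q specD(2)[OF q(1)] by auto
        then have "c * d' = c' * d" using cd(1) by (simp add: eq_fract)
        also have "\<dots> \<in> q" using cd q specD(5)[OF q(1), of d c'] by (simp add: mult.commute)
        finally show "c \<in> q" using specD(6)[OF q(1)] cd q by blast
      qed (use q in \<open>auto simp: local_max_ideal_def\<close>)
      show "snd (spec_map A B \<theta>) U s p \<in> local_max_ideal A p \<longleftrightarrow>
          s (fst (spec_map A B \<theta>) p) \<in> local_max_ideal B (fst (spec_map A B \<theta>) p)"
        using loc[OF p(1), of "\<theta> a" "\<theta> b"] loc[OF pb[OF p(1)], of a b] ab p lm[OF p(1)] ring_hom_onD(1)[OF \<theta>]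
        by (simp add: snd_spec_map fst_spec_map)
    }
  qed
qed

lemma morph_eq_sym: "morph_eq A B \<phi> \<psi> \<Longrightarrow> morph_eq A B \<psi> \<phi>"
  unfolding morph_eq_def by auto

lemma morph_eq_trans: "morph_eq A B \<phi> \<psi> \<Longrightarrow> morph_eq A B \<psi> \<chi> \<Longrightarrow> morph_eq A B \<phi> \<chi>"
  unfolding morph_eq_def by auto

lemma morph_eq_spec_map_id:
  assumes A: "is_subring A" and \<theta>: "\<And>x. x \<in> A \<Longrightarrow> \<theta> x = x"
  shows "morph_eq A A (spec_map A A \<theta>) morph_id"
  unfolding morph_eq_def
proof (intro conjI ballI allI impI)
  have hom: "ring_hom_on A A \<theta>"
    unfolding ring_hom_on_def using A by (auto simp: \<theta> subring_one subring_add subring_mult)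
  have pb: "{b \<in> A. \<theta> b \<in> p} = p" if "p \<in> spec A" for p
    using specD(1)[OF that] \<theta> by auto
  then show "fst (spec_map A A \<theta>) p = fst morph_id p" if "p \<in> spec A" for p
    using that by (simp add: fst_spec_map morph_id_def)
  fix U s assume U: "openin (zariski A) U" and s: "s \<in> sections A U"
  show "snd (spec_map A A \<theta>) U s = snd morph_id U s"
  proof
    fix p
    show "snd (spec_map A A \<theta>) U s p = snd morph_id U s p"
    proof (cases "p \<in> U")
      case True
      then have p: "p \<in> spec A" using openin_zariski_subset[OF A U] by blast
      obtain W a b where W: "openin (zariski A) W" "p \<in> W" "W \<subseteq> U" "a \<in> A" "b \<in> A"
      "\<forall>q\<in>W. b \<notin> q \<and> s q = Fract a b"
      by (rule sectionsD[OF s True])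
      then have "local_map A p \<theta> (s p) = s p"
        using local_map_eq[OF hom A p, of a b] \<theta> bspec[OF W(6) W(2)] by simp
      then show ?thesis using True p pb by (simp add: snd_spec_map morph_id_def)
    next
      case False
      \<comment> \<open>Sections are compared as functions; off \<open>U\<close> both are
        \<open>undefined\<close> by extensionality.\<close>
      then have "s p = undefined" using s by (auto simp: sections_def extensional_def)
      moreover have "p \<notin> {p \<in> spec A. {b \<in> A. \<theta> b \<in> p} \<in> U}" using False pb by auto
      ultimately show ?thesis unfolding snd_spec_map morph_id_def restrict_def by (auto simp only: if_False snd_conv)
    qed
  qed
qed

text \<open>\<open>\<zeta>\<close> is constrained only on \<open>C\<close>, so that the same fact
  covers identities and equivariance, where a composite is known only on a subring.\<close>

lemma morph_comp_spec_map:
  assumes A: "is_subring A" and B: "is_subring B" and C: "is_subring C"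
    and \<eta>: "ring_hom_on C B \<eta>" and \<theta>: "ring_hom_on B A \<theta>"
    and \<zeta>: "\<And>x. x \<in> C \<Longrightarrow> \<zeta> x = \<theta> (\<eta> x)"
  shows "morph_eq A C (morph_comp B (spec_map B C \<eta>) (spec_map A B \<theta>)) (spec_map A C \<zeta>)"
proof -
  have hom: "ring_hom_on C A \<zeta>"
    using ring_hom_on_comp[OF \<eta> \<theta>] subring_add[OF C] subring_mult[OF C] subring_one[OF C]
    unfolding ring_hom_on_def by (auto simp: \<zeta>)
  have pb: "{c \<in> C. \<eta> c \<in> {b \<in> B. \<theta> b \<in> p}} = {c \<in> C. \<zeta> c \<in> p}" for p
    using \<zeta> ring_hom_onD(1)[OF \<eta>] by auto
  show ?thesis
    unfolding morph_eq_def
  proof (intro conjI ballI allI impI)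
    show "fst (morph_comp B (spec_map B C \<eta>) (spec_map A B \<theta>)) p = fst (spec_map A C \<zeta>) p" for p
      by (simp only: morph_comp_def fst_conv o_def fst_spec_map pb)
    fix U s assume U: "openin (zariski C) U" and s: "s \<in> sections C U"
    show "snd (morph_comp B (spec_map B C \<eta>) (spec_map A B \<theta>)) U s = snd (spec_map A C \<zeta>) U s"
    proof
      fix p
      let ?q = "{b \<in> B. \<theta> b \<in> p}" and ?r = "{c \<in> C. \<zeta> c \<in> p}"
      show "snd (morph_comp B (spec_map B C \<eta>) (spec_map A B \<theta>)) U s p = snd (spec_map A C \<zeta>) U s p"
      proof (cases "p \<in> spec A \<and> ?r \<in> U")
        case True
        then have q: "?q \<in> spec B" using spec_pullback[OF B \<theta>] by blast
        obtain W a b where W: "openin (zariski C) W" "?r \<in> W" "W \<subseteq> U" "a \<in> C" "b \<in> C"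
      "\<forall>q\<in>W. b \<notin> q \<and> s q = Fract a b"
      by (rule sectionsD[OF s conjunct2[OF True]])
        have ab: "a \<in> C" "b \<in> C" "b \<notin> ?r" "s ?r = Fract a b" using W(4,5) bspec[OF W(6) W(2)] by auto
        then have "\<eta> b \<notin> ?q" "\<theta> (\<eta> b) \<notin> p" "\<zeta> b \<notin> p" using \<zeta> by auto
        then show ?thesis
          using True q ab local_map_eq[OF \<eta> C q, of a b] local_map_eq[OF \<theta> B, of p "\<eta> a" "\<eta> b"]
            local_map_eq[OF hom C, of p a b] ring_hom_onD(1)[OF \<eta>]
          by (simp add: morph_comp_def snd_spec_map preim_spec_map pb[simplified] \<zeta>)
      next
        case False
        then show ?thesis using spec_pullback[OF B \<theta>, of p]
          by (auto simp: morph_comp_def snd_spec_map preim_spec_map pb[simplified])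
      qed
    qed
  qed
qed

lemma scheme_iso_spec_map:
  assumes A: "is_subring A" and B: "is_subring B" and \<theta>: "ring_hom_on B A \<theta>" and bij: "bij_betw \<theta> B A"
  shows "scheme_iso A B (spec_map A B \<theta>)"
proof -
  let ?\<psi> = "spec_map B A (inv_into B \<theta>)"
  note inv = ring_hom_on_inv_into[OF B \<theta> bij]
  have "morph_eq A A (morph_comp B ?\<psi> (spec_map A B \<theta>)) (spec_map A A (\<lambda>x. x))"
    using bij by (intro morph_comp_spec_map[OF A B A inv \<theta>]) (auto simp: bij_betw_def f_inv_into_f)
  moreover have "morph_eq B B (morph_comp A (spec_map A B \<theta>) ?\<psi>) (spec_map B B (\<lambda>x. x))"
    using bij by (intro morph_comp_spec_map[OF B A B \<theta> inv]) (auto simp: bij_betw_def)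
  ultimately show ?thesis
    unfolding scheme_iso_def
    using scheme_morphism_spec_map[OF A B \<theta>] scheme_morphism_spec_map[OF B A inv]
      morph_eq_trans[OF _ morph_eq_spec_map_id[OF A refl]] morph_eq_trans[OF _ morph_eq_spec_map_id[OF B refl]]
    by blast
qed

section \<open>Recovering ring homomorphisms from morphisms\<close>

lemma scheme_morphismD:
  assumes "scheme_morphism A B \<phi>" "openin (zariski B) U"
  shows "s \<in> sections B U \<Longrightarrow> snd \<phi> U s \<in> sections A (preim A \<phi> U)"
    "snd \<phi> U (\<lambda>q\<in>U. 1) = (\<lambda>p\<in>preim A \<phi> U. 1)"
    "s \<in> sections B U \<Longrightarrow> s' \<in> sections B U \<Longrightarrow>
      snd \<phi> U (\<lambda>q\<in>U. s q + s' q) = (\<lambda>p\<in>preim A \<phi> U. snd \<phi> U s p + snd \<phi> U s' p)"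
    "s \<in> sections B U \<Longrightarrow> s' \<in> sections B U \<Longrightarrow>
      snd \<phi> U (\<lambda>q\<in>U. s q * s' q) = (\<lambda>p\<in>preim A \<phi> U. snd \<phi> U s p * snd \<phi> U s' p)"
proof -
  have *: "snd \<phi> U ` sections B U \<subseteq> sections A (preim A \<phi> U) \<and>
        snd \<phi> U (\<lambda>q\<in>U. 1) = (\<lambda>p\<in>preim A \<phi> U. 1) \<and>
        (\<forall>s\<in>sections B U. \<forall>t\<in>sections B U.
           snd \<phi> U (\<lambda>q\<in>U. s q + t q) = (\<lambda>p\<in>preim A \<phi> U. snd \<phi> U s p + snd \<phi> U t p) \<and>
           snd \<phi> U (\<lambda>q\<in>U. s q * t q) = (\<lambda>p\<in>preim A \<phi> U. snd \<phi> U s p * snd \<phi> U t p))"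
    using assms unfolding scheme_morphism_def by (elim conjE allE[of _ U] impE) simp_all
  show "s \<in> sections B U \<Longrightarrow> snd \<phi> U s \<in> sections A (preim A \<phi> U)"
    using conjunct1[OF *] by (rule subsetD) (rule imageI)
  show "snd \<phi> U (\<lambda>q\<in>U. 1) = (\<lambda>p\<in>preim A \<phi> U. 1)"
    using * by (elim conjE)
  show "s \<in> sections B U \<Longrightarrow> s' \<in> sections B U \<Longrightarrow>
      snd \<phi> U (\<lambda>q\<in>U. s q + s' q) = (\<lambda>p\<in>preim A \<phi> U. snd \<phi> U s p + snd \<phi> U s' p)"
    using * by (elim conjE) (drule (1) bspec, drule (1) bspec, elim conjE)
  show "s \<in> sections B U \<Longrightarrow> s' \<in> sections B U \<Longrightarrow>
      snd \<phi> U (\<lambda>q\<in>U. s q * s' q) = (\<lambda>p\<in>preim A \<phi> U. snd \<phi> U s p * snd \<phi> U s' p)"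
    using * by (elim conjE) (drule (1) bspec, drule (1) bspec, elim conjE)
qed

lemma preim_spec:
  assumes A: "is_subring A" and B: "is_subring B" and \<phi>: "scheme_morphism A B \<phi>"
  shows "preim A \<phi> (spec B) = spec A"
proof -
  have "continuous_map (zariski A) (zariski B) (fst \<phi>)"
    using \<phi> unfolding scheme_morphism_def by (rule conjunct1)
  then show ?thesis
    unfolding continuous_map_def topspace_zariski[OF A] topspace_zariski[OF B] preim_def by blast
qed

lemma spec_map_global_section:
  assumes A: "is_subring A" and B: "is_subring B" and \<theta>: "ring_hom_on B A \<theta>" and b: "b \<in> B"
  shows "snd (spec_map A B \<theta>) (spec B) (const_section B b) = const_section A (\<theta> b)"
proof
  fix p
  show "snd (spec_map A B \<theta>) (spec B) (const_section B b) p = const_section A (\<theta> b) p"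
    using spec_pullback[OF B \<theta>, of p] local_map_eq[OF \<theta> B, of p b 1] b subring_one[OF B]
      specD(3)[of p A] ring_hom_onD(2)[OF \<theta>]
    by (cases "p \<in> spec A") (simp_all add: snd_spec_map to_fract_def)
qed

lemma const_section_eq_iff:
  "is_subring A \<Longrightarrow> (\<lambda>q\<in>spec A. x) = (\<lambda>q\<in>spec A. y) \<longleftrightarrow> x = y"
  using zero_in_spec[of A] by (auto simp: fun_eq_iff)

text \<open>Global sections are constant, so the image of the constant section of \<open>b\<close>
  is the constant section of some element of \<open>A\<close>, and this defines
  \<open>\<theta>\<close>. Constants are told apart at the generic point.\<close>

lemma scheme_morphism_global_sections:
  assumes A: "is_subring A" and B: "is_subring B" and \<phi>: "scheme_morphism A B \<phi>"
  obtains \<theta> where "ring_hom_on B A \<theta>"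
    "\<forall>b\<in>B. snd \<phi> (spec B) (const_section B b) = const_section A (\<theta> b)"
proof -
  note pre = preim_spec[OF A B \<phi>]
  note oB = openin_spec[OF B]
  note cs = const_in_sections[OF B oB]
  have "\<exists>a\<in>A. snd \<phi> (spec B) (const_section B b) = const_section A a" if "b \<in> B" for b
  proof -
    have "snd \<phi> (spec B) (const_section B b) \<in> sections A (spec A)"
      using scheme_morphismD(1)[OF \<phi> oB cs[OF that]] unfolding pre .
    then show ?thesis using global_sectionE[OF A] by metis
  qed
  then obtain \<theta> where \<theta>: "\<And>b. b \<in> B \<Longrightarrow> \<theta> b \<in> A"
    "\<forall>b\<in>B. snd \<phi> (spec B) (const_section B b) = const_section A (\<theta> b)"
    by metis
  have "const_section A (\<theta> 1) = const_section A 1"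
    using scheme_morphismD(2)[OF \<phi> oB] bspec[OF \<theta>(2) subring_one[OF B]] unfolding pre by simp
  then have one: "\<theta> 1 = 1" unfolding const_section_eq_iff[OF A] to_fract_eq_iff .
  have "\<theta> (x + y) = \<theta> x + \<theta> y \<and> \<theta> (x * y) = \<theta> x * \<theta> y" if xy: "x \<in> B" "y \<in> B" for x y
  proof -
    let ?s = "const_section B"
    have eq: "?s (x + y) = (\<lambda>q\<in>spec B. ?s x q + ?s y q)" "?s (x * y) = (\<lambda>q\<in>spec B. ?s x q * ?s y q)"
      by (auto simp: fun_eq_iff)
    have "snd \<phi> (spec B) (\<lambda>q\<in>spec B. ?s x q + ?s y q) =
        (\<lambda>p\<in>spec A. snd \<phi> (spec B) (?s x) p + snd \<phi> (spec B) (?s y) p)"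
      "snd \<phi> (spec B) (\<lambda>q\<in>spec B. ?s x q * ?s y q) =
        (\<lambda>p\<in>spec A. snd \<phi> (spec B) (?s x) p * snd \<phi> (spec B) (?s y) p)"
      using scheme_morphismD(3,4)[OF \<phi> oB cs[OF xy(1)] cs[OF xy(2)]] unfolding pre .
    then have "const_section A (\<theta> (x + y)) = const_section A (\<theta> x + \<theta> y)"
      "const_section A (\<theta> (x * y)) = const_section A (\<theta> x * \<theta> y)"
      unfolding eq[symmetric] bspec[OF \<theta>(2) xy(1)] bspec[OF \<theta>(2) xy(2)]
        bspec[OF \<theta>(2) subring_add[OF B xy]] bspec[OF \<theta>(2) subring_mult[OF B xy]]
      by (simp_all add: restrict_def fun_eq_iff)
    then show ?thesis unfolding const_section_eq_iff[OF A] to_fract_eq_iff by blast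
  qed
  then have "ring_hom_on B A \<theta>" unfolding ring_hom_on_def using \<theta>(1) one by blast
  then show ?thesis using that \<theta>(2) by blast
qed

text \<open>Both composites act as the identity on constant sections, which makes the two induced
  homomorphisms inverse to each other.\<close>

lemma scheme_iso_global_sections:
  assumes A: "is_subring A" and B: "is_subring B" and iso: "scheme_iso A B \<phi>"
  obtains \<theta> where "ring_hom_on B A \<theta>" "bij_betw \<theta> B A"
    "\<forall>b\<in>B. snd \<phi> (spec B) (const_section B b) = const_section A (\<theta> b)"
proof -
  obtain \<psi> where \<phi>: "scheme_morphism A B \<phi>" and \<psi>: "scheme_morphism B A \<psi>"
    and AA: "morph_eq A A (morph_comp B \<psi> \<phi>) morph_id" and BB: "morph_eq B B (morph_comp A \<phi> \<psi>) morph_id"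
    using iso unfolding scheme_iso_def by blast
  obtain \<theta> where \<theta>: "ring_hom_on B A \<theta>"
    "\<forall>b\<in>B. snd \<phi> (spec B) (const_section B b) = const_section A (\<theta> b)"
    by (rule scheme_morphism_global_sections[OF A B \<phi>])
  obtain \<eta> where \<eta>: "ring_hom_on A B \<eta>"
    "\<forall>a\<in>A. snd \<psi> (spec A) (const_section A a) = const_section B (\<eta> a)"
    by (rule scheme_morphism_global_sections[OF B A \<psi>])
  have 1: "\<theta> (\<eta> a) = a" if "a \<in> A" for a
  proof -
    have "snd \<phi> (preim B \<psi> (spec A)) (snd \<psi> (spec A) (const_section A a)) = const_section A a"
      using AA openin_spec[OF A] const_in_sections[OF A openin_spec[OF A] that]
      unfolding morph_eq_def morph_comp_def morph_id_def by simp
    then have "const_section A (\<theta> (\<eta> a)) = const_section A a"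
      using that \<theta>(2) \<eta>(2) ring_hom_onD(1)[OF \<eta>(1)] preim_spec[OF B A \<psi>] by simp
    then show ?thesis unfolding const_section_eq_iff[OF A] to_fract_eq_iff .
  qed
  have 2: "\<eta> (\<theta> b) = b" if "b \<in> B" for b
  proof -
    have "snd \<psi> (preim A \<phi> (spec B)) (snd \<phi> (spec B) (const_section B b)) = const_section B b"
      using BB openin_spec[OF B] const_in_sections[OF B openin_spec[OF B] that]
      unfolding morph_eq_def morph_comp_def morph_id_def by simp
    then have "const_section B (\<eta> (\<theta> b)) = const_section B b"
      using that \<theta>(2) \<eta>(2) ring_hom_onD(1)[OF \<theta>(1)] preim_spec[OF A B \<phi>] by simp
    then show ?thesis unfolding const_section_eq_iff[OF B] to_fract_eq_iff .
  qed
  have "bij_betw \<theta> B A"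
    by (rule bij_betw_byWitness[of _ \<eta>]) (use 1 2 ring_hom_onD(1)[OF \<theta>(1)] ring_hom_onD(1)[OF \<eta>(1)] in auto)
  then show ?thesis using that \<theta> by blast
qed

section \<open>Fractions and graded subrings\<close>

lemma ring_hom_on_sum:
  assumes "is_subring B" "ring_hom_on B A \<theta>" "\<And>i. i \<in> I \<Longrightarrow> f i \<in> B"
  shows "\<theta> (sum f I) = (\<Sum>i\<in>I. \<theta> (f i))"
  using assms(3)
proof (induction I rule: infinite_finite_induct)
  case (insert i I)
  then show ?case using ring_hom_onD(3)[OF assms(2), of "f i" "sum f I"] subring_sum[OF assms(1), of I f]
    by auto
qed (simp_all add: ring_hom_on_zero[OF assms(1,2)])

lemma is_subring_UNIV: "is_subring UNIV"
  by (simp add: is_subring_def)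

lemma is_subring_image:
  assumes B: "is_subring B" and \<theta>: "ring_hom_on B A \<theta>"
  shows "is_subring (\<theta> ` B)"
  unfolding is_subring_def
proof (intro conjI ballI)
  show "1 \<in> \<theta> ` B" using ring_hom_onD(2)[OF \<theta>] subring_one[OF B] by (metis imageI)
  fix x y assume "x \<in> \<theta> ` B" "y \<in> \<theta> ` B"
  then obtain a b where ab: "x = \<theta> a" "a \<in> B" "y = \<theta> b" "b \<in> B" by blast
  have "\<theta> (a - b) = \<theta> a - \<theta> b"
    using ring_hom_onD(3)[OF \<theta>, of a "- b"] ring_hom_on_uminus[OF B \<theta> ab(4)] subring_uminus[OF B ab(4)] ab
    by simp
  then show "x - y \<in> \<theta> ` B" using ab subring_diff[OF B ab(2,4)] by (metis imageI)
  show "x * y \<in> \<theta> ` B" using ab ring_hom_onD(4)[OF \<theta> ab(2,4)] subring_mult[OF B ab(2,4)] by (metis imageI)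
qed

lemma ring_hom_to_fract: "ring_hom_on UNIV UNIV to_fract"
  by (simp add: ring_hom_on_def)

lemma to_fract_power: "to_fract (x ^ n) = to_fract x ^ n"
  using ring_hom_on_power[OF is_subring_UNIV ring_hom_to_fract] by simp

lemma subring_range_to_fract: "is_subring (range to_fract)"
  by (rule is_subring_image[OF is_subring_UNIV ring_hom_to_fract])

section \<open>Extension of homomorphisms to fraction fields\<close>

lemma ring_hom_eval:
  fixes h :: "'a::idom \<Rightarrow> 'b::idom"
  assumes h: "ring_hom_on UNIV UNIV h"
  shows "ring_hom_on UNIV UNIV (\<lambda>f. poly (map_poly h f) y)"
proof -
  interpret h: comm_ring_hom h
    using h ring_hom_on_zero[OF is_subring_UNIV h] by unfold_locales (auto simp: ring_hom_on_def)
  interpret map_poly_comm_ring_hom h ..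
  show ?thesis by (simp add: ring_hom_on_def hom_distribs)
qed

text \<open>The extension of an injective homomorphism to the fraction field, computed from the
  reduced fraction so that no choice is involved. It serves for both maps out of C[t]: into C(t,u)
  and into the fraction field of the given surface.\<close>

definition fract_ext :: "('a::{factorial_ring_gcd, semiring_gcd_mult_normalize} \<Rightarrow> 'f::field) \<Rightarrow> 'a fract \<Rightarrow> 'f" where
  "fract_ext h z = h (fst (quot_of_fract z)) / h (snd (quot_of_fract z))"

definition eval_ext :: "('a::{factorial_ring_gcd, semiring_gcd_mult_normalize} \<Rightarrow> 'f::field) \<Rightarrow> 'f \<Rightarrow> 'a fract poly \<Rightarrow> 'f" where
  "eval_ext h y f = poly (map_poly (fract_ext h) f) y"

context
  fixes h :: "'a::{factorial_ring_gcd, semiring_gcd_mult_normalize} \<Rightarrow> 'f::field"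
  assumes h: "ring_hom_on UNIV UNIV h" and inj: "inj h"
begin

lemma inj_hom_eq_zero_iff: "h x = 0 \<longleftrightarrow> x = 0"
  using inj ring_hom_on_zero[OF is_subring_UNIV h] by (metis injD)

text \<open>Replaces the reduced fraction by an arbitrary one; injectivity of \<open>h\<close> keeps
  the denominators nonzero.\<close>

lemma fract_ext_divide:
  assumes "b \<noteq> 0"
  shows "fract_ext h (to_fract a / to_fract b) = h a / h b"
proof -
  let ?q = "quot_of_fract (to_fract a / to_fract b)"
  have nz: "snd ?q \<noteq> 0" by simp
  have "to_fract (fst ?q) / to_fract (snd ?q) = to_fract a / to_fract b"
    by (simp flip: Fract_conv_to_fract)
  then have "to_fract (fst ?q * b) = to_fract (a * snd ?q)"
    using nz assms by (simp add: frac_eq_eq)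
  then have "fst ?q * b = a * snd ?q" unfolding to_fract_eq_iff .
  then have "h (fst ?q) * h b = h a * h (snd ?q)"
    using ring_hom_onD(4)[OF h UNIV_I UNIV_I] by metis
  then show ?thesis
    using nz assms by (simp add: fract_ext_def frac_eq_eq inj_hom_eq_zero_iff)
qed

lemma fract_ext_to_fract: "fract_ext h (to_fract a) = h a"
  using fract_ext_divide[of 1 a] ring_hom_onD(2)[OF h] by simp

lemma ring_hom_fract_ext: "ring_hom_on UNIV UNIV (fract_ext h)"
  unfolding ring_hom_on_def
proof (intro conjI ballI)
  show "fract_ext h 1 = 1" using fract_ext_to_fract[of 1] ring_hom_onD(2)[OF h] by simp
  fix x y :: "'a fract"
  obtain a b c d where x: "x = to_fract a / to_fract b" "b \<noteq> 0" and y: "y = to_fract c / to_fract d" "d \<noteq> 0"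
    by (metis fract_coprimeE)
  have add: "x + y = to_fract (a * d + c * b) / to_fract (b * d)"
    using x y by (simp add: add_frac_eq)
  have mult: "x * y = to_fract (a * c) / to_fract (b * d)"
    using x y by simp
  have bd: "b * d \<noteq> 0" using x y by simp
  show "fract_ext h (x + y) = fract_ext h x + fract_ext h y"
  proof -
    have "fract_ext h (x + y) = h (a * d + c * b) / h (b * d)"
      unfolding add by (rule fract_ext_divide[OF bd])
    also have "\<dots> = h a / h b + h c / h d"
      using x(2) y(2) ring_hom_onD(3,4)[OF h] by (simp add: add_frac_eq inj_hom_eq_zero_iff)
    finally show ?thesis using fract_ext_divide[OF x(2), of a] fract_ext_divide[OF y(2), of c] x(1) y(1) by simp
  qed
  show "fract_ext h (x * y) = fract_ext h x * fract_ext h y"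
  proof -
    have "fract_ext h (x * y) = h (a * c) / h (b * d)"
      unfolding mult by (rule fract_ext_divide[OF bd])
    also have "\<dots> = h a / h b * (h c / h d)"
      using ring_hom_onD(4)[OF h] by simp
    finally show ?thesis using fract_ext_divide[OF x(2), of a] fract_ext_divide[OF y(2), of c] x(1) y(1) by simp
  qed
qed simp

lemma fract_ext_eq_zero_iff: "fract_ext h z = 0 \<longleftrightarrow> z = 0"
proof -
  obtain a b where z: "z = to_fract a / to_fract b" "b \<noteq> 0" by (rule fract_coprimeE)
  then show ?thesis by (simp add: fract_ext_divide inj_hom_eq_zero_iff)
qed

lemma inj_fract_ext: "inj (fract_ext h)"
proof (rule injI)
  fix x y assume eq: "fract_ext h x = fract_ext h y"
  have "fract_ext h (x + - y) = fract_ext h x + fract_ext h (- y)"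
    by (rule ring_hom_onD(3)[OF ring_hom_fract_ext UNIV_I UNIV_I])
  then have "fract_ext h (x - y) = 0"
    using eq ring_hom_on_uminus[OF is_subring_UNIV ring_hom_fract_ext, of y] by simp
  then show "x = y" unfolding fract_ext_eq_zero_iff by simp
qed

lemma ring_hom_eval_ext: "ring_hom_on UNIV UNIV (eval_ext h y)"
  using ring_hom_eval[OF ring_hom_fract_ext, of y] by (simp add: eval_ext_def[abs_def])

lemma eval_ext_monom: "eval_ext h y (monom r n) = fract_ext h r * y ^ n"
  unfolding eval_ext_def using ring_hom_on_zero[OF is_subring_UNIV ring_hom_fract_ext]
  by (simp add: map_poly_monom poly_monom)

end

text \<open>For z = a/b the single denominator b^N serves all powers: write m = N k + l with l < N;
  then z^(N k) is a polynomial and b^N clears z^l.\<close>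

lemma poly_root_closed:
  fixes z :: "complex poly fract"
  assumes "0 < N" "z ^ N \<in> range to_fract"
  shows "z \<in> range to_fract"
proof -
  obtain a b where z: "z = to_fract a / to_fract b" "b \<noteq> 0" by (rule fract_coprimeE)
  show ?thesis
  proof (rule poly_completely_integrally_closed)
    show "b ^ N \<noteq> 0" using z by simp
    fix m
    define k l where "k = m div N" and "l = m mod N"
    have m: "m = N * k + l" "l \<le> N" using assms(1) by (simp_all add: k_def l_def)
    have "b ^ N = b ^ (N - l) * b ^ l" using m(2) by (simp flip: power_add)
    then have "to_fract (b ^ N) * z ^ m = (z ^ N) ^ k * (to_fract b ^ (N - l) * (to_fract b ^ l * z ^ l))"
      unfolding m(1) by (simp add: to_fract_power power_add power_mult mult_ac)
    also have "to_fract b ^ l * z ^ l = to_fract (a ^ l)"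
      using z by (simp add: to_fract_power power_divide)
    finally have "to_fract (b ^ N) * z ^ m = (z ^ N) ^ k * (to_fract b ^ (N - l) * to_fract (a ^ l))" .
    also have "\<dots> \<in> range to_fract"
      using subring_power[OF subring_range_to_fract assms(2), of k]
      by (rule subring_mult[OF subring_range_to_fract]) (simp flip: to_fract_power to_fract_mult)
    finally show "to_fract (b ^ N) * z ^ m \<in> range to_fract" .
  qed
qed

text \<open>The part of degree \<open>n\<close> of \<^const>\<open>A_plus\<close> \<open>d P\<close> will be \<open>M u\<^sup>n\<close> with
  \<open>M = coeff_set d P n\<close>; denominators of \<open>e\<close> are needed in the construction of
  \<open>(d, P)\<close>.\<close>

definition coeff_set :: "nat \<Rightarrow> complex poly fract \<Rightarrow> nat \<Rightarrow> complex poly fract set" where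
  "coeff_set N e n = {r. r ^ N * e ^ n \<in> range to_fract}"

lemma coeff_set_mult:
  assumes "r \<in> coeff_set N e n" "s \<in> coeff_set N e m"
  shows "r * s \<in> coeff_set N e (n + m)"
proof -
  have "(r * s) ^ N * e ^ (n + m) = (r ^ N * e ^ n) * (s ^ N * e ^ m)"
    by (simp add: power_mult_distrib power_add)
  then show ?thesis using assms subring_mult[OF subring_range_to_fract]
    unfolding coeff_set_def mem_Collect_eq by (simp only:)
qed

lemma coeff_set_zero: "0 < N \<Longrightarrow> 0 \<in> coeff_set N e n"
  unfolding coeff_set_def using subring_zero[OF subring_range_to_fract] by (simp add: power_0_left)

lemma coeff_set_to_fract: "to_fract p \<in> coeff_set N e 0"
  unfolding coeff_set_def by (simp flip: to_fract_power)

text \<open>Each term \<open>r\<^sup>k s\<^sup>N\<^sup>-\<^sup>k e\<^sup>n\<close> of the binomial expansion has its \<open>N\<close>-th power in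
  \<open>\<complex>[t]\<close>.\<close>

lemma coeff_set_add:
  assumes N: "0 < N" and r: "r \<in> coeff_set N e n" and s: "s \<in> coeff_set N e n"
  shows "r + s \<in> coeff_set N e n"
proof -
  have "r ^ k * s ^ (N - k) * e ^ n \<in> range to_fract" if "k \<le> N" for k
  proof (rule poly_root_closed[OF N])
    have "(r ^ k * s ^ (N - k) * e ^ n) ^ N = (r ^ N) ^ k * (s ^ N) ^ (N - k) * (e ^ n) ^ N"
      by (simp add: power_mult_distrib mult.commute flip: power_mult)
    also have "(e ^ n) ^ N = (e ^ n) ^ k * (e ^ n) ^ (N - k)"
      using that by (simp flip: power_add)
    finally have "(r ^ k * s ^ (N - k) * e ^ n) ^ N = (r ^ N * e ^ n) ^ k * (s ^ N * e ^ n) ^ (N - k)"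
      by (simp add: power_mult_distrib)
    moreover have "(r ^ N * e ^ n) ^ k * (s ^ N * e ^ n) ^ (N - k) \<in> range to_fract"
      using r s unfolding coeff_set_def mem_Collect_eq
      by (rule subring_mult[OF subring_range_to_fract subring_power[OF subring_range_to_fract] subring_power[OF subring_range_to_fract]])
    ultimately show "(r ^ k * s ^ (N - k) * e ^ n) ^ N \<in> range to_fract" by (simp only:)
  qed
  moreover have "(of_nat m :: complex poly fract) \<in> range to_fract" for m
    by (induction m) (auto intro: subring_add[OF subring_range_to_fract] subring_one[OF subring_range_to_fract] subring_zero[OF subring_range_to_fract])
  moreover have "(r + s) ^ N * e ^ n = (\<Sum>k\<le>N. of_nat (N choose k) * (r ^ k * s ^ (N - k) * e ^ n))"
    by (simp add: binomial_ring sum_distrib_right mult.assoc)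
  ultimately show ?thesis unfolding coeff_set_def mem_Collect_eq
    by (simp only:) (rule subring_sum[OF subring_range_to_fract], rule subring_mult[OF subring_range_to_fract], simp_all)
qed

lemma coeff_set_sum:
  "0 < N \<Longrightarrow> (\<And>i. i \<in> I \<Longrightarrow> r i \<in> coeff_set N e n) \<Longrightarrow> sum r I \<in> coeff_set N e n"
  by (induction I rule: infinite_finite_induct) (auto intro: coeff_set_zero coeff_set_add)

lemma coeff_set_smult: "r \<in> coeff_set N e n \<Longrightarrow> to_fract p * r \<in> coeff_set N e n"
  using coeff_set_mult[OF coeff_set_to_fract, of r N e n p] by simp

lemma coeff_set_uminus: "r \<in> coeff_set N e n \<Longrightarrow> - r \<in> coeff_set N e n"
  using coeff_set_smult[of r N e n "-1"] by simp

text \<open>The common model of both sides: its variable becomes \<open>u_var\<close> on the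
  standard surface and a homogeneous fraction of degree one on the given one.\<close>

definition graded_subring :: "nat \<Rightarrow> complex poly \<Rightarrow> complex poly fract poly set" where
  "graded_subring d P = {f. \<forall>i. coeff f i \<in> coeff_set d (to_fract P) i}"

lemma in_graded_subringD: "f \<in> graded_subring d P \<Longrightarrow> coeff f i \<in> coeff_set d (to_fract P) i"
  by (simp add: graded_subring_def)

lemma is_subring_graded_subring:
  assumes "0 < d"
  shows "is_subring (graded_subring d P)"
  unfolding is_subring_def
proof (intro conjI ballI)
  show "1 \<in> graded_subring d P"
    using coeff_set_to_fract[of 1] coeff_set_zero[OF assms]
    by (auto simp: graded_subring_def coeff_1)
  fix f g assume f: "f \<in> graded_subring d P" and g: "g \<in> graded_subring d P"
  have "coeff f i + - coeff g i \<in> coeff_set d (to_fract P) i" for i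
    using f g by (intro coeff_set_add[OF assms] coeff_set_uminus) (auto simp: graded_subring_def)
  then show "f - g \<in> graded_subring d P" by (simp add: graded_subring_def)
  have "coeff f k * coeff g (i - k) \<in> coeff_set d (to_fract P) i" if "k \<le> i" for i k
  proof -
    have "coeff f k * coeff g (i - k) \<in> coeff_set d (to_fract P) (k + (i - k))"
      using f g by (intro coeff_set_mult) (auto simp: graded_subring_def)
    then show ?thesis using that by simp
  qed
  then show "f * g \<in> graded_subring d P"
    by (auto simp: graded_subring_def coeff_mult intro!: coeff_set_sum[OF assms])
qed

lemma monom_in_graded_subring:
  "0 < d \<Longrightarrow> r \<in> coeff_set d (to_fract P) n \<Longrightarrow> monom r n \<in> graded_subring d P"
  by (auto simp: graded_subring_def coeff_set_zero)

text \<open>The leading term of an element whose powers have a common denominator is in the ring, and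
  subtracting it preserves this property.\<close>

lemma graded_subring_completely_integrally_closed:
  assumes d: "0 < d" and P: "P \<noteq> 0" and c: "c \<in> graded_subring d P" "c \<noteq> 0"
    and f: "\<And>m. c * f ^ m \<in> graded_subring d P"
  shows "f \<in> graded_subring d P"
  using f
proof (induction "degree f" arbitrary: f rule: less_induct)
  case less
  note R = is_subring_graded_subring[OF d, of P]
  let ?r = "lead_coeff f" and ?n = "degree f" and ?e = "to_fract P"
  show ?case
  proof (cases "f = 0")
    case True
    then show ?thesis using subring_zero[OF R] by simp
  next
    case False
    have "lead_coeff c \<in> coeff_set d ?e (degree c)" using c(1) by (simp add: graded_subring_def)
    then obtain c0 where c0: "lead_coeff c ^ d * ?e ^ degree c = to_fract c0"
      unfolding coeff_set_def by auto
    then have "to_fract c0 \<noteq> 0" using c(2) P by (metis leading_coeff_0_iff mult_eq_0_iff power_eq_0_iff to_fract_eq_0_iff)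
    then have "c0 \<noteq> 0" by simp
    \<comment> \<open>Leading coefficients are multiplicative, so the common denominator
      \<open>c\<close> for the powers of \<open>f\<close> yields the common denominator
      \<open>c0\<close> for those of \<open>?r ^ d * ?e ^ ?n\<close>.\<close>
    moreover have "to_fract c0 * (?r ^ d * ?e ^ ?n) ^ m \<in> range to_fract" for m
    proof -
      have "degree (c * f ^ m) = degree c + m * ?n" 
        using c(2) False by (simp add: degree_mult_eq Polynomial.degree_power_eq)
      moreover have "coeff (c * f ^ m) (degree (c * f ^ m)) = lead_coeff c * ?r ^ m"
        by (simp add: lead_coeff_mult lead_coeff_power)
      ultimately have "lead_coeff c * ?r ^ m \<in> coeff_set d ?e (degree c + m * ?n)"
        using less.prems[of m] by (metis in_graded_subringD)
      moreover have "(lead_coeff c * ?r ^ m) ^ d * ?e ^ (degree c + m * ?n) = to_fract c0 * (?r ^ d * ?e ^ ?n) ^ m"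
        unfolding c0[symmetric] by (simp add: power_mult_distrib power_add mult_ac flip: power_mult)
      ultimately show ?thesis unfolding coeff_set_def by simp
    qed
    ultimately have "?r ^ d * ?e ^ ?n \<in> range to_fract"
      by (rule poly_completely_integrally_closed)
    then have "?r \<in> coeff_set d ?e ?n" by (simp add: coeff_set_def)
    then have g: "monom ?r ?n \<in> graded_subring d P" by (rule monom_in_graded_subring[OF d])
    let ?f = "f - monom ?r ?n"
    have cf: "c * ?f ^ m \<in> graded_subring d P" for m
    proof -
      have "(of_nat k :: complex poly fract poly) \<in> graded_subring d P" for k
        by (induction k) (auto intro: subring_add[OF R] subring_one[OF R] subring_zero[OF R])
      moreover have "c * ?f ^ m = (\<Sum>k\<le>m. of_nat (m choose k) * ((c * f ^ k) * (- monom ?r ?n) ^ (m - k)))"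
      proof -
        have "?f ^ m = (f + - monom ?r ?n) ^ m" by simp
        also have "\<dots> = (\<Sum>k\<le>m. of_nat (m choose k) * f ^ k * (- monom ?r ?n) ^ (m - k))"
          by (rule binomial_ring)
        finally show ?thesis by (simp add: sum_distrib_left mult_ac)
      qed
      ultimately show ?thesis
        using less.prems g by (simp only:) (rule subring_sum[OF R], rule subring_mult[OF R], assumption,
          rule subring_mult[OF R], assumption, rule subring_power[OF R], rule subring_uminus[OF R])
    qed
    have "?f \<in> graded_subring d P"
    \<comment> \<open>In degree zero the leading term is all of \<open>f\<close>, and no descent in
      degree is available.\<close>
    proof (cases "?n = 0")
      case True
      then have "?f = 0" by (metis coeff_0_degree_minus_1 degree_0_id diff_self monom_0)
      then show ?thesis using subring_zero[OF R] by simp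
    next
      case False
      have "degree ?f \<le> ?n" by (intro degree_diff_le) (simp_all add: degree_monom_le)
      moreover have "degree ?f \<noteq> ?n"
      proof
        assume *: "degree ?f = ?n"
        have "coeff ?f ?n = 0" by simp
        then have "?f = 0" using * by (metis leading_coeff_0_iff)
        then show False using * False by simp
      qed
      ultimately have "degree ?f < ?n" by simp
      then show ?thesis by (rule less.hyps[OF _ cf])
    qed
    then show ?thesis using subring_add[OF R _ g, of ?f] by simp
  qed
qed

text \<open>If an integral equation has degree n, then b^n clears x^m for m < n, and the equation
  expresses higher powers through lower ones with coefficients in \<open>B\<close>.\<close>

lemma integral_over_common_denominator:
  fixes B :: "'f::field set"
  assumes B: "is_subring B" and x: "integral_over B x" and ab: "x = a / b" "a \<in> B" "b \<in> B" "b \<noteq> 0"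
  obtains c where "c \<in> B" "c \<noteq> 0" "\<forall>m. c * x ^ m \<in> B"
proof -
  obtain n k where n: "0 < n" "\<And>i. k i \<in> B" "x ^ n = (\<Sum>i<n. k i * x ^ i)"
    using integral_over_power_eq[OF B x] by metis
  have "b ^ n * x ^ m \<in> B" for m
  proof (induction m rule: less_induct)
    case (less m)
    show ?case
    proof (cases "m < n")
      case True
      then have "b ^ n = b ^ (n - m) * b ^ m" by (simp flip: power_add)
      then have "b ^ n * x ^ m = b ^ (n - m) * a ^ m" using ab by (simp add: power_divide)
      then show ?thesis using ab subring_mult[OF B] subring_power[OF B] by metis
    next
      case False
      then have "x ^ m = x ^ n * x ^ (m - n)" by (simp flip: power_add)
      then have "b ^ n * x ^ m = (\<Sum>i<n. k i * (b ^ n * x ^ (i + (m - n))))"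
        unfolding n(3) by (simp add: sum_distrib_left sum_distrib_right power_add mult_ac)
      moreover have "k i * (b ^ n * x ^ (i + (m - n))) \<in> B" if "i \<in> {..<n}" for i
        using that False by (intro subring_mult[OF B n(2)] less.IH) auto
      ultimately show ?thesis using subring_sum[OF B, of "{..<n}"] by (simp only:)
    qed
  qed
  then show ?thesis using that[of "b ^ n"] ab subring_power[OF B] by auto
qed

lemma integral_over_mono: "integral_over A x \<Longrightarrow> A \<subseteq> B \<Longrightarrow> integral_over B x"
  unfolding integral_over_def by blast

section \<open>The normalization of the standard surface\<close>

abbreviation const_t :: "complex poly \<Rightarrow> ratfun" where
  "const_t p \<equiv> to_fract [:p:]"

abbreviation eval_tu :: "complex poly fract poly \<Rightarrow> ratfun" where
  "eval_tu \<equiv> eval_ext const_t u_var"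

lemma ring_hom_const_t: "ring_hom_on UNIV UNIV const_t"
proof -
  have "const_t 1 = 1" by (metis one_pCons to_fract_1)
  then show ?thesis by (simp add: ring_hom_on_def flip: to_fract_add to_fract_mult)
qed

lemma inj_const_t: "inj const_t"
  by (rule injI) simp

lemmas ring_hom_eval_tu = ring_hom_eval_ext[OF ring_hom_const_t inj_const_t, of u_var]
lemmas eval_tu_add = ring_hom_onD(3)[OF ring_hom_eval_tu UNIV_I UNIV_I]
lemmas eval_tu_mult = ring_hom_onD(4)[OF ring_hom_eval_tu UNIV_I UNIV_I]
lemmas eval_tu_power = ring_hom_on_power[OF is_subring_UNIV ring_hom_eval_tu UNIV_I]
lemmas eval_tu_monom = eval_ext_monom[OF ring_hom_const_t inj_const_t, of u_var]
lemmas fract_ext_const_t = fract_ext_to_fract[OF ring_hom_const_t inj_const_t]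

lemma fract_poly_pCons: "fract_poly (pCons a g) = pCons (to_fract a) (fract_poly g)"
  by (rule poly_eqI) (simp add: coeff_map_poly coeff_pCons split: nat.split)

lemma eval_tu_const: "eval_tu [:to_fract p:] = const_t p"
  using eval_tu_monom[of "to_fract p" 0] by (simp add: monom_0 fract_ext_const_t)

lemma eval_tu_fract_poly: "eval_tu (fract_poly g) = to_fract g"
proof (induction g)
  case 0
  show ?case using ring_hom_on_zero[OF is_subring_UNIV ring_hom_eval_tu] by simp
next
  case (pCons a g)
  have "fract_poly (pCons a g) = [:to_fract a:] + monom 1 1 * fract_poly g"
    by (simp add: fract_poly_pCons monom_altdef)
  then have "eval_tu (fract_poly (pCons a g)) = const_t a + u_var * to_fract g"
    using pCons.IH ring_hom_onD(2)[OF ring_hom_fract_ext[OF ring_hom_const_t inj_const_t]]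
    by (simp only: eval_tu_add eval_tu_mult eval_tu_const eval_tu_monom mult_1 power_one_right)
  also have "\<dots> = to_fract (pCons a g)"
    unfolding u_var_def by (simp flip: to_fract_add to_fract_mult)
  finally show ?case .
qed

lemma clear_denominators:
  fixes f :: "complex poly fract poly"
  obtains p g where "p \<noteq> 0" "Polynomial.smult (to_fract p) f = fract_poly g"
proof -
  obtain a b where k: "fract_content f = to_fract a / to_fract b" "b \<noteq> 0" by (rule fract_coprimeE)
  have "Polynomial.smult (to_fract b) f = Polynomial.smult (to_fract b) (Polynomial.smult (fract_content f) (fract_poly (primitive_part_fract f)))"
    by (simp add: content_times_primitive_part_fract)
  also have "\<dots> = fract_poly (Polynomial.smult a (primitive_part_fract f))"
    using k by simp
  finally show ?thesis using that k(2) by blast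
qed

lemma eval_tu_smult: "eval_tu (Polynomial.smult (to_fract p) f) = const_t p * eval_tu f"
proof -
  have "Polynomial.smult (to_fract p) f = [:to_fract p:] * f" by simp
  then show ?thesis by (simp only: eval_tu_mult eval_tu_const)
qed

lemma eval_tu_denominator:
  obtains p g where "p \<noteq> 0" "const_t p * eval_tu f = to_fract g"
  by (metis clear_denominators eval_tu_fract_poly eval_tu_smult)

text \<open>Multiplication by a polynomial in \<open>t\<close> moves the value into C[t][u], where
  evaluation at \<open>u_var\<close> is the embedding into fractions.\<close>

lemma inj_eval_tu: "inj eval_tu"
proof (rule injI)
  fix f g assume eq: "eval_tu f = eval_tu g"
  obtain p k where p: "p \<noteq> 0" "Polynomial.smult (to_fract p) (f - g) = fract_poly k"
    by (rule clear_denominators)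
  have "eval_tu (f - g) + eval_tu g = eval_tu f" by (simp flip: eval_tu_add)
  then have "eval_tu (f - g) = 0" using eq by simp
  then have "to_fract k = 0" using eval_tu_smult[of p "f - g"] p(2) by (simp add: eval_tu_fract_poly)
  then have "Polynomial.smult (to_fract p) (f - g) = 0" using p(2) by simp
  then show "f = g" using p(1) by simp
qed

text \<open>The range is C(t)[u]. For x = a/b in lowest terms, each power of \<open>b\<close>
  divides \<open>g\<close> times a polynomial in \<open>t\<close> alone. Such a factor has degree 0
  in u, so \<open>b\<close> has degree 0 in u as well and is invertible in C(t)[u].\<close>

lemma eval_tu_completely_integrally_closed:
  assumes c: "c \<noteq> 0" "\<And>m. eval_tu c * x ^ m \<in> range eval_tu"
  shows "x \<in> range eval_tu"
proof -
  obtain a b where x: "x = to_fract a / to_fract b" "b \<noteq> 0" "coprime a b" by (rule fract_coprimeE)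
  obtain p g where p: "p \<noteq> 0" "const_t p * eval_tu c = to_fract g" by (rule eval_tu_denominator)
  have "eval_tu c \<noteq> 0"
    using c(1) inj_eval_tu ring_hom_on_zero[OF is_subring_UNIV ring_hom_eval_tu] by (metis injD)
  then have g0: "g \<noteq> 0" using p by auto
  have "degree (b ^ m) \<le> degree g" for m
  proof -
    obtain y where y: "eval_tu c * x ^ m = eval_tu y" using c(2) by blast
    obtain q k where q: "q \<noteq> 0" "const_t q * eval_tu y = to_fract k" by (rule eval_tu_denominator)
    have "const_t q * (to_fract g * x ^ m) = const_t p * to_fract k"
      unfolding p(2)[symmetric] q(2)[symmetric] y[symmetric] by (simp add: mult_ac)
    then have "const_t q * to_fract g * to_fract a ^ m = const_t p * to_fract k * to_fract b ^ m"
      using x(2) unfolding x(1) by (simp add: power_divide field_simps)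
    then have "to_fract ([:q:] * g * a ^ m) = to_fract ([:p:] * k * b ^ m)"
      by (simp only: to_fract_mult to_fract_power)
    then have "[:q:] * g * a ^ m = [:p:] * k * b ^ m" unfolding to_fract_eq_iff .
    then have "b ^ m dvd ([:q:] * g) * a ^ m" by (metis dvd_triv_right)
    then have "b ^ m dvd [:q:] * g"
      using x(3) by (metis coprime_commute coprime_dvd_mult_left_iff coprime_power_left_iff coprime_power_right_iff)
    then have "degree (b ^ m) \<le> degree ([:q:] * g)"
      using q(1) g0 by (intro dvd_imp_degree_le) auto
    also have "\<dots> = degree g" using q(1) by simp
    finally show ?thesis .
  qed
  from this[of "Suc (degree g)"] have "Suc (degree g) * degree b \<le> degree g"
    by (simp only: Polynomial.degree_power_eq[OF x(2)])
  then have "degree b = 0" by (cases "degree b") auto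
  then obtain b0 where b0: "b = [:b0:]" by (rule degree_eq_zeroE)
  then have "b0 \<noteq> 0" using x(2) by simp
  have "const_t b0 * eval_tu (Polynomial.smult (inverse (to_fract b0)) (fract_poly a)) = to_fract a"
    unfolding eval_tu_smult[symmetric] using \<open>b0 \<noteq> 0\<close> by (simp add: eval_tu_fract_poly)
  then have "x = eval_tu (Polynomial.smult (inverse (to_fract b0)) (fract_poly a))"
    using \<open>b0 \<noteq> 0\<close> unfolding x(1) b0 by (metis nonzero_mult_div_cancel_left to_fract_eq_0_iff pCons_eq_0_iff)
  then show ?thesis by blast
qed

lemma ring_hom_eval_v: "ring_hom_on UNIV UNIV (eval_v d P)"
  using ring_hom_eval[OF ring_hom_to_fract] unfolding eval_v_def .

lemma B_plus_subring: "is_subring (B_plus d P)"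
  unfolding B_plus_def by (rule is_subring_image[OF is_subring_UNIV ring_hom_eval_v])

lemma to_fract_in_B_plus: "to_fract g \<in> B_plus d P"
proof -
  have "eval_v d P [:g:] = to_fract g" by (simp add: eval_v_def fract_poly_pCons)
  then show ?thesis unfolding B_plus_def by (metis rangeI)
qed

lemma v_in_B_plus: "u_var ^ d / const_t P \<in> B_plus d P"
proof -
  have "eval_v d P [:0, 1:] = u_var ^ d / const_t P" by (simp add: eval_v_def fract_poly_pCons poly_embed_tu)
  then show ?thesis unfolding B_plus_def by (metis rangeI)
qed

lemma fract_poly_in_graded_subring: "0 < d \<Longrightarrow> fract_poly g \<in> graded_subring d P"
  unfolding graded_subring_def coeff_set_def by (simp add: coeff_map_poly flip: to_fract_power to_fract_mult)

lemma is_subring_eval_tu_image: "0 < d \<Longrightarrow> is_subring (eval_tu ` graded_subring d P)"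
  by (rule is_subring_image[OF is_subring_graded_subring])
    (use ring_hom_eval_tu in \<open>auto simp: ring_hom_on_def\<close>)

text \<open>The generator v = u^d / P has coefficient 1/P in degree \<open>d\<close>, which is
  admissible since (1/P)^d P^d = 1.\<close>

lemma B_plus_subset:
  assumes d: "0 < d" and P: "P \<noteq> 0"
  shows "B_plus d P \<subseteq> eval_tu ` graded_subring d P"
proof -
  note R = is_subring_eval_tu_image[OF d, of P]
  have g: "to_fract g \<in> eval_tu ` graded_subring d P" for g
    using fract_poly_in_graded_subring[OF d, of g P] eval_tu_fract_poly[of g] by (metis imageI)
  have "1 / to_fract P \<in> coeff_set d (to_fract P) d"
    unfolding coeff_set_def using P subring_one[OF subring_range_to_fract] by (simp add: power_divide)
  then have "monom (1 / to_fract P) d \<in> graded_subring d P" by (rule monom_in_graded_subring[OF d])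
  moreover have "eval_tu (monom (1 / to_fract P) d) = u_var ^ d / const_t P"
    using fract_ext_divide[OF ring_hom_const_t inj_const_t P, of 1] ring_hom_onD(2)[OF ring_hom_const_t]
    by (simp only: to_fract_1 eval_tu_monom times_divide_eq_left mult_1)
  ultimately have v: "u_var ^ d / const_t P \<in> eval_tu ` graded_subring d P" by (metis imageI)
  show ?thesis
  proof
    fix x assume "x \<in> B_plus d P"
    then obtain q where "x = poly (fract_poly q) (u_var ^ d / const_t P)"
      unfolding B_plus_def eval_v_def poly_embed_tu by blast
    then have "x = (\<Sum>i\<le>degree (fract_poly q). to_fract (coeff q i) * (u_var ^ d / const_t P) ^ i)"
      by (simp add: poly_altdef coeff_map_poly)
    then show "x \<in> eval_tu ` graded_subring d P"
      using g v by (simp only:) (rule subring_sum[OF R], rule subring_mult[OF R], simp, rule subring_power[OF R])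
  qed
qed

text \<open>If p = r^d P^n is a polynomial, then (r u^n)^d = p v^n, so r u^n is integral over
  \<open>B_plus\<close>. Conversely the powers of an integral element of C(t,u) have a common
  denominator in the graded subring. This forces the element into C(t)[u] and from there into the
  graded subring, as both are completely integrally closed.\<close>

lemma A_plus_eq:
  assumes d: "0 < d" and P: "P \<noteq> 0"
  shows "A_plus d P = eval_tu ` graded_subring d P"
proof
  note B = B_plus_subring[of d P]
  show "eval_tu ` graded_subring d P \<subseteq> A_plus d P"
  proof (rule image_subsetI)
    fix f assume f: "f \<in> graded_subring d P"
    have mono: "integral_over (B_plus d P) (eval_tu (monom r n))" if r: "r \<in> coeff_set d (to_fract P) n" for r n
    proof -
      obtain p where p: "r ^ d * to_fract P ^ n = to_fract p" using r unfolding coeff_set_def by blast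
      let ?j = "fract_ext const_t"
      note j = ring_hom_fract_ext[OF ring_hom_const_t inj_const_t]
      have "?j r ^ d * ?j (to_fract P) ^ n = ?j (r ^ d * to_fract P ^ n)"
        by (simp only: ring_hom_onD(4)[OF j UNIV_I UNIV_I] ring_hom_on_power[OF is_subring_UNIV j UNIV_I])
      then have "?j r ^ d * const_t P ^ n = const_t p"
        by (simp only: p fract_ext_const_t)
      then have jr: "?j r ^ d = const_t p / const_t P ^ n" using P by (simp add: eq_divide_eq)
      have "eval_tu (monom r n) ^ d = ?j r ^ d * (u_var ^ d) ^ n"
        by (simp add: eval_tu_monom power_mult_distrib mult.commute flip: power_mult)
      then have "eval_tu (monom r n) ^ d = const_t p * (u_var ^ d / const_t P) ^ n"
        by (simp add: jr power_divide)
      then have "eval_tu (monom r n) ^ d \<in> B_plus d P"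
        using to_fract_in_B_plus v_in_B_plus subring_mult[OF B] subring_power[OF B] by metis
      then show ?thesis by (rule integral_over_root[OF B d])
    qed
    have sum: "integral_over (B_plus d P) (eval_tu (\<Sum>i\<in>I. monom (coeff f i) i))" if "finite I" for I
      using that
    proof induction
      case empty
      show ?case using mono[OF coeff_set_zero[OF d], of 0] by simp
    next
      case (insert i I)
      then show ?case
        using integral_over_add[OF B mono[OF in_graded_subringD[OF f, of i]]] by (simp add: eval_tu_add)
    qed
    show "eval_tu f \<in> A_plus d P"
      using sum[of "{..degree f}"] by (simp add: poly_as_sum_of_monoms A_plus_def)
  qed
  show "A_plus d P \<subseteq> eval_tu ` graded_subring d P"
  proof
    note R = is_subring_eval_tu_image[OF d, of P]
    fix x assume "x \<in> A_plus d P"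
    then have x: "integral_over (eval_tu ` graded_subring d P) x"
      unfolding A_plus_def using integral_over_mono B_plus_subset[OF d P] by blast
    obtain a b where ab: "x = to_fract a / to_fract b" "b \<noteq> 0" by (rule fract_coprimeE)
    have g: "to_fract g \<in> eval_tu ` graded_subring d P" for g
      using fract_poly_in_graded_subring[OF d, of g P] eval_tu_fract_poly[of g] by (metis imageI)
    obtain c' where c': "c' \<in> eval_tu ` graded_subring d P" "c' \<noteq> 0" "\<forall>m. c' * x ^ m \<in> eval_tu ` graded_subring d P"
      by (rule integral_over_common_denominator[OF R x ab(1) g g]) (use ab in simp_all)
    then obtain c where c: "c' = eval_tu c" "c \<in> graded_subring d P" by blast
    have "c \<noteq> 0" using c' c ring_hom_on_zero[OF is_subring_UNIV ring_hom_eval_tu] by auto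
    have "x \<in> range eval_tu"
    proof (rule eval_tu_completely_integrally_closed[OF \<open>c \<noteq> 0\<close>])
      show "eval_tu c * x ^ m \<in> range eval_tu" for m
        using c'(3)[rule_format, of m] unfolding c(1) by (rule subsetD[OF image_mono[OF subset_UNIV]])
    qed
    then obtain f where f: "x = eval_tu f" by blast
    have "c * f ^ m \<in> graded_subring d P" for m
    proof -
      have "eval_tu (c * f ^ m) = c' * x ^ m" by (simp add: eval_tu_mult eval_tu_power c f)
      then have "eval_tu (c * f ^ m) \<in> eval_tu ` graded_subring d P" using c'(3)[rule_format, of m] by (simp only:)
      then show ?thesis unfolding inj_image_mem_iff[OF inj_eval_tu] .
    qed
    then have "f \<in> graded_subring d P"
      by (rule graded_subring_completely_integrally_closed[OF d P c(2) \<open>c \<noteq> 0\<close>])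
    then show "x \<in> eval_tu ` graded_subring d P" using f by blast
  qed
qed

lemma is_subring_A_plus: "0 < d \<Longrightarrow> P \<noteq> 0 \<Longrightarrow> is_subring (A_plus d P)"
  by (simp add: A_plus_eq is_subring_eval_tu_image)

definition rescale :: "complex \<Rightarrow> complex poly fract poly \<Rightarrow> complex poly fract poly" where
  "rescale c f = f \<circ>\<^sub>p [:0, to_fract [:c:]:]"

lemma coeff_rescale: "coeff (rescale c f) i = to_fract [:c:] ^ i * coeff f i"
  by (simp add: rescale_def coeff_pcompose_linear)

lemma rescale_in_graded_subring: "f \<in> graded_subring d P \<Longrightarrow> rescale c f \<in> graded_subring d P"
  unfolding graded_subring_def mem_Collect_eq coeff_rescale to_fract_power[symmetric]
  by (blast intro: coeff_set_smult)

lemma ring_hom_substitution: "ring_hom_on UNIV UNIV (\<lambda>f :: 'a::idom poly. f \<circ>\<^sub>p g)"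
  by (simp add: ring_hom_on_def pcompose_add pcompose_mult pcompose_1)

text \<open>\<open>scale_u\<close> localizes at the zero ideal, so it reaches every fraction: for
  nonzero \<open>c\<close> the substitution keeps denominators nonzero.\<close>

lemma scale_u_Fract:
  assumes "c \<noteq> 0" "b \<noteq> 0"
  shows "scale_u c (Fract a b) = Fract (a \<circ>\<^sub>p [:0, [:c:]:]) (b \<circ>\<^sub>p [:0, [:c:]:])"
  unfolding scale_u_def
proof (rule local_map_eq[OF ring_hom_substitution is_subring_UNIV])
  show "{0} \<in> spec (UNIV :: complex poly poly set)" by (rule zero_in_spec[OF is_subring_UNIV])
  have "b \<circ>\<^sub>p [:0, [:c:]:] \<noteq> 0" using assms by (simp add: pcompose_eq_0_iff)
  then show "b \<circ>\<^sub>p [:0, [:c:]:] \<notin> {0}" by simp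
qed simp_all

text \<open>The denominator can be taken in C[t], which the substitution fixes, so only the
  numerator changes.\<close>

lemma scale_u_eval_tu:
  assumes c: "c \<noteq> 0"
  shows "scale_u c (eval_tu f) = eval_tu (rescale c f)"
proof -
  obtain p g where p: "p \<noteq> 0" "Polynomial.smult (to_fract p) f = fract_poly g" by (rule clear_denominators)
  have "eval_tu f = Fract g [:p:]"
    using p eval_tu_smult[of p f] by (simp add: Fract_conv_to_fract eval_tu_fract_poly field_simps)
  then have "scale_u c (eval_tu f) = Fract (g \<circ>\<^sub>p [:0, [:c:]:]) [:p:]"
    using scale_u_Fract[OF c, of "[:p:]" g] p(1) by simp
  moreover have "Polynomial.smult (to_fract p) (rescale c f) = fract_poly (g \<circ>\<^sub>p [:0, [:c:]:])"
  proof (rule poly_eqI)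
    fix i
    have "to_fract p * coeff f i = to_fract (coeff g i)"
      using arg_cong[OF p(2), of "\<lambda>q. coeff q i"] by (simp add: coeff_map_poly)
    then show "coeff (Polynomial.smult (to_fract p) (rescale c f)) i = coeff (fract_poly (g \<circ>\<^sub>p [:0, [:c:]:])) i"
      by (simp add: coeff_rescale coeff_map_poly coeff_pcompose_linear to_fract_power)
  qed
  then have "const_t p * eval_tu (rescale c f) = to_fract (g \<circ>\<^sub>p [:0, [:c:]:])"
    by (simp flip: eval_tu_smult add: eval_tu_fract_poly)
  moreover have "const_t p \<noteq> 0" using p(1) by simp
  ultimately show ?thesis by (metis Fract_conv_to_fract nonzero_mult_div_cancel_left)
qed

section \<open>Graded surfaces\<close>

text \<open>A grading is encoded by the coaction \<open>\<gamma>\<close>, which sends \<open>f\<close> with homogeneous components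
  \<open>f\<^sub>i\<close> to the polynomial with coefficients \<open>f\<^sub>i\<close>.\<close>

locale graded_surface =
  fixes \<gamma> :: "'a::idom \<Rightarrow> 'a poly" and h :: "complex poly \<Rightarrow> 'a" and S :: "'a set"
  assumes hom_\<gamma>: "ring_hom_on UNIV UNIV \<gamma>"
    and \<gamma>_at_1: "poly (\<gamma> f) 1 = f"
    and \<gamma>_coeff: "\<gamma> (coeff (\<gamma> f) i) = monom (coeff (\<gamma> f) i) i"
    and hom_h: "ring_hom_on UNIV UNIV h"
    and inj_h: "inj h"
    and range_h: "range h = {f. \<gamma> f = monom f 0}"
    and finite_S: "finite S"
    and generated: "is_subring T \<Longrightarrow> range h \<subseteq> T \<Longrightarrow> S \<subseteq> T \<Longrightarrow> T = UNIV"
    and normal: "integral_over (range to_fract) (x :: 'a fract) \<Longrightarrow> x \<in> range to_fract"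
    and no_chain: "p0 \<in> spec UNIV \<Longrightarrow> p1 \<in> spec UNIV \<Longrightarrow> p2 \<in> spec UNIV \<Longrightarrow> p3 \<in> spec UNIV \<Longrightarrow>
      \<not> ((p0 :: 'a set) \<subset> p1 \<and> p1 \<subset> p2 \<and> p2 \<subset> p3)"
    and effective: "2 \<le> (k::nat) \<Longrightarrow> \<exists>n f. \<gamma> f = monom f n \<and> f \<noteq> 0 \<and> \<not> k dvd n"
begin

definition W :: "nat \<Rightarrow> 'a set" where
  "W n = {f. \<gamma> f = monom f n}"

lemmas \<gamma>_add = ring_hom_onD(3)[OF hom_\<gamma> UNIV_I UNIV_I]
lemmas \<gamma>_mult = ring_hom_onD(4)[OF hom_\<gamma> UNIV_I UNIV_I]
lemmas \<gamma>_one = ring_hom_onD(2)[OF hom_\<gamma>]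
lemmas \<gamma>_zero = ring_hom_on_zero[OF is_subring_UNIV hom_\<gamma>]
lemmas \<gamma>_uminus = ring_hom_on_uminus[OF is_subring_UNIV hom_\<gamma> UNIV_I]
lemmas h_add = ring_hom_onD(3)[OF hom_h UNIV_I UNIV_I]
lemmas h_mult = ring_hom_onD(4)[OF hom_h UNIV_I UNIV_I]
lemmas h_one = ring_hom_onD(2)[OF hom_h]
lemmas h_zero = ring_hom_on_zero[OF is_subring_UNIV hom_h]
lemmas h_uminus = ring_hom_on_uminus[OF is_subring_UNIV hom_h UNIV_I]

lemma h_eq_zero_iff: "h p = 0 \<longleftrightarrow> p = 0"
  using inj_h h_zero by (metis injD)

lemma \<gamma>_diff: "\<gamma> (f - g) = \<gamma> f - \<gamma> g"
  using \<gamma>_add[of f "- g"] by (simp add: \<gamma>_uminus)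

lemma W_mult: "f \<in> W n \<Longrightarrow> g \<in> W m \<Longrightarrow> f * g \<in> W (n + m)"
  by (simp add: W_def \<gamma>_mult mult_monom)

lemma W_one: "1 \<in> W 0"
  by (simp add: W_def \<gamma>_one monom_0 one_pCons)

lemma W_power: "f \<in> W n \<Longrightarrow> f ^ k \<in> W (n * k)"
  by (induction k) (auto simp: W_one add.commute dest: W_mult)

lemma range_h_eq_W: "range h = W 0"
  by (simp add: range_h W_def)

lemma h_in_W: "h p \<in> W 0"
  using range_h_eq_W by blast

lemma coeff_in_W: "coeff (\<gamma> f) i \<in> W i"
  by (simp add: W_def \<gamma>_coeff)

lemma coeff_W: "f \<in> W n \<Longrightarrow> coeff (\<gamma> f) i = (if i = n then f else 0)"
  by (simp add: W_def)

lemma sum_components: "(\<Sum>i\<le>degree (\<gamma> f). coeff (\<gamma> f) i) = f"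
  using \<gamma>_at_1[of f] by (simp add: poly_altdef)

text \<open>The coaction of \<open>f\<close> times the monomial of \<open>c\<close> is concentrated
  in degree \<open>n + k\<close>; cancelling the nonzero \<open>c\<close> kills all components of
  \<open>f\<close> outside degree \<open>n\<close>.\<close>

lemma W_cancel:
  assumes "f * c \<in> W (n + k)" "c \<in> W k" "c \<noteq> 0"
  shows "f \<in> W n"
proof -
  have eq: "\<gamma> f * monom c k = monom (f * c) (n + k)"
    using assms(1,2) by (simp add: W_def \<gamma>_mult)
  have "coeff (\<gamma> f) i = 0" if "i \<noteq> n" for i
  proof -
    have "coeff (\<gamma> f * monom c k) (i + k) = c * coeff (\<gamma> f) i"
      unfolding mult.commute[of "\<gamma> f"] by (simp add: coeff_monom_mult)
    then show ?thesis using that assms(3) unfolding eq by simp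
  qed
  then have m: "\<gamma> f = monom (coeff (\<gamma> f) n) n" by (intro poly_eqI) simp
  have "f = coeff (\<gamma> f) n"
    using arg_cong[OF m, of "\<lambda>p. poly p 1"] by (simp add: \<gamma>_at_1 poly_monom)
  then show ?thesis using m unfolding W_def by simp
qed

text \<open>If the conclusion fails, then there is a homogeneous prime ideal \<open>Q\<close> that contains \<open>f\<close>,
  does not contain \<open>x\<close> and does not meet \<open>\<complex>[t]\<close>, so that
  \<open>0 \<subset> Q \<subset> A\<^sub>+ \<subset> A\<^sub>+ + (t)\<close> is a chain of length three.\<close>

lemma power_in_principal_ideal:
  assumes f: "f \<in> W i" "0 < i" "f \<noteq> 0" and x: "x \<in> W j" "0 < j"
  obtains p n a where "p \<noteq> 0" "h p * x ^ n = f * a"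
proof (cases "\<exists>p n a. p \<noteq> 0 \<and> h p * x ^ n = f * a")
  case False
  \<comment> \<open>The multiplicative set generated by \<open>x\<close> and the nonzero polynomials
    in \<open>t\<close>. If the claim fails, it misses all multiples of \<open>f\<close>.\<close>
  define M where "M = {h p * x ^ n | p n. p \<noteq> 0}"
  have ideal: "is_ideal UNIV (range ((*) f))"
    unfolding is_ideal_def
  proof (intro conjI ballI)
    show "0 \<in> range ((*) f)" using mult_zero_right[of f] by (metis rangeI)
    fix u assume "u \<in> range ((*) f)"
    then obtain a where a: "u = f * a" by blast
    show "u + v \<in> range ((*) f)" if "v \<in> range ((*) f)" for v
      using that a distrib_left[of f a] by (metis (no_types, lifting) image_iff rangeI)
    show "b * u \<in> range ((*) f)" for b
      using a by (metis mult.left_commute rangeI)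
  qed simp
  have M: "h p * x ^ n \<in> M" if "p \<noteq> 0" for p n
    unfolding M_def using that by blast
  have oneM: "1 \<in> M" using M[of 1 0] by (simp add: h_one)
  have multM: "u * v \<in> M" if uv: "u \<in> M" "v \<in> M" for u v
  proof -
    obtain p n q m where "u = h p * x ^ n" "p \<noteq> 0" "v = h q * x ^ m" "q \<noteq> 0"
      using uv unfolding M_def by blast
    then have "u * v = h (p * q) * x ^ (n + m)" "p * q \<noteq> 0" by (simp_all add: h_mult power_add mult_ac)
    then show ?thesis using M by simp
  qed
  have disj: "range ((*) f) \<inter> M = {}" 
  proof (intro equals0I)
    fix z assume "z \<in> range ((*) f) \<inter> M"
    then obtain a where a: "z = f * a" and "z \<in> M" by blast
    then obtain p n where "z = h p * x ^ n" "p \<noteq> 0" unfolding M_def by blast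
    then show False using False a by metis
  qed
  obtain Q where Q: "Q \<in> spec UNIV" "range ((*) f) \<subseteq> Q" "Q \<inter> M = {}"
    by (rule prime_ideal_avoiding[OF is_subring_UNIV ideal subset_UNIV oneM multM disj])
  have xQ: "x \<notin> Q" using Q(3) M[of 1 1] by (auto simp: h_one)
  have hQ: "p = 0" if "h p \<in> Q" for p
    using that Q(3) M[of p 0] by auto
  have fQ: "f \<in> Q" using Q(2) by (metis mult_1_right rangeI subsetD)
  \<comment> \<open>\<open>Q\<close> may fail to be homogeneous; \<open>Q'\<close> is the largest
    homogeneous ideal inside it and is again prime.\<close>
  define Q' where "Q' = {a. \<forall>i. coeff (\<gamma> a) i \<in> Q}"
  have Q'_prime: "Q' \<in> spec UNIV"
    unfolding spec_def is_prime_ideal_def is_ideal_def mem_Collect_eq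
  proof (intro conjI ballI impI)
    show "0 \<in> Q'" using specD(2)[OF Q(1)] by (simp add: Q'_def \<gamma>_zero)
    show "1 \<notin> Q'" using specD(3)[OF Q(1)] by (auto simp: Q'_def \<gamma>_one coeff_1 intro!: exI[of _ 0])
    show "a + b \<in> Q'" if "a \<in> Q'" "b \<in> Q'" for a b
      using that specD(4)[OF Q(1)] by (simp add: Q'_def \<gamma>_add)
    have sumQ: "sum g I \<in> Q" if "\<And>i. i \<in> I \<Longrightarrow> g i \<in> Q" for g and I :: "nat set"
      using that by (induction I rule: infinite_finite_induct) (auto intro: specD(2)[OF Q(1)] specD(4)[OF Q(1)])
    show "a * b \<in> Q'" if "b \<in> Q'" for a b
      using that specD(5)[OF Q(1)] by (auto simp: Q'_def \<gamma>_mult coeff_mult intro!: sumQ)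
    show "a \<in> Q' \<or> b \<in> Q'" if ab: "a * b \<in> Q'" for a b
    proof (rule ccontr)
      assume n: "\<not> (a \<in> Q' \<or> b \<in> Q')"
      \<comment> \<open>The lowest components outside \<open>Q\<close>: in degree
        \<open>k + l\<close> of the product every other summand has a factor in
        \<open>Q\<close>.\<close>
      define k where "k = (LEAST k. coeff (\<gamma> a) k \<notin> Q)"
      define l where "l = (LEAST l. coeff (\<gamma> b) l \<notin> Q)"
      have k: "coeff (\<gamma> a) k \<notin> Q" "\<And>i. i < k \<Longrightarrow> coeff (\<gamma> a) i \<in> Q"
      proof -
        obtain i0 where "coeff (\<gamma> a) i0 \<notin> Q" using n unfolding Q'_def by blast
        then show "coeff (\<gamma> a) k \<notin> Q" unfolding k_def by (rule LeastI)
        show "coeff (\<gamma> a) i \<in> Q" if "i < k" for i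
          using not_less_Least[OF that[unfolded k_def]] by simp
      qed
      have l: "coeff (\<gamma> b) l \<notin> Q" "\<And>i. i < l \<Longrightarrow> coeff (\<gamma> b) i \<in> Q"
      proof -
        obtain i0 where "coeff (\<gamma> b) i0 \<notin> Q" using n unfolding Q'_def by blast
        then show "coeff (\<gamma> b) l \<notin> Q" unfolding l_def by (rule LeastI)
        show "coeff (\<gamma> b) i \<in> Q" if "i < l" for i
          using not_less_Least[OF that[unfolded l_def]] by simp
      qed
      define rest where "rest = (\<Sum>i\<in>{..k + l} - {k}. coeff (\<gamma> a) i * coeff (\<gamma> b) (k + l - i))"
      have "rest \<in> Q"
        unfolding rest_def
      proof (rule sumQ)
        fix i assume i: "i \<in> {..k + l} - {k}"
        show "coeff (\<gamma> a) i * coeff (\<gamma> b) (k + l - i) \<in> Q"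
        proof (cases "i < k")
          case True
          then show ?thesis using k(2) specD(6)[OF Q(1)] by simp
        next
          case False
          then have "k + l - i < l" using i by auto
          then show ?thesis using l(2) specD(6)[OF Q(1)] by simp
        qed
      qed
      moreover have eq: "coeff (\<gamma> (a * b)) (k + l) = coeff (\<gamma> a) k * coeff (\<gamma> b) l + rest"
        unfolding rest_def \<gamma>_mult coeff_mult by (subst sum.remove[of _ k]) auto
      moreover have "coeff (\<gamma> (a * b)) (k + l) \<in> Q" using ab unfolding Q'_def by blast
      moreover have "- 1 * rest \<in> Q" by (rule specD(5)[OF Q(1) UNIV_I \<open>rest \<in> Q\<close>])
      ultimately have "coeff (\<gamma> a) k * coeff (\<gamma> b) l + rest + - 1 * rest \<in> Q"
        unfolding eq[symmetric] by (intro specD(4)[OF Q(1)])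
      then have "coeff (\<gamma> a) k * coeff (\<gamma> b) l \<in> Q" by simp
      then show False using k(1) l(1) specD(6)[OF Q(1)] by simp
    qed
  qed simp
  \<comment> \<open>The irrelevant ideal.\<close>
  define P where "P = {a. coeff (\<gamma> a) 0 = 0}"
  have coeff0: "coeff (\<gamma> (a * b)) 0 = coeff (\<gamma> a) 0 * coeff (\<gamma> b) 0" for a b
    by (simp add: \<gamma>_mult coeff_mult)
  have P_prime: "P \<in> spec UNIV"
    unfolding spec_def is_prime_ideal_def is_ideal_def P_def
    by (auto simp: \<gamma>_zero \<gamma>_one \<gamma>_add coeff0)
  \<comment> \<open>The inverse image of the ideal (t) under the projection to degree zero; any
    other point of the line would serve equally well.\<close>
  define P' where "P' = {a. \<exists>p. coeff (\<gamma> a) 0 = h p \<and> poly p 0 = 0}"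
  have ex_h: "\<exists>p. coeff (\<gamma> a) 0 = h p" for a
    using coeff_in_W[of a 0] range_h_eq_W by blast
  have P'_iff: "a \<in> P' \<longleftrightarrow> poly p 0 = 0" if "coeff (\<gamma> a) 0 = h p" for a p
    using that inj_h by (auto simp: P'_def dest: injD)
  have P'_prime: "P' \<in> spec UNIV"
    unfolding spec_def is_prime_ideal_def is_ideal_def mem_Collect_eq
  proof (intro conjI ballI impI)
    show "0 \<in> P'" by (subst P'_iff[of _ 0]) (simp_all add: \<gamma>_zero h_zero)
    show "1 \<notin> P'" by (subst P'_iff[of _ 1]) (simp_all add: \<gamma>_one h_one)
    fix a b
    obtain p where p: "coeff (\<gamma> a) 0 = h p" using ex_h by blast
    obtain q where q: "coeff (\<gamma> b) 0 = h q" using ex_h by blast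
    have sum: "coeff (\<gamma> (a + b)) 0 = h (p + q)" using p q by (simp add: \<gamma>_add h_add)
    have prod: "coeff (\<gamma> (a * b)) 0 = h (p * q)" using p q by (simp add: coeff0 h_mult)
    show "a \<in> P' \<Longrightarrow> b \<in> P' \<Longrightarrow> a + b \<in> P'"
      unfolding P'_iff[OF p] P'_iff[OF q] P'_iff[OF sum] by simp
    show "b \<in> P' \<Longrightarrow> a * b \<in> P'"
      unfolding P'_iff[OF q] P'_iff[OF prod] by simp
    show "a * b \<in> P' \<Longrightarrow> a \<in> P' \<or> b \<in> P'"
      unfolding P'_iff[OF p] P'_iff[OF q] P'_iff[OF prod] by simp
  qed simp
  have "{0} \<subset> Q'"
  proof -
    have "f \<in> Q'" using fQ specD(2)[OF Q(1)] by (simp add: Q'_def coeff_W[OF f(1)])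
    then show ?thesis using f(3) specD(2)[OF Q'_prime] by blast
  qed
  moreover have "Q' \<subset> P"
  proof -
    have "a \<in> P" if "a \<in> Q'" for a
    proof -
      obtain p where p: "coeff (\<gamma> a) 0 = h p" using ex_h by blast
      have "coeff (\<gamma> a) 0 \<in> Q" using that unfolding Q'_def by blast
      then have "p = 0" using hQ p by simp
      then show ?thesis using p h_zero by (simp add: P_def)
    qed
    moreover have "x \<in> P" using x by (simp add: P_def coeff_W)
    moreover have "x \<notin> Q'" using xQ by (auto simp: Q'_def coeff_W[OF x(1)])
    ultimately show ?thesis by blast
  qed
  moreover have "P \<subset> P'"
  proof -
    have "a \<in> P'" if "a \<in> P" for a
      using that P'_iff[of a 0] by (simp add: P_def h_zero)
    moreover have t: "coeff (\<gamma> (h [:0, 1:])) 0 = h [:0, 1:]" by (simp add: coeff_W[OF h_in_W])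
    have "h [:0, 1:] \<in> P'" unfolding P'_iff[OF t] by simp
    moreover have "h [:0, 1:] \<notin> P" by (simp add: P_def t h_eq_zero_iff)
    ultimately show ?thesis by blast
  qed
  ultimately show ?thesis
    using no_chain[OF zero_in_spec[OF is_subring_UNIV] Q'_prime P_prime P'_prime] by blast
qed (use that in blast)

text \<open>Homogeneous generators of positive degree over C[t]. The degree is stored with the
  component because a component may be zero, and zero lies in every \<open>W i\<close>.\<close>

definition H :: "('a \<times> nat) set" where
  "H = (\<Union>s\<in>S. (\<lambda>i. (coeff (\<gamma> s) i, i)) ` {1..degree (\<gamma> s)})"

lemma finite_H: "finite H"
  unfolding H_def using finite_S by blast

lemma H_W: "y \<in> H \<Longrightarrow> fst y \<in> W (snd y)" and H_pos: "y \<in> H \<Longrightarrow> 0 < snd y"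
  unfolding H_def by (auto intro: coeff_in_W)

lemma generated_H:
  assumes T: "is_subring T" and "range h \<subseteq> T" "fst ` H \<subseteq> T"
  shows "T = UNIV"
proof (rule generated[OF T assms(2)], rule subsetI)
  fix s assume s: "s \<in> S"
  have "coeff (\<gamma> s) i \<in> T" if "i \<le> degree (\<gamma> s)" for i
  proof (cases i)
    case 0
    then show ?thesis using coeff_in_W[of s 0] assms(2) range_h_eq_W by blast
  next
    case (Suc k)
    then have "i \<in> {1..degree (\<gamma> s)}" using that by simp
    then have "(coeff (\<gamma> s) i, i) \<in> H" unfolding H_def using s by blast
    then show ?thesis using assms(3) by force
  qed
  then have "(\<Sum>i\<le>degree (\<gamma> s). coeff (\<gamma> s) i) \<in> T" by (intro subring_sum[OF T]) simp
  then show "s \<in> T" by (simp only: sum_components)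
qed

definition gmonom :: "('a \<times> nat \<Rightarrow> nat) \<Rightarrow> 'a" where
  "gmonom \<alpha> = (\<Prod>y\<in>H. fst y ^ \<alpha> y)"

definition wdeg :: "('a \<times> nat \<Rightarrow> nat) \<Rightarrow> nat" where
  "wdeg \<alpha> = (\<Sum>y\<in>H. snd y * \<alpha> y)"

text \<open>The bound \<open>n\<close> on exponents makes the set finite and excludes nothing, since
  all degrees in \<open>H\<close> are positive; extensionality makes each exponent vector occur
  once.\<close>

definition exps :: "nat \<Rightarrow> ('a \<times> nat \<Rightarrow> nat) set" where
  "exps n = {\<alpha> \<in> H \<rightarrow>\<^sub>E {..n}. wdeg \<alpha> = n}"

definition mspan :: "nat \<Rightarrow> 'a set" where
  "mspan n = {\<Sum>\<alpha>\<in>exps n. h (k \<alpha>) * gmonom \<alpha> | k. True}"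

lemma finite_exps: "finite (exps n)"
proof (rule finite_subset)
  show "exps n \<subseteq> H \<rightarrow>\<^sub>E {..n}" unfolding exps_def by blast
qed (simp add: finite_PiE finite_H)

lemma gmonom_W: "gmonom \<alpha> \<in> W (wdeg \<alpha>)"
proof -
  have "(\<Prod>y\<in>K. fst y ^ \<alpha> y) \<in> W (\<Sum>y\<in>K. snd y * \<alpha> y)" if "finite K" "K \<subseteq> H" for K
    using that by (induction K) (auto intro: W_one W_mult W_power H_W)
  then show ?thesis using finite_H by (simp add: gmonom_def wdeg_def)
qed

lemma mspanI: "(\<Sum>\<alpha>\<in>exps n. h (k \<alpha>) * gmonom \<alpha>) \<in> mspan n"
  unfolding mspan_def by blast

lemma mspan_add: "f \<in> mspan n \<Longrightarrow> g \<in> mspan n \<Longrightarrow> f + g \<in> mspan n"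
proof -
  assume "f \<in> mspan n" "g \<in> mspan n"
  then obtain k l where "f = (\<Sum>\<alpha>\<in>exps n. h (k \<alpha>) * gmonom \<alpha>)" "g = (\<Sum>\<alpha>\<in>exps n. h (l \<alpha>) * gmonom \<alpha>)"
    unfolding mspan_def by blast
  then have "f + g = (\<Sum>\<alpha>\<in>exps n. h (k \<alpha> + l \<alpha>) * gmonom \<alpha>)"
    by (simp add: h_add distrib_right sum.distrib)
  then show ?thesis unfolding mspan_def by (auto intro: exI[of _ "\<lambda>\<alpha>. k \<alpha> + l \<alpha>"])
qed

lemma mspan_h: "f \<in> mspan n \<Longrightarrow> h p * f \<in> mspan n"
proof -
  assume "f \<in> mspan n"
  then obtain k where "f = (\<Sum>\<alpha>\<in>exps n. h (k \<alpha>) * gmonom \<alpha>)"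
    unfolding mspan_def by blast
  then have "h p * f = (\<Sum>\<alpha>\<in>exps n. h (p * k \<alpha>) * gmonom \<alpha>)"
    by (simp add: h_mult sum_distrib_left mult.assoc)
  then show ?thesis unfolding mspan_def by (auto intro: exI[of _ "\<lambda>\<alpha>. p * k \<alpha>"])
qed

lemma mspan_zero: "0 \<in> mspan n"
  using mspanI[of "\<lambda>_. 0" n] by (simp add: h_zero)

lemma mspan_sum: "(\<And>i. i \<in> I \<Longrightarrow> f i \<in> mspan n) \<Longrightarrow> sum f I \<in> mspan n"
  by (induction I rule: infinite_finite_induct) (auto intro: mspan_zero mspan_add)

lemma gmonom_in_mspan: "gmonom \<alpha> \<in> mspan (wdeg \<alpha>)"
proof -
  let ?\<beta> = "restrict \<alpha> H"
  have "\<alpha> y \<le> wdeg \<alpha>" if y: "y \<in> H" for y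
  proof -
    have "\<alpha> y \<le> snd y * \<alpha> y" using H_pos[OF y] by (cases "snd y") auto
    also have "\<dots> \<le> wdeg \<alpha>" unfolding wdeg_def by (rule member_le_sum[OF y _ finite_H]) simp
    finally show ?thesis .
  qed
  moreover have "wdeg ?\<beta> = wdeg \<alpha>" unfolding wdeg_def by (rule sum.cong) auto
  ultimately have "?\<beta> \<in> exps (wdeg \<alpha>)" unfolding exps_def by auto
  then have "(\<Sum>\<beta>\<in>exps (wdeg \<alpha>). h (if \<beta> = ?\<beta> then 1 else 0) * gmonom \<beta>) = gmonom ?\<beta>"
    using finite_exps by (simp add: if_distrib[of h] if_distrib[of "\<lambda>z. z * _"] h_one h_zero cong: if_cong)
  also have "gmonom ?\<beta> = gmonom \<alpha>" unfolding gmonom_def by (rule prod.cong) auto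
  finally show ?thesis using mspanI[of "\<lambda>\<beta>. if \<beta> = ?\<beta> then 1 else 0" "wdeg \<alpha>"] by (simp only:)
qed

lemma mspan_mult:
  assumes "f \<in> mspan n" "g \<in> mspan m"
  shows "f * g \<in> mspan (n + m)"
proof -
  obtain k l where f: "f = (\<Sum>\<alpha>\<in>exps n. h (k \<alpha>) * gmonom \<alpha>)" and g: "g = (\<Sum>\<alpha>\<in>exps m. h (l \<alpha>) * gmonom \<alpha>)"
    using assms unfolding mspan_def by blast
  have "f * g = (\<Sum>\<alpha>\<in>exps n. \<Sum>\<beta>\<in>exps m. h (k \<alpha> * l \<beta>) * gmonom (\<lambda>y. \<alpha> y + \<beta> y))"
    unfolding f g sum_product
    by (intro sum.cong refl) (simp add: h_mult gmonom_def power_add prod.distrib mult_ac)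
  moreover have "gmonom (\<lambda>y. \<alpha> y + \<beta> y) \<in> mspan (n + m)" if "\<alpha> \<in> exps n" "\<beta> \<in> exps m" for \<alpha> \<beta>
  proof -
    have "wdeg (\<lambda>y. \<alpha> y + \<beta> y) = n + m"
      using that by (simp add: exps_def wdeg_def distrib_left sum.distrib)
    then show ?thesis using gmonom_in_mspan by metis
  qed
  ultimately show ?thesis by (simp only:) (intro mspan_sum mspan_h)
qed

lemma h_in_mspan: "h p \<in> mspan 0"
  using mspan_h[OF gmonom_in_mspan, of p "\<lambda>_. 0"] by (simp add: gmonom_def wdeg_def)

text \<open>The elements whose components all lie in the spans form a subring that contains C[t] and
  the generators, hence everything. Thus each \<open>W n\<close> is a finitely generated module over
  C[t].\<close>

lemma W_subset_mspan: "W n \<subseteq> mspan n"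
proof -
  let ?T = "{f. \<forall>n. coeff (\<gamma> f) n \<in> mspan n}"
  have pure: "f \<in> ?T" if "f \<in> W n" "f \<in> mspan n" for f n
    using that mspan_zero by (simp add: coeff_W)
  have "?T = UNIV"
  proof (rule generated_H)
    show "is_subring ?T"
      unfolding is_subring_def mem_Collect_eq
    proof (intro conjI ballI allI)
      show "coeff (\<gamma> 1) n \<in> mspan n" for n
        using pure[OF W_one] h_in_mspan[of 1] by (simp add: h_one)
      fix f g n assume fg: "f \<in> ?T" "g \<in> ?T"
      have "coeff (\<gamma> (f - g)) n = coeff (\<gamma> f) n + h (- 1) * coeff (\<gamma> g) n"
        by (simp add: \<gamma>_diff h_uminus h_one)
      then show "coeff (\<gamma> (f - g)) n \<in> mspan n" using fg by (simp only:) (rule mspan_add, blast, rule mspan_h, blast)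
      have mult: "coeff (\<gamma> f) k * coeff (\<gamma> g) (n - k) \<in> mspan n" if "k \<le> n" for k
      proof -
        have "coeff (\<gamma> f) k * coeff (\<gamma> g) (n - k) \<in> mspan (k + (n - k))"
          by (rule mspan_mult) (use fg in blast)+
        then show ?thesis using that by simp
      qed
      show "coeff (\<gamma> (f * g)) n \<in> mspan n"
        unfolding \<gamma>_mult coeff_mult by (rule mspan_sum, rule mult) simp
    qed
    show "range h \<subseteq> ?T" using pure[OF h_in_W h_in_mspan] by blast
    have "fst y \<in> ?T" if y: "y \<in> H" for y
    proof (rule pure[OF H_W[OF y]])
      have "gmonom (\<lambda>z. if z = y then 1 else 0) = fst y" "wdeg (\<lambda>z. if z = y then 1 else 0) = snd y"
        using y finite_H by (simp_all add: gmonom_def wdeg_def if_distrib[of "\<lambda>k. _ ^ k"] if_distrib[of "\<lambda>k. _ * k"] cong: if_cong)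
      then show "fst y \<in> mspan (snd y)" using gmonom_in_mspan by metis
    qed
    then show "fst ` H \<subseteq> ?T" by blast
  qed
  show ?thesis
  proof
    fix f assume f: "f \<in> W n"
    have "f \<in> ?T" unfolding \<open>?T = UNIV\<close> ..
    then have "coeff (\<gamma> f) n \<in> mspan n" by blast
    then show "f \<in> mspan n" by (simp add: coeff_W[OF f])
  qed
qed

end

context graded_surface
begin

text \<open>For large \<open>n\<close> every monomial of degree \<open>n + i\<close> lies in \<open>f A\<close> up to a denominator in
  \<open>\<complex>[t]\<close>. Hence \<open>g/f\<close>, up to a denominator, maps the finitely generated module
  \<open>W n\<close> to itself, so it is integral.\<close>

lemma same_degree_proportional:
  assumes f: "f \<in> W i" "f \<noteq> 0" and g: "g \<in> W i"
  obtains p q where "p \<noteq> 0" "h p * g = h q * f"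
proof (cases "i = 0")
  case True
  obtain p where p: "f = h p" using f True range_h_eq_W by blast
  obtain q where q: "g = h q" using g True range_h_eq_W by blast
  have "p \<noteq> 0" using p f(2) h_zero by auto
  moreover have "h p * g = h q * f" by (simp add: p q mult.commute)
  ultimately show ?thesis by (rule that)
next
  case False
  then have i: "0 < i" by simp
  have "\<exists>p n. p \<noteq> 0 \<and> (\<exists>a. h p * fst y ^ n = f * a)" if "y \<in> H" for y
    using power_in_principal_ideal[OF f(1) i f(2) H_W[OF that] H_pos[OF that]] by metis
  then obtain P N where PN: "\<And>y. y \<in> H \<Longrightarrow> P y \<noteq> 0" "\<And>y. y \<in> H \<Longrightarrow> \<exists>a. h (P y) * fst y ^ N y = f * a"
    by metis
  \<comment> \<open>\<open>m\<close> bounds all the exponents \<open>N y\<close>, and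
    \<open>p\<close> is a common denominator for all generators.\<close>
  define m where "m = sum N H"
  define p where "p = prod P H"
  have p0: "p \<noteq> 0" unfolding p_def using PN(1) finite_H by simp
  \<comment> \<open>The sum bounds the degree of a monomial with all exponents at most
    \<open>m\<close>, so in degree at least \<open>n\<close> some exponent reaches \<open>m\<close>.
    A positive multiple of \<open>i\<close> is taken so that \<open>W n\<close> contains a power of
    \<open>f\<close> and is not zero.\<close>
  define n where "n = i * Suc (\<Sum>y\<in>H. snd y * m)"
  have big: "\<exists>a. h p * gmonom \<alpha> = f * a" if \<alpha>: "\<alpha> \<in> exps (n + i)" for \<alpha>
  proof -
    have "\<exists>y\<in>H. m \<le> \<alpha> y"
    proof (rule ccontr)
      assume "\<not> (\<exists>y\<in>H. m \<le> \<alpha> y)"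
      then have "\<alpha> y \<le> m" if "y \<in> H" for y using that by (auto simp: not_le less_imp_le)
      then have "wdeg \<alpha> \<le> (\<Sum>y\<in>H. snd y * m)" unfolding wdeg_def by (intro sum_mono mult_left_mono) auto
      also have "\<dots> < n" unfolding n_def using i by (cases i) simp_all
      also have "n \<le> wdeg \<alpha>" using \<alpha> unfolding exps_def by simp
      finally show False by simp
    qed
    then obtain y where y: "y \<in> H" "m \<le> \<alpha> y" by blast
    have "N y \<le> m" unfolding m_def by (rule member_le_sum[OF y(1) _ finite_H]) simp
    then have e1: "fst y ^ \<alpha> y = fst y ^ N y * fst y ^ (\<alpha> y - N y)" using y(2) by (simp flip: power_add)
    have e2: "gmonom \<alpha> = fst y ^ \<alpha> y * (\<Prod>z\<in>H - {y}. fst z ^ \<alpha> z)"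
      unfolding gmonom_def by (rule prod.remove[OF finite_H y(1)])
    have e3: "h p = h (P y) * h (\<Prod>z\<in>H - {y}. P z)"
      unfolding p_def by (simp add: prod.remove[OF finite_H y(1)] h_mult)
    obtain a where a: "h (P y) * fst y ^ N y = f * a" using PN(2)[OF y(1)] by blast
    have "h p * gmonom \<alpha> = (h (P y) * fst y ^ N y) *
        (h (\<Prod>z\<in>H - {y}. P z) * fst y ^ (\<alpha> y - N y) * (\<Prod>z\<in>H - {y}. fst z ^ \<alpha> z))"
      unfolding e1 e2 e3 by (simp only: mult_ac)
    then show ?thesis unfolding a mult.assoc by blast
  qed
  \<comment> \<open>Multiplication by \<open>g\<close> leads from \<open>W n\<close> to
    \<open>W (n + i)\<close>; multiplying by \<open>h p\<close> and dividing by \<open>f\<close>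
    leads back.\<close>
  have step: "\<exists>b\<in>W n. h p * a = f * b" if a: "a \<in> W (n + i)" for a
  proof -
    obtain k where k: "a = (\<Sum>\<alpha>\<in>exps (n + i). h (k \<alpha>) * gmonom \<alpha>)"
      using a W_subset_mspan[of "n + i"] unfolding mspan_def by blast
    obtain c where c: "\<And>\<alpha>. \<alpha> \<in> exps (n + i) \<Longrightarrow> h p * gmonom \<alpha> = f * c \<alpha>" using big by metis
    have "h p * a = (\<Sum>\<alpha>\<in>exps (n + i). h (k \<alpha>) * (h p * gmonom \<alpha>))"
      by (simp add: k sum_distrib_left mult_ac)
    also have "\<dots> = (\<Sum>\<alpha>\<in>exps (n + i). h (k \<alpha>) * (f * c \<alpha>))"
      by (rule sum.cong) (simp_all add: c)
    also have "\<dots> = f * (\<Sum>\<alpha>\<in>exps (n + i). h (k \<alpha>) * c \<alpha>)"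
      by (simp add: sum_distrib_left mult_ac)
    finally obtain b where b: "h p * a = f * b" by blast
    have "b * f \<in> W (n + i)"
      using W_mult[OF h_in_W[of p] a] b by (simp add: mult.commute)
    then have "b \<in> W n" by (rule W_cancel[OF _ f])
    then show ?thesis using b by blast
  qed
  let ?x = "to_fract (h p * g) / to_fract f"
  let ?v = "\<lambda>\<alpha>. to_fract (gmonom \<alpha>)"
  have "\<exists>k. ?x * ?v \<alpha> = (\<Sum>\<beta>\<in>exps n. to_fract (h (k \<beta>)) * ?v \<beta>)" if \<alpha>: "\<alpha> \<in> exps n" for \<alpha>
  proof -
    have "gmonom \<alpha> \<in> W n" using gmonom_W[of \<alpha>] \<alpha> by (simp add: exps_def)
    then have "gmonom \<alpha> * g \<in> W (n + i)" by (rule W_mult[OF _ g])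
    then obtain b where b: "b \<in> W n" "h p * (gmonom \<alpha> * g) = f * b" using step by blast
    obtain k where k: "b = (\<Sum>\<beta>\<in>exps n. h (k \<beta>) * gmonom \<beta>)"
      using b(1) W_subset_mspan[of n] unfolding mspan_def by blast
    have "to_fract (h p * (gmonom \<alpha> * g)) = to_fract f * to_fract b" by (simp only: b(2) to_fract_mult)
    then have "?x * ?v \<alpha> = to_fract b" using f(2) by (simp add: field_simps)
    also have "\<dots> = (\<Sum>\<beta>\<in>exps n. to_fract (h (k \<beta>)) * ?v \<beta>)" by (simp add: k)
    finally show ?thesis by blast
  qed
  then have "\<forall>\<alpha>\<in>exps n. \<exists>k. ?x * ?v \<alpha> = (\<Sum>\<beta>\<in>exps n. to_fract (h (k \<beta>)) * ?v \<beta>)" by blast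
  from bchoice[OF this]
  obtain c where "\<forall>\<alpha>\<in>exps n. ?x * ?v \<alpha> = (\<Sum>\<beta>\<in>exps n. to_fract (h (c \<alpha> \<beta>)) * ?v \<beta>)" ..
  note c = bspec[OF this]
  have nz: "\<exists>\<alpha>\<in>exps n. ?v \<alpha> \<noteq> 0"
  proof (rule ccontr)
    assume "\<not> ?thesis"
    then have zero: "gmonom \<alpha> = 0" if "\<alpha> \<in> exps n" for \<alpha> using that by auto
    have "f ^ Suc (\<Sum>y\<in>H. snd y * m) \<in> W n" unfolding n_def by (rule W_power[OF f(1)])
    then obtain k where "f ^ Suc (\<Sum>y\<in>H. snd y * m) = (\<Sum>\<beta>\<in>exps n. h (k \<beta>) * gmonom \<beta>)"
      using W_subset_mspan[of n] unfolding mspan_def by blast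
    then have "f ^ Suc (\<Sum>y\<in>H. snd y * m) = 0" using zero by simp
    then show False using f(2) by simp
  qed
  have "integral_over (range to_fract) ?x"
    by (rule integral_over_family[OF subring_range_to_fract finite_exps nz _ c]) simp
  then have "?x \<in> range to_fract" by (rule normal)
  then obtain a where "?x = to_fract a" by (elim rangeE)
  then have "to_fract (h p * g) = to_fract (a * f)" using f(2) by (simp add: field_simps)
  then have a: "h p * g = a * f" unfolding to_fract_eq_iff .
  then have "a * f \<in> W (0 + i)" using W_mult[OF h_in_W g] by metis
  then have "a \<in> W 0" by (rule W_cancel[OF _ f])
  then obtain q where "a = h q" using range_h_eq_W by blast
  then show ?thesis using that p0 a by blast
qed

text \<open>Let \<open>d\<close> be the least positive degree of a homogeneous fraction a/b. If it
  is not one, effectivity provides \<open>f\<close> of a degree n not divisible by \<open>d\<close>,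
  and with q = n div d the fraction f b^q / a^q has the smaller positive degree n mod d.\<close>

lemma degree_one_fraction:
  obtains a b k where "a \<in> W (Suc k)" "b \<in> W k" "a \<noteq> 0" "b \<noteq> 0"
proof -
  define D where "D = {n. 0 < n \<and> (\<exists>k. \<exists>a\<in>W (k + n). \<exists>b\<in>W k. a \<noteq> 0 \<and> b \<noteq> 0)}"
  obtain n f where nf: "\<gamma> f = monom f n" "f \<noteq> 0" "\<not> 2 dvd n" using effective[of 2] by auto
  have "0 < n" using nf(3) by (cases n) auto
  moreover have "f \<in> W (0 + n)" using nf(1) by (simp add: W_def)
  ultimately have "n \<in> D" unfolding D_def using nf(2) W_one one_neq_zero by blast
  define d where "d = (LEAST d. d \<in> D)"
  have d: "d \<in> D" unfolding d_def by (rule LeastI[of "\<lambda>d. d \<in> D", OF \<open>n \<in> D\<close>])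
  have least: "r \<notin> D" if "r < d" for r using that not_less_Least unfolding d_def by blast
  obtain k a b where ab: "0 < d" "a \<in> W (k + d)" "b \<in> W k" "a \<noteq> 0" "b \<noteq> 0"
    using d unfolding D_def by blast
  have "d = 1"
  proof (rule ccontr)
    assume "d \<noteq> 1"
    then have "2 \<le> d" using ab(1) by simp
    then obtain n f where f: "f \<in> W n" "f \<noteq> 0" "\<not> d dvd n" using effective[of d] unfolding W_def by blast
    let ?q = "n div d" and ?r = "n mod d"
    have "0 < ?r" using f(3) by (simp add: dvd_eq_mod_eq_0)
    have "f * b ^ ?q \<in> W (n + k * ?q)" by (rule W_mult[OF f(1) W_power[OF ab(3)]])
    also have "n + k * ?q = (k + d) * ?q + ?r"
      using div_mult_mod_eq[of n d] by (simp add: algebra_simps)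
    finally have "f * b ^ ?q \<in> W ((k + d) * ?q + ?r)" .
    moreover have "a ^ ?q \<in> W ((k + d) * ?q)" by (rule W_power[OF ab(2)])
    moreover have "f * b ^ ?q \<noteq> 0" "a ^ ?q \<noteq> 0" using f ab by auto
    ultimately have "?r \<in> D" unfolding D_def using \<open>0 < ?r\<close> by blast
    then show False using least[of ?r] ab(1) by simp
  qed
  then show ?thesis using that ab by auto
qed

section \<open>Homogeneous fractions and an element of degree one\<close>

definition hF :: "complex poly \<Rightarrow> 'a fract" where
  "hF p = to_fract (h p)"

lemma hom_hF: "ring_hom_on UNIV UNIV hF"
  unfolding hF_def using ring_hom_on_comp[OF hom_h ring_hom_to_fract] .

lemma inj_hF: "inj hF"
  using inj_h by (auto simp: hF_def inj_on_def)

abbreviation j :: "complex poly fract \<Rightarrow> 'a fract" where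
  "j \<equiv> fract_ext hF"

lemmas hom_j = ring_hom_fract_ext[OF hom_hF inj_hF]
lemmas inj_j = inj_fract_ext[OF hom_hF inj_hF]
lemmas j_to_fract = fract_ext_to_fract[OF hom_hF inj_hF]
lemmas j_divide = fract_ext_divide[OF hom_hF inj_hF]
lemmas j_eq_zero_iff = fract_ext_eq_zero_iff[OF hom_hF inj_hF]
lemmas j_mult = ring_hom_onD(4)[OF hom_j UNIV_I UNIV_I]
lemmas j_add = ring_hom_onD(3)[OF hom_j UNIV_I UNIV_I]
lemmas j_power = ring_hom_on_power[OF is_subring_UNIV hom_j UNIV_I]
lemmas j_sum = ring_hom_on_sum[OF is_subring_UNIV hom_j UNIV_I]

text \<open>The element \<open>w\<close> is homogeneous of degree one in the ring of homogeneous fractions, and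
  the fractions of degree zero are in \<open>\<complex>(t)\<close>.\<close>

definition uniformizer :: "'a fract \<Rightarrow> bool" where
  "uniformizer w \<longleftrightarrow> w \<noteq> 0 \<and> (\<forall>n f. f \<in> W n \<longleftrightarrow> (\<exists>r. to_fract f = j r * w ^ n))"

text \<open>For w = a/b and \<open>f\<close> of degree n, the elements f b^n and a^n have the same
  degree, so they are proportional over C[t] and f / w^n lies in C(t). The converse cancels the
  homogeneous factor.\<close>

lemma uniformizer_exists: obtains w where "uniformizer w"
proof -
  obtain a b k where ab: "a \<in> W (Suc k)" "b \<in> W k" "a \<noteq> 0" "b \<noteq> 0" by (rule degree_one_fraction)
  define w where "w = to_fract a / to_fract b"
  have wn: "w ^ n * to_fract (b ^ n) = to_fract (a ^ n)" for n
    using ab(4) by (simp add: w_def power_divide to_fract_power)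
  have bn: "to_fract (b ^ n) \<noteq> 0" for n using ab(4) by simp
  have 1: "\<exists>r. to_fract f = j r * w ^ n" if f: "f \<in> W n" for n f
  proof -
    have "f * b ^ n \<in> W (n + k * n)" by (rule W_mult[OF f W_power[OF ab(2)]])
    moreover have "a ^ n \<in> W (n + k * n)" using W_power[OF ab(1), of n] by simp
    moreover have "a ^ n \<noteq> 0" using ab(3) by simp
    ultimately obtain p q where pq: "p \<noteq> 0" "h p * (f * b ^ n) = h q * a ^ n"
      using same_degree_proportional by metis
    have "hF p * (to_fract f * to_fract (b ^ n)) = hF q * (w ^ n * to_fract (b ^ n))"
      unfolding wn hF_def using pq(2) by (metis to_fract_mult)
    then have "hF p * to_fract f = hF q * w ^ n"
      unfolding mult.assoc[symmetric] mult_right_cancel[OF bn] .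
    moreover have "hF p \<noteq> 0" using pq(1) by (simp add: hF_def h_eq_zero_iff)
    ultimately have "to_fract f = j (to_fract q / to_fract p) * w ^ n"
      using pq(1) by (simp add: j_divide field_simps)
    then show ?thesis by blast
  qed
  have 2: "f \<in> W n" if r: "to_fract f = j r * w ^ n" for n f r
  proof -
    obtain p q where pq: "r = to_fract p / to_fract q" "q \<noteq> 0" by (rule fract_coprimeE)
    have q0: "hF q \<noteq> 0" using pq(2) by (simp add: hF_def h_eq_zero_iff)
    have "hF q * (to_fract f * to_fract (b ^ n)) = hF p * (w ^ n * to_fract (b ^ n))"
      using pq q0 by (simp add: r j_divide)
    then have "to_fract (f * (h q * b ^ n)) = to_fract (h p * a ^ n)"
      unfolding wn hF_def by (simp add: mult_ac)
    then have "f * (h q * b ^ n) = h p * a ^ n" unfolding to_fract_eq_iff .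
    moreover have "h p * a ^ n \<in> W (0 + Suc k * n)" by (rule W_mult[OF h_in_W W_power[OF ab(1)]])
    ultimately have "f * (h q * b ^ n) \<in> W (n + k * n)" by simp
    moreover have "h q * b ^ n \<in> W (k * n)" using W_mult[OF h_in_W W_power[OF ab(2)]] by fastforce
    ultimately show ?thesis by (rule W_cancel) (use pq(2) ab(4) in \<open>simp add: h_eq_zero_iff\<close>)
  qed
  have "uniformizer w"
    unfolding uniformizer_def using 1 2 ab by (auto simp: w_def)
  then show ?thesis by (rule that)
qed

end

section \<open>Normal forms of divisors\<close>

lemma order_power: "p \<noteq> 0 \<Longrightarrow> order x (p ^ n) = n * order x p" for p :: "'a::idom poly"
  by (induction n) (simp_all add: order_mult order_1_eq_0)

lemma monic_eqI_order:
  fixes p q :: "complex poly"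
  assumes "lead_coeff p = 1" "lead_coeff q = 1" "\<And>x. order x p = order x q"
  shows "p = q"
proof -
  have "p \<noteq> 0" "q \<noteq> 0" using assms by auto
  then have "{z. poly p z = 0} = {z. poly q z = 0}" using assms(3) by (auto simp: order_root)
  then show ?thesis
    using complex_poly_decompose[of p] complex_poly_decompose[of q] assms by simp
qed

lemma poly_root_extraction:
  fixes p :: "complex poly"
  assumes p: "lead_coeff p = 1" and g: "\<And>x. g dvd order x p"
  obtains P where "lead_coeff P = 1" "p = P ^ g"
proof -
  let ?R = "{z. poly p z = 0}"
  define P where "P = (\<Prod>z\<in>?R. [:- z, 1:] ^ (order z p div g))"
  have "P ^ g = (\<Prod>z\<in>?R. [:- z, 1:] ^ order z p)"
    unfolding P_def prod_power_distrib using g by (simp flip: power_mult)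
  also have "\<dots> = p" using complex_poly_decompose[of p] p by simp
  finally have "p = P ^ g" by simp
  moreover have "lead_coeff P = 1" unfolding P_def by (simp add: lead_coeff_prod lead_coeff_power)
  ultimately show ?thesis using that by blast
qed

text \<open>As long as some root has order at least \<open>N\<close>, the factor (t - x)^N is split
  off; the degree falls each time.\<close>

lemma extract_powers:
  fixes f :: "complex poly"
  assumes "f \<noteq> 0" "0 < N"
  obtains g P where "g \<noteq> 0" "P \<noteq> 0" "f = g ^ N * P" "\<forall>x. order x P < N"
proof -
  have "\<exists>g P. g \<noteq> 0 \<and> P \<noteq> 0 \<and> f = g ^ N * P \<and> (\<forall>x. order x P < N)"
    using assms(1)
  proof (induction "degree f" arbitrary: f rule: less_induct)
    case less
    show ?case
    proof (cases "\<exists>x. N \<le> order x f")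
      case True
      then obtain x f1 where f1: "f = [:- x, 1:] ^ N * f1"
        using order_divides[of _ N f] by (metis dvdE)
      have "f1 \<noteq> 0" using f1 less.prems by auto
      then have "degree f = N + degree f1"
        unfolding f1 by (subst degree_mult_eq) (simp_all add: degree_linear_power)
      then obtain g P where "g \<noteq> 0" "P \<noteq> 0" "f1 = g ^ N * P" "\<forall>x. order x P < N"
        using less.hyps[of f1] \<open>f1 \<noteq> 0\<close> assms(2) by auto
      moreover from this(3) have "f = ([:- x, 1:] * g) ^ N * P"
        by (simp only: f1 power_mult_distrib mult.assoc)
      moreover from \<open>g \<noteq> 0\<close> have "[:- x, 1:] * g \<noteq> 0" by (simp only: mult_eq_0_iff) simp
      ultimately show ?thesis by blast
    next
      case False
      then show ?thesis using less.prems by (intro exI[of _ 1] exI[of _ f]) (auto simp: not_le)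
    qed
  qed
  then show ?thesis using that by blast
qed

text \<open>C[t] is principal: finitely many fractions have a greatest common divisor, and Bezout
  coefficients place it in every submodule that contains them. The empty set accounts for the
  element \<open>0\<close>.\<close>

lemma fract_gcd:
  fixes X :: "complex poly fract set"
  assumes "finite X" "X \<subseteq> M" "0 \<in> M" "\<And>x y. x \<in> M \<Longrightarrow> y \<in> M \<Longrightarrow> x + y \<in> M"
    "\<And>p x. x \<in> M \<Longrightarrow> to_fract p * x \<in> M"
  obtains q where "q \<in> M" "\<forall>x\<in>X. \<exists>p. x = to_fract p * q"
proof -
  have "\<exists>q\<in>M. \<forall>x\<in>X. \<exists>p. x = to_fract p * q"
    using assms(1,2)
  proof (induction X)
    case empty
    show ?case using assms(3) by blast
  next
    case (insert x X)
    then obtain q where q: "q \<in> M" "\<forall>x\<in>X. \<exists>p. x = to_fract p * q" by blast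
    obtain a b where x: "x = to_fract a / to_fract b" "b \<noteq> 0" by (rule fract_coprimeE)
    obtain c d where qcd: "q = to_fract c / to_fract d" "d \<noteq> 0" by (rule fract_coprimeE)
    let ?A = "a * d" and ?C = "c * b"
    define g where "g = gcd ?A ?C"
    define e where "e = to_fract g / to_fract (b * d)"
    have e: "x = to_fract ?A / to_fract (b * d)" "q = to_fract ?C / to_fract (b * d)"
      using x qcd by (simp_all add: field_simps)
    obtain u v where uv: "u * ?A + v * ?C = g"
      unfolding g_def using bezout_coefficients_fst_snd by blast
    have "e = to_fract u * x + to_fract v * q"
      unfolding e e_def uv[symmetric] by (simp only: to_fract_add to_fract_mult add_divide_distrib times_divide_eq_right)
    moreover have "x \<in> M" using insert.prems by blast
    ultimately have "e \<in> M" using assms(4,5) q(1) by simp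
    moreover have "g dvd ?A" "g dvd ?C" by (simp_all add: g_def)
    then obtain k l where kl: "?A = g * k" "?C = g * l" by (elim dvdE)
    have xq: "x = to_fract k * e" "q = to_fract l * e"
      using e(1)[unfolded kl(1)] e(2)[unfolded kl(2)] unfolding e_def
      by (simp_all only: to_fract_mult mult.commute[of "to_fract g"] times_divide_eq_right)
    moreover have "\<exists>p. y = to_fract p * e" if y: "y \<in> X" for y
    proof -
      obtain p where "y = to_fract p * q" using q(2) y by blast
      then have "y = to_fract (p * l) * e" by (simp only: xq(2) to_fract_mult mult.assoc)
      then show ?thesis by blast
    qed
    ultimately show ?case using xq(1) by blast
  qed
  then show ?thesis using that by blast
qed

text \<open>C[t] contains the g-th roots of its elements that lie in C(t), so a common factor of the
  exponent and the divisor can be removed.\<close>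

lemma coeff_set_power:
  assumes "0 < g"
  shows "coeff_set (d * g) (e ^ g) n = coeff_set d e n"
proof -
  have "r ^ (d * g) * (e ^ g) ^ n = (r ^ d * e ^ n) ^ g" for r
    by (simp add: power_mult_distrib mult.commute flip: power_mult)
  moreover have "z ^ g \<in> range to_fract \<longleftrightarrow> z \<in> range to_fract" for z :: "complex poly fract"
    using poly_root_closed[OF assms] subring_power[OF subring_range_to_fract] by blast
  ultimately show ?thesis unfolding coeff_set_def by (simp only:)
qed

lemma coeff_set_unit:
  assumes "c \<noteq> 0"
  shows "coeff_set N (to_fract [:c:] * e) n = coeff_set N e n"
proof -
  have "to_fract ([:c:] ^ n) * y \<in> range to_fract \<longleftrightarrow> y \<in> range to_fract" for y
  proof
    have "to_fract ([:1 / c:] ^ n) * (to_fract ([:c:] ^ n) * y) = to_fract (([:1 / c:] * [:c:]) ^ n) * y"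
      by (simp only: to_fract_mult power_mult_distrib mult.assoc)
    also have "\<dots> = y" using assms by (simp flip: one_pCons)
    finally show "to_fract ([:c:] ^ n) * y \<in> range to_fract \<Longrightarrow> y \<in> range to_fract"
      using subring_mult[OF subring_range_to_fract] by (metis rangeI)
  qed (rule subring_mult[OF subring_range_to_fract], simp)
  then show ?thesis
    unfolding coeff_set_def by (simp add: power_mult_distrib to_fract_power mult.left_commute[of "_ ^ N"])
qed

text \<open>Since (r s^n)^N e^n = r^N (s^N e)^n, the passage to \<open>r * s ^ n\<close> multiplies
  \<open>e\<close> by an N-th power. This turns \<open>e\<close> into a polynomial with all orders
  below \<open>N\<close>. A constant makes it monic, and the common divisor of \<open>N\<close> and
  the orders disappears by extracting a root.\<close>

lemma normal_form:
  assumes N: "0 < N" and e: "e \<noteq> 0"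
  obtains s d P where "s \<noteq> 0" "1 \<le> d" "lead_coeff P = 1" "condition_star d P"
    "\<And>n r. r * s ^ n \<in> coeff_set N e n \<longleftrightarrow> r \<in> coeff_set d (to_fract P) n"
proof -
  obtain a b where ab: "e = to_fract a / to_fract b" "b \<noteq> 0" by (rule fract_coprimeE)
  then have "a \<noteq> 0" using e by auto
  \<comment> \<open>Multiplying e = a/b by b^N gives this polynomial; taking out its N-th power k^N
    leaves \<open>P1\<close>, whence s = b/k.\<close>
  have "a * b ^ (N - 1) \<noteq> 0" using ab \<open>a \<noteq> 0\<close> by simp
  then obtain k P1 where k: "k \<noteq> 0" "P1 \<noteq> 0" "a * b ^ (N - 1) = k ^ N * P1" "\<forall>x. order x P1 < N"
    by (rule extract_powers[OF _ N])
  define s where "s = to_fract b / to_fract k"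
  have s0: "s \<noteq> 0" using ab k by (simp add: s_def)
  have "b ^ N = b ^ (N - 1) * b" using N by (metis power_minus_mult)
  then have "e * to_fract b ^ N = to_fract (a * b ^ (N - 1))"
    using ab by (simp flip: to_fract_power)
  then have se: "s ^ N * e = to_fract P1"
    using k(1) unfolding k(3) by (simp add: s_def power_divide field_simps to_fract_power)
  define c P2 where "c = lead_coeff P1" and "P2 = Polynomial.smult (1 / c) P1"
  have c: "c \<noteq> 0" using k(2) by (simp add: c_def)
  have P1: "P1 = [:c:] * P2" using c by (simp add: P2_def)
  have P2: "lead_coeff P2 = 1" "P2 \<noteq> 0" using c k(2) by (simp_all add: P2_def c_def)
  have order_P2: "order x P2 = order x P1" for x unfolding P2_def using c by (simp add: order_smult)
  let ?X = "insert N ((\<lambda>x. order x P2) ` {x. poly P2 x = 0})"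
  define g where "g = Gcd ?X"
  have "g dvd N" unfolding g_def by (rule Gcd_dvd) simp
  then obtain d where d: "N = d * g" by (metis dvdE mult.commute)
  then have dg: "0 < d" "0 < g" using N by auto
  have "g dvd order x P2" for x
  proof (cases "poly P2 x = 0")
    case True
    then show ?thesis unfolding g_def by (intro Gcd_dvd) auto
  next
    case False
    then show ?thesis by (simp add: order_0I)
  qed
  then obtain P where P: "lead_coeff P = 1" "P2 = P ^ g" by (rule poly_root_extraction[OF P2(1)])
  have P0: "P \<noteq> 0" using P(1) by auto
  have order_P: "order x P2 = g * order x P" for x unfolding P(2) by (rule order_power[OF P0])
  have less: "order x P < d" for x
  proof -
    have "g * order x P < d * g" using k(4) unfolding order_P[symmetric] order_P2 d by blast
    then show ?thesis using dg(2) by (simp only: mult.commute[of d] nat_mult_less_cancel1)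
  qed
  have star: "condition_star d P"
  \<comment> \<open>For \<open>d = 1\<close> all orders are below 1, so the monic \<open>P\<close>
    has no roots and equals 1, as the separate clause of the condition demands.\<close>
  proof (cases "d = 1")
    case True
    then have "order x P = order x 1" for x using less[of x] by (simp add: order_1_eq_0)
    then have "P = 1" using P(1) by (intro monic_eqI_order) simp_all
    then show ?thesis using True by (simp add: condition_star_def)
  next
    case False
    let ?Y = "insert d ((\<lambda>x. order x P) ` {x. poly P x = 0})"
    have roots: "poly P2 x = 0 \<longleftrightarrow> poly P x = 0" for x using P(2) dg(2) by simp
    have "?X = (*) g ` ?Y" by (auto simp: d mult.commute roots order_P image_image)
    then have "g = g * Gcd ?Y" unfolding g_def by (metis Gcd_mult normalize_nat_def id_apply)
    then have "Gcd ?Y = 1" using dg(2) by simp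
    then show ?thesis using False less P0 by (auto simp: condition_star_def order_root)
  qed
  have "r * s ^ n \<in> coeff_set N e n \<longleftrightarrow> r \<in> coeff_set d (to_fract P) n" for n r
  proof -
    have "(r * s ^ n) ^ N * e ^ n = r ^ N * (s ^ N * e) ^ n"
      by (simp add: power_mult_distrib mult.assoc mult.commute[of n] flip: power_mult)
    then have "r * s ^ n \<in> coeff_set N e n \<longleftrightarrow> r \<in> coeff_set N (to_fract P1) n"
      by (simp only: coeff_set_def mem_Collect_eq se)
    also have "coeff_set N (to_fract P1) n = coeff_set N (to_fract P2) n"
      unfolding P1 to_fract_mult by (rule coeff_set_unit[OF c])
    also have "\<dots> = coeff_set d (to_fract P) n"
      unfolding P(2) d to_fract_power by (rule coeff_set_power[OF dg(2)])
    finally show ?thesis .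
  qed
  then show ?thesis using that[OF s0 _ P(1) star] dg by simp
qed

section \<open>The modules of coefficients of a graded surface\<close>

context graded_surface
begin

lemma uniformizer_mult:
  assumes "uniformizer w" "s \<noteq> 0"
  shows "uniformizer (j s * w)"
proof -
  have eq: "j (r / s ^ n) * (j s * w) ^ n = j r * w ^ n" for r n
  proof -
    have "j (r / s ^ n) * j s ^ n = j r"
      using assms(2) by (simp flip: j_power j_mult)
    then show ?thesis by (simp only: power_mult_distrib mult.assoc[symmetric])
  qed
  have eq': "j r * (j s * w) ^ n = j (r * s ^ n) * w ^ n" for r n
    by (simp add: j_mult j_power power_mult_distrib)
  have w: "w \<noteq> 0" "\<And>n f. f \<in> W n \<longleftrightarrow> (\<exists>r. to_fract f = j r * w ^ n)"
    using assms(1) unfolding uniformizer_def by auto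
  show ?thesis
    unfolding uniformizer_def
  proof (intro conjI allI iffI)
    show "j s * w \<noteq> 0" using w(1) assms(2) by (simp add: j_eq_zero_iff)
    fix n f
    show "f \<in> W n \<Longrightarrow> \<exists>r. to_fract f = j r * (j s * w) ^ n" unfolding w(2) using eq by metis
    show "\<exists>r. to_fract f = j r * (j s * w) ^ n \<Longrightarrow> f \<in> W n" unfolding w(2) eq' by blast
  qed
qed

text \<open>Write a generator of degree i as s w^i. As i divides \<open>N\<close>, a power of it has
  degree \<open>N\<close> and coefficient s^(N/i); \<open>q\<close> divides all these coefficients,
  and q w^N lies in the ring. With e = 1/q the value s^N e^i is then the i-th power of a polynomial,
  and the condition is stable under sums and products, so it holds for all homogeneous elements.
  Conversely r^N = p q^n gives (r w^n)^N = p (q w^N)^n, which lies in the ring, and normality yields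
  r w^n.\<close>

lemma coeff_set_of_homogeneous:
  assumes w: "uniformizer w"
  obtains N e where "0 < N" "e \<noteq> 0" "\<And>n r. j r * w ^ n \<in> range to_fract \<longleftrightarrow> r \<in> coeff_set N e n"
proof -
  have w0: "w \<noteq> 0" and W_iff: "\<And>n f. f \<in> W n \<longleftrightarrow> (\<exists>r. to_fract f = j r * w ^ n)"
    using w unfolding uniformizer_def by auto
  have cancel: "r = r'" if "j r * w ^ n = j r' * w ^ n" for r r' n
    using that w0 inj_j by (simp add: inj_eq)
  have "\<forall>y\<in>H. \<exists>r. to_fract (fst y) = j r * w ^ snd y" using H_W unfolding W_iff by blast
  from bchoice[OF this] obtain s where "\<forall>y\<in>H. to_fract (fst y) = j (s y) * w ^ snd y" ..
  note s = bspec[OF this]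
  define N where "N = (\<Prod>y\<in>H. snd y)"
  have N: "0 < N" unfolding N_def using finite_H H_pos by (simp add: prod_pos)
  have dvdN: "snd y dvd N" if "y \<in> H" for y unfolding N_def using that finite_H by (rule dvd_prodI[rotated])
  define M where "M = {r. j r * w ^ N \<in> range to_fract}"
  let ?X = "(\<lambda>y. s y ^ (N div snd y)) ` H"
  have R: "is_subring (range to_fract :: 'a fract set)" by (rule subring_range_to_fract)
  have XM: "?X \<subseteq> M"
  proof (rule image_subsetI)
    fix y assume y: "y \<in> H"
    have "j (s y ^ (N div snd y)) * w ^ N = (j (s y) * w ^ snd y) ^ (N div snd y)"
      using dvdN[OF y] by (simp add: j_power power_mult_distrib flip: power_mult)
    also have "\<dots> = to_fract (fst y ^ (N div snd y))" by (simp add: s[OF y] to_fract_power)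
    finally show "s y ^ (N div snd y) \<in> M" unfolding M_def by blast
  qed
  have M0: "0 \<in> M" using j_eq_zero_iff[of 0] subring_zero[OF R] by (simp add: M_def)
  have Madd: "x + y \<in> M" if "x \<in> M" "y \<in> M" for x y
    using that subring_add[OF R] unfolding M_def mem_Collect_eq j_add distrib_right by blast
  have Msmult: "to_fract p * x \<in> M" if "x \<in> M" for p x
    using that subring_mult[OF R, of "hF p"] unfolding M_def mem_Collect_eq j_mult j_to_fract mult.assoc
    by (simp add: hF_def)
  obtain q where q: "q \<in> M" "\<forall>x\<in>?X. \<exists>p. x = to_fract p * q"
    by (rule fract_gcd[OF finite_imageI[OF finite_H] XM M0 Madd Msmult])
  have "q \<noteq> 0"
  proof
    assume "q = 0"
    have zero: "fst y = 0" if y: "y \<in> H" for y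
    proof -
      have "s y ^ (N div snd y) = 0" using q(2) y \<open>q = 0\<close> by auto
      then have "s y = 0" by simp
      then show ?thesis using s[OF y] j_eq_zero_iff[of 0] by simp
    qed
    \<comment> \<open>If all generators of positive degree vanished, everything would have degree 0,
      which is divisible by 2, against effectivity.\<close>
    have "range h = UNIV"
      by (rule generated_H[OF is_subring_image[OF is_subring_UNIV hom_h]])
        (use zero h_zero in \<open>auto intro: range_eqI[of _ _ 0]\<close>)
    moreover obtain n f where "\<gamma> f = monom f n" "f \<noteq> 0" "\<not> 2 dvd n" using effective[of 2] by auto
    ultimately show False using range_h_eq_W coeff_W[of f 0 n] coeff_W[of f n n]
      by (metis UNIV_I coeff_monom dvd_0_right)
  qed
  define e where "e = inverse q"
  have e: "e \<noteq> 0" using \<open>q \<noteq> 0\<close> by (simp add: e_def)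
  let ?J = "coeff_set N e"
  have 1: "r \<in> ?J n" if r: "j r * w ^ n \<in> range to_fract" for r n
  proof -
    \<comment> \<open>Quantifying over every \<open>r\<close> avoids naming the coefficient of a
      component; it is unique since \<open>w\<close> is nonzero and \<open>j\<close> is
      injective.\<close>
    let ?T = "{f. \<forall>n r. to_fract (coeff (\<gamma> f) n) = j r * w ^ n \<longrightarrow> r \<in> ?J n}"
    have zero: "r \<in> ?J n" if "0 = j r * w ^ n" for r n
      using that w0 coeff_set_zero[OF N] by (simp add: j_eq_zero_iff)
    have pure: "f \<in> ?T" if f: "f \<in> W n" "to_fract f = j r * w ^ n" "r \<in> ?J n" for f n r
    proof (intro CollectI allI impI)
      fix n' r' assume r': "to_fract (coeff (\<gamma> f) n') = j r' * w ^ n'"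
      show "r' \<in> ?J n'"
      proof (cases "n' = n")
        case True
        have "coeff (\<gamma> f) n = f" by (simp add: coeff_W[OF f(1)])
        then have "j r' * w ^ n = j r * w ^ n" using trans[OF r'[symmetric]] f(2) True by simp
        then have "r' = r" by (rule cancel)
        then show ?thesis using True f(3) by simp
      next
        case False
        then have "0 = j r' * w ^ n'" using r' by (simp only: coeff_W[OF f(1)] if_False to_fract_0)
        then show ?thesis by (rule zero)
      qed
    qed
    have TD: "r \<in> ?J n" if "f \<in> ?T" "to_fract (coeff (\<gamma> f) n) = j r * w ^ n" for f n r
      using that by simp
    have comp: "\<exists>r. to_fract (coeff (\<gamma> f) n) = j r * w ^ n" for f n using coeff_in_W W_iff by blast
    have "?T = UNIV"
    proof (rule generated_H)
      show "is_subring ?T"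
        unfolding is_subring_def
      proof (intro conjI ballI)
        have "to_fract (1 :: 'a) = j 1 * w ^ 0" using ring_hom_onD(2)[OF hom_j] by simp
        moreover have "1 \<in> ?J 0" using coeff_set_to_fract[of 1] by simp
        ultimately show "1 \<in> ?T" by (rule pure[OF W_one])
        fix f g assume f: "f \<in> ?T" and g: "g \<in> ?T"
        show "f - g \<in> ?T"
        proof (intro CollectI allI impI)
          fix n r assume r: "to_fract (coeff (\<gamma> (f - g)) n) = j r * w ^ n"
          obtain r1 where r1: "to_fract (coeff (\<gamma> f) n) = j r1 * w ^ n" using comp by blast
          obtain r2 where r2: "to_fract (coeff (\<gamma> g) n) = j r2 * w ^ n" using comp by blast
          have "r1 \<in> ?J n" "r2 \<in> ?J n" using TD[OF f r1] TD[OF g r2] .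
          then have "r1 + - r2 \<in> ?J n" by (intro coeff_set_add[OF N] coeff_set_uminus)
          moreover have "j r * w ^ n = j (r1 + - r2) * w ^ n"
            unfolding r[symmetric] j_add ring_hom_on_uminus[OF is_subring_UNIV hom_j UNIV_I]
            by (simp add: \<gamma>_diff r1 r2 left_diff_distrib)
          ultimately show "r \<in> ?J n" using cancel by metis
        qed
        show "f * g \<in> ?T"
        proof (intro CollectI allI impI)
          fix n r assume r: "to_fract (coeff (\<gamma> (f * g)) n) = j r * w ^ n"
          from choice[OF allI[OF comp[of f]]]
          obtain r1 where r1: "\<forall>k. to_fract (coeff (\<gamma> f) k) = j (r1 k) * w ^ k" ..
          from choice[OF allI[OF comp[of g]]]
          obtain r2 where r2: "\<forall>k. to_fract (coeff (\<gamma> g) k) = j (r2 k) * w ^ k" ..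
          have "r1 k * r2 (n - k) \<in> ?J n" if "k \<le> n" for k
          proof -
            have "r1 k \<in> ?J k" "r2 (n - k) \<in> ?J (n - k)" using TD[OF f r1[rule_format]] TD[OF g r2[rule_format]] .
            then have "r1 k * r2 (n - k) \<in> ?J (k + (n - k))" by (rule coeff_set_mult)
            then show ?thesis using that by simp
          qed
          then have "(\<Sum>k\<le>n. r1 k * r2 (n - k)) \<in> ?J n" by (intro coeff_set_sum[OF N]) simp
          moreover have "j r * w ^ n = j (\<Sum>k\<le>n. r1 k * r2 (n - k)) * w ^ n"
          proof -
            have "j r * w ^ n = (\<Sum>k\<le>n. (j (r1 k) * w ^ k) * (j (r2 (n - k)) * w ^ (n - k)))"
              unfolding r[symmetric] by (simp add: \<gamma>_mult coeff_mult r1 r2)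
            also have "\<dots> = (\<Sum>k\<le>n. j (r1 k * r2 (n - k)) * w ^ n)"
            proof (rule sum.cong[OF refl])
              fix k assume "k \<in> {..n}"
              then have "w ^ n = w ^ k * w ^ (n - k)" by (simp flip: power_add)
              then show "(j (r1 k) * w ^ k) * (j (r2 (n - k)) * w ^ (n - k)) = j (r1 k * r2 (n - k)) * w ^ n"
                by (simp only: j_mult mult_ac)
            qed
            finally show ?thesis by (simp add: j_sum sum_distrib_right)
          qed
          ultimately show "r \<in> ?J n" using cancel by metis
        qed
      qed
      have "h p \<in> ?T" for p
        by (rule pure[OF h_in_W, of _ "to_fract p"]) (simp_all add: j_to_fract hF_def coeff_set_to_fract)
      then show "range h \<subseteq> ?T" by blast
      have "fst y \<in> ?T" if y: "y \<in> H" for y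
      proof (rule pure[OF H_W[OF y] s[OF y]])
        obtain p where "s y ^ (N div snd y) = to_fract p * q" using q(2) y by blast
        then have p: "s y ^ (N div snd y) * e = to_fract p" using \<open>q \<noteq> 0\<close> by (simp add: e_def)
        have "s y ^ N * e ^ snd y = (s y ^ (N div snd y) * e) ^ snd y"
          using dvdN[OF y] by (simp add: power_mult_distrib flip: power_mult)
        also have "\<dots> \<in> range to_fract" unfolding p by (simp flip: to_fract_power)
        finally show "s y \<in> ?J (snd y)" by (simp add: coeff_set_def)
      qed
      then show "fst ` H \<subseteq> ?T" by blast
    qed
    obtain f where f: "j r * w ^ n = to_fract f" using r by blast
    then have "f \<in> W n" using W_iff by metis
    then have "coeff (\<gamma> f) n = f" by (simp add: coeff_W)
    moreover have "f \<in> ?T" unfolding \<open>?T = UNIV\<close> ..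
    ultimately show ?thesis using TD[of f n r] f by simp
  qed
  have 2: "j r * w ^ n \<in> range to_fract" if r: "r \<in> ?J n" for r n
  proof (rule normal, rule integral_over_root[OF R N])
    obtain p where "r ^ N * e ^ n = to_fract p" using r unfolding coeff_set_def by blast
    then have "r ^ N = to_fract p * q ^ n" using \<open>q \<noteq> 0\<close> by (simp add: e_def power_inverse field_simps)
    then have "j r ^ N = hF p * j q ^ n" by (metis j_mult j_power j_to_fract)
    then have "(j r * w ^ n) ^ N = hF p * (j q * w ^ N) ^ n"
      by (simp add: power_mult_distrib mult.commute[of n] flip: power_mult)
    also have "\<dots> \<in> range to_fract"
    proof (rule subring_mult[OF R _ subring_power[OF R]])
      show "j q * w ^ N \<in> range to_fract" using q(1) unfolding M_def by blast
    qed (simp add: hF_def)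
    finally show "(j r * w ^ n) ^ N \<in> range to_fract" .
  qed
  show ?thesis using that[OF N e] 1 2 by blast
qed

theorem graded_structure:
  obtains d P w where "1 \<le> d" "lead_coeff P = 1" "condition_star d P" "uniformizer w"
    "\<And>n r. j r * w ^ n \<in> range to_fract \<longleftrightarrow> r \<in> coeff_set d (to_fract P) n"
proof -
  obtain w where w: "uniformizer w" by (rule uniformizer_exists)
  obtain N e where Ne: "0 < N" "e \<noteq> 0"
    and M: "\<And>n r. j r * w ^ n \<in> range to_fract \<longleftrightarrow> r \<in> coeff_set N e n"
    by (rule coeff_set_of_homogeneous[OF w]) blast
  obtain s d P where s: "s \<noteq> 0" and dP: "1 \<le> d" "lead_coeff P = 1" "condition_star d P"
    and eq: "\<And>n r. r * s ^ n \<in> coeff_set N e n \<longleftrightarrow> r \<in> coeff_set d (to_fract P) n"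
    by (rule normal_form[OF Ne]) blast
  have "j r * (j s * w) ^ n = j (r * s ^ n) * w ^ n" for r n
    by (simp add: j_mult j_power power_mult_distrib)
  then show ?thesis using that[OF dP uniformizer_mult[OF w s]] M eq by simp
qed

end

section \<open>Torus actions\<close>

lemma nontrivial_root_of_unity: 
  assumes "2 \<le> k" obtains c :: complex where "c ^ k = 1" "c \<noteq> 1" "c \<noteq> 0"
proof -
  have "card {z :: complex. z ^ k = 1} = k" using assms by (intro card_roots_unity_eq) simp
  then have "\<not> {z :: complex. z ^ k = 1} \<subseteq> {1}"
    using assms card_mono[of "{1 :: complex}" "{z. z ^ k = 1}"] by auto
  then obtain c :: complex where "c ^ k = 1" "c \<noteq> 1" by blast
  moreover from this(1) have "c \<noteq> 0" using assms by (auto simp: power_0_left)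
  ultimately show ?thesis by (rule that)
qed

locale torus_surface =
  fixes \<iota> :: "complex \<Rightarrow> 'a::idom" and act :: "complex \<Rightarrow> 'a \<Rightarrow> 'a" and t :: 'a
  assumes surface: "normal_affine_surface \<iota> (UNIV :: 'a set)"
    and action: "torus_action \<iota> UNIV act"
    and effective_act: "effective_action UNIV act"
    and nonneg: "\<And>i. i < 0 \<Longrightarrow> weight_space \<iota> UNIV act i = {0}"
    and inj_t: "inj (poly_embed \<iota> t)"
    and weight_0: "weight_space \<iota> UNIV act 0 = range (poly_embed \<iota> t)"
begin

lemma hom_\<iota>: "ring_hom_on UNIV UNIV \<iota>"
  using surface unfolding normal_affine_surface_def by blast

lemma hom_act: "c \<noteq> 0 \<Longrightarrow> ring_hom_on UNIV UNIV (act c)"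
  using action unfolding torus_action_def by blast

lemma act_\<iota>: "c \<noteq> 0 \<Longrightarrow> act c (\<iota> z) = \<iota> z"
  using action unfolding torus_action_def by blast

lemma act_one: "act 1 f = f"
  using action unfolding torus_action_def by blast

lemma act_act: "c \<noteq> 0 \<Longrightarrow> d \<noteq> 0 \<Longrightarrow> act (c * d) f = act c (act d f)"
  using action unfolding torus_action_def by blast

lemma act_expansion:
  obtains I g where "finite I" "\<forall>c. c \<noteq> 0 \<longrightarrow> act c f = (\<Sum>i\<in>I. \<iota> (c powi i) * g i)"
proof -
  have "\<exists>(I :: int set) g. finite I \<and> (\<forall>i\<in>I. g i \<in> UNIV) \<and>
      (\<forall>c. c \<noteq> 0 \<longrightarrow> act c f = (\<Sum>i\<in>I. \<iota> (c powi i) * g i))"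
    using action unfolding torus_action_def by blast
  then show ?thesis using that by blast
qed

lemmas \<iota>_mult = ring_hom_onD(4)[OF hom_\<iota> UNIV_I UNIV_I]
lemmas \<iota>_one = ring_hom_onD(2)[OF hom_\<iota>]
lemmas \<iota>_power = ring_hom_on_power[OF is_subring_UNIV hom_\<iota> UNIV_I]
lemmas \<iota>_zero = ring_hom_on_zero[OF is_subring_UNIV hom_\<iota>]

lemma inj_\<iota>: "inj \<iota>"
proof (rule injI)
  fix x y assume eq: "\<iota> x = \<iota> y"
  show "x = y"
  proof (rule ccontr)
    assume "x \<noteq> y"
    have "\<iota> (x - y) + \<iota> y = \<iota> x" by (simp flip: ring_hom_onD(3)[OF hom_\<iota> UNIV_I UNIV_I])
    then have "\<iota> (x - y) = 0" using eq by simp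
    moreover have "\<iota> (x - y) * \<iota> (inverse (x - y)) = 1"
      using \<open>x \<noteq> y\<close> by (simp flip: \<iota>_mult add: \<iota>_one)
    ultimately show False by simp
  qed
qed

text \<open>The points \<open>\<iota> c\<close> are infinitely many and the coefficients lie in a
  domain. Hence the action determines the coaction.\<close>

lemma poly_eqI_torus:
  assumes "\<And>c. c \<noteq> 0 \<Longrightarrow> poly p (\<iota> c) = poly q (\<iota> c)"
  shows "p = q"
proof (rule ccontr)
  assume "p \<noteq> q"
  then have "finite {x. poly (p - q) x = 0}" by (intro poly_roots_finite) simp
  moreover have "\<iota> ` (UNIV - {0}) \<subseteq> {x. poly (p - q) x = 0}" using assms by auto
  ultimately have "finite (\<iota> ` (UNIV - {0}))" by (rule finite_subset[rotated])
  then have "finite (UNIV - {0 :: complex})"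
    using inj_\<iota> by (meson finite_imageD inj_on_subset subset_UNIV)
  then show False using infinite_UNIV_char_0[where ?'a = complex] by simp
qed

text \<open>Multiplication by a power of \<open>c\<close> that exceeds all the exponents in absolute
  value turns the Laurent expression into a polynomial.\<close>

lemma laurent_coeffs_zero:
  assumes I: "finite I" and zero: "\<And>c. c \<noteq> 0 \<Longrightarrow> (\<Sum>i\<in>I. \<iota> (c powi i) * a i) = 0" and i: "i \<in> I"
  shows "a i = 0"
proof -
  define m where "m = (\<Sum>i\<in>I. \<bar>i\<bar>)"
  have m: "0 \<le> k + m" if "k \<in> I" for k
  proof -
    have "\<bar>k\<bar> \<le> m" unfolding m_def by (rule member_le_sum[OF that _ I]) simp
    then show ?thesis by linarith
  qed
  define p where "p = (\<Sum>k\<in>I. monom (a k) (nat (k + m)))"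
  have "poly p (\<iota> c) = poly 0 (\<iota> c)" if c: "c \<noteq> 0" for c
  proof -
    have "\<iota> c ^ nat (k + m) = \<iota> (c powi m) * \<iota> (c powi k)" if "k \<in> I" for k
    proof -
      have "c ^ nat (k + m) = c powi (k + m)" using m[OF that] by (simp add: power_int_def)
      also have "\<dots> = c powi m * c powi k" using c by (simp add: power_int_add)
      finally have "\<iota> (c ^ nat (k + m)) = \<iota> (c powi m) * \<iota> (c powi k)" by (simp add: \<iota>_mult)
      then show ?thesis by (simp add: \<iota>_power)
    qed
    then have "poly p (\<iota> c) = \<iota> (c powi m) * (\<Sum>k\<in>I. \<iota> (c powi k) * a k)"
      by (simp add: p_def poly_sum poly_monom sum_distrib_left mult_ac)
    then show ?thesis using zero[OF c] by simp
  qed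
  then have "p = 0" by (rule poly_eqI_torus)
  moreover have "coeff p (nat (i + m)) = (\<Sum>k\<in>I. if k = i then a k else 0)"
    unfolding p_def coeff_sum by (rule sum.cong) (use m[OF i] m in \<open>auto simp: nat_eq_iff\<close>)
  ultimately show ?thesis using I i by simp
qed

lemma in_weight_space: "f \<in> weight_space \<iota> UNIV act i \<longleftrightarrow> (\<forall>c. c \<noteq> 0 \<longrightarrow> act c f = \<iota> (c powi i) * f)"
  by (simp add: weight_space_def)

text \<open>The action of d on c.f has two Laurent expansions in c; comparing their coefficients
  shows that \<open>g i\<close> has weight \<open>i\<close>. The negative weights vanish by
  \<open>nonneg\<close>, which leaves a polynomial.\<close>

lemma coaction_exists:
  obtains p where "\<forall>c. c \<noteq> 0 \<longrightarrow> poly p (\<iota> c) = act c f"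
    "\<forall>i. coeff p i \<in> weight_space \<iota> UNIV act (int i)"
proof -
  obtain I g where I: "finite I" and g: "\<forall>c. c \<noteq> 0 \<longrightarrow> act c f = (\<Sum>i\<in>I. \<iota> (c powi i) * g i)"
    by (rule act_expansion)
  have weight: "g i \<in> weight_space \<iota> UNIV act i" if i: "i \<in> I" for i
    unfolding in_weight_space
  proof (intro allI impI)
    fix d :: complex assume d: "d \<noteq> 0"
    have "act d (g i) - \<iota> (d powi i) * g i = 0"
    proof (rule laurent_coeffs_zero[OF I _ i])
      fix c :: complex assume c: "c \<noteq> 0"
      have "act d (act c f) = (\<Sum>i\<in>I. \<iota> (c powi i) * act d (g i))"
        using c d by (simp add: g ring_hom_on_sum[OF is_subring_UNIV hom_act] ring_hom_onD(4)[OF hom_act] act_\<iota>)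
      moreover have "act d (act c f) = (\<Sum>i\<in>I. \<iota> (c powi i) * (\<iota> (d powi i) * g i))"
      proof -
        have "act d (act c f) = act (c * d) f" using act_act[OF d c] by (simp add: mult.commute)
        also have "\<dots> = (\<Sum>i\<in>I. \<iota> ((c * d) powi i) * g i)" using g c d by simp
        finally show ?thesis by (simp add: power_int_mult_distrib \<iota>_mult mult.assoc)
      qed
      ultimately show "(\<Sum>i\<in>I. \<iota> (c powi i) * (act d (g i) - \<iota> (d powi i) * g i)) = 0"
        by (simp add: right_diff_distrib sum_subtractf)
    qed
    then show "act d (g i) = \<iota> (d powi i) * g i" by simp
  qed
  define I' where "I' = {i \<in> I. 0 \<le> i}"
  have zero: "g i = 0" if "i \<in> I - I'" for i
    using weight[of i] nonneg[of i] that by (auto simp: I'_def)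
  define p where "p = (\<Sum>i\<in>I'. monom (g i) (nat i))"
  have I': "finite I'" using I by (simp add: I'_def)
  have "poly p (\<iota> c) = act c f" if c: "c \<noteq> 0" for c
  proof -
    have "act c f = (\<Sum>i\<in>I'. \<iota> (c powi i) * g i)"
      using g c by (simp add: I'_def) (rule sum.mono_neutral_right[OF I], use zero I'_def in auto)
    also have "\<dots> = (\<Sum>i\<in>I'. \<iota> c ^ nat i * g i)"
      by (rule sum.cong) (auto simp: I'_def power_int_def \<iota>_power)
    also have "\<dots> = poly p (\<iota> c)" by (simp add: p_def poly_sum poly_monom mult.commute)
    finally show ?thesis by simp
  qed
  moreover have "coeff p n \<in> weight_space \<iota> UNIV act (int n)" for n
  proof -
    have "coeff p n = (\<Sum>i\<in>I'. if i = int n then g i else 0)"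
      unfolding p_def coeff_sum by (rule sum.cong) (auto simp: I'_def)
    also have "\<dots> = (if int n \<in> I' then g (int n) else 0)" using I' by simp
    also have "\<dots> \<in> weight_space \<iota> UNIV act (int n)"
      using weight[of "int n"] by (auto simp: I'_def in_weight_space ring_hom_on_zero[OF is_subring_UNIV hom_act])
    finally show ?thesis .
  qed
  ultimately show ?thesis using that by blast
qed

text \<open>By \<open>poly_eqI_torus\<close> only one polynomial has these values, so the weights of
  its coefficients need not be part of the choice.\<close>

definition coaction :: "'a \<Rightarrow> 'a poly" where
  "coaction f = (SOME p. \<forall>c. c \<noteq> 0 \<longrightarrow> poly p (\<iota> c) = act c f)"

lemma poly_coaction: "c \<noteq> 0 \<Longrightarrow> poly (coaction f) (\<iota> c) = act c f"
proof -
  have "\<exists>p. \<forall>c. c \<noteq> 0 \<longrightarrow> poly p (\<iota> c) = act c f" by (rule coaction_exists[of f]) blast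
  then have "\<forall>c. c \<noteq> 0 \<longrightarrow> poly (coaction f) (\<iota> c) = act c f"
    unfolding coaction_def by (rule someI_ex)
  then show "c \<noteq> 0 \<Longrightarrow> poly (coaction f) (\<iota> c) = act c f" by blast
qed

lemma coaction_eqI: "(\<And>c. c \<noteq> 0 \<Longrightarrow> poly p (\<iota> c) = act c f) \<Longrightarrow> coaction f = p"
  by (rule poly_eqI_torus) (simp add: poly_coaction)

lemma coeff_coaction: "coeff (coaction f) i \<in> weight_space \<iota> UNIV act (int i)"
  by (rule coaction_exists[of f]) (metis coaction_eqI)

lemma weight_space_iff_coaction:
  "f \<in> weight_space \<iota> UNIV act (int n) \<longleftrightarrow> coaction f = monom f n"
proof
  assume "f \<in> weight_space \<iota> UNIV act (int n)"
  then show "coaction f = monom f n"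
    by (intro coaction_eqI) (simp add: in_weight_space poly_monom \<iota>_power mult.commute)
next
  assume m: "coaction f = monom f n"
  show "f \<in> weight_space \<iota> UNIV act (int n)"
    unfolding in_weight_space
    using m by (auto simp flip: poly_coaction simp: poly_monom \<iota>_power mult.commute)
qed

lemma hom_coaction: "ring_hom_on UNIV UNIV coaction"
  unfolding ring_hom_on_def
  by (auto intro!: coaction_eqI simp: poly_coaction ring_hom_onD[OF hom_act])

definition gens :: "'a set" where
  "gens = (SOME S. finite S \<and> UNIV = is_subring hull (range \<iota> \<union> S))"

lemma gens: "finite gens" "UNIV = is_subring hull (range \<iota> \<union> gens)"
proof -
  have "\<exists>S. finite S \<and> (UNIV :: 'a set) = is_subring hull (range \<iota> \<union> S)"
    using surface unfolding normal_affine_surface_def by blast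
  then have "finite gens \<and> UNIV = is_subring hull (range \<iota> \<union> gens)"
    unfolding gens_def by (rule someI_ex)
  then show "finite gens" "UNIV = is_subring hull (range \<iota> \<union> gens)" by blast+
qed

lemma hom_poly_embed: "ring_hom_on UNIV UNIV (poly_embed \<iota> t)"
  using ring_hom_eval[OF hom_\<iota>, of t] by (simp add: poly_embed_def[abs_def])

lemma poly_embed_const: "poly_embed \<iota> t [:c:] = \<iota> c"
  by (cases "c = 0") (simp_all add: poly_embed_def map_poly_pCons \<iota>_zero)

lemma no_chain_of_four:
  assumes "p0 \<in> spec UNIV" "p1 \<in> spec UNIV" "p2 \<in> spec UNIV" "p3 \<in> spec (UNIV :: 'a set)"
  shows "\<not> (p0 \<subset> p1 \<and> p1 \<subset> p2 \<and> p2 \<subset> p3)"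
proof
  assume ch: "p0 \<subset> p1 \<and> p1 \<subset> p2 \<and> p2 \<subset> p3"
  define c where "c = (!) [p0, p1, p2, p3]"
  have "c i \<in> spec UNIV" if "i \<le> 3" for i
  proof -
    have "i = 0 \<or> i = 1 \<or> i = 2 \<or> i = 3" using that by linarith
    then show ?thesis using assms by (auto simp: c_def)
  qed
  moreover have "c i \<subset> c (Suc i)" if "i < 3" for i
  proof -
    have "i = 0 \<or> i = 1 \<or> i = 2" using that by linarith
    then show ?thesis using ch by (auto simp: c_def)
  qed
  ultimately have "3 \<in> {n. \<exists>c. (\<forall>i\<le>n. c i \<in> spec (UNIV :: 'a set)) \<and> (\<forall>i<n. c i \<subset> c (Suc i))}" by blast
  then have "enat 3 \<le> krull_dim (UNIV :: 'a set)" unfolding krull_dim_def by (rule SUP_upper)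
  also have "\<dots> = 2" using surface unfolding normal_affine_surface_def by blast
  also have "(2 :: enat) = enat 2" by (simp add: numeral_eq_enat)
  finally show False by simp
qed

text \<open>If \<open>k\<close> divided every degree that occurs, a k-th root of unity other than 1
  would fix all components and so act trivially.\<close>

lemma degrees_coprime:
  assumes "2 \<le> (k :: nat)"
  shows "\<exists>n f. coaction f = monom f n \<and> f \<noteq> 0 \<and> \<not> k dvd n"
proof (rule ccontr)
  assume "\<not> ?thesis"
  then have dvd: "k dvd n" if "coaction f = monom f n" "f \<noteq> 0" for f n using that by blast
  obtain c :: complex where c: "c ^ k = 1" "c \<noteq> 1" "c \<noteq> 0" by (rule nontrivial_root_of_unity[OF assms])
  have "act c f = f" for f
  proof -
    have pow: "coeff (coaction f) i * \<iota> c ^ i = coeff (coaction f) i * \<iota> 1 ^ i" for i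
    proof (cases "coeff (coaction f) i = 0")
      case False
      have "coaction (coeff (coaction f) i) = monom (coeff (coaction f) i) i"
        using coeff_coaction weight_space_iff_coaction by blast
      then have "k dvd i" using dvd False by blast
      then obtain l where "i = k * l" by (elim dvdE)
      then have "\<iota> c ^ i = \<iota> ((c ^ k) ^ l)" by (simp only: \<iota>_power power_mult)
      then show ?thesis by (simp add: c(1) \<iota>_one)
    qed simp
    have "poly (coaction f) (\<iota> c) = poly (coaction f) (\<iota> 1)" by (simp only: poly_altdef pow)
    then show ?thesis using c(3) by (simp add: poly_coaction act_one)
  qed
  then have "morph_eq UNIV UNIV (spec_map UNIV UNIV (act c)) morph_id"
    by (intro morph_eq_spec_map_id[OF is_subring_UNIV])
  then show False using effective_act c unfolding effective_action_def by blast
qed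

sublocale graded_surface coaction "poly_embed \<iota> t" gens
proof
  show "ring_hom_on UNIV UNIV coaction" by (rule hom_coaction)
  show "poly (coaction f) 1 = f" for f using poly_coaction[of 1 f] by (simp add: \<iota>_one act_one)
  show "coaction (coeff (coaction f) i) = monom (coeff (coaction f) i) i" for f i
    using coeff_coaction weight_space_iff_coaction by blast
  show "ring_hom_on UNIV UNIV (poly_embed \<iota> t)" by (rule hom_poly_embed)
  show "inj (poly_embed \<iota> t)" by (rule inj_t)
  show "range (poly_embed \<iota> t) = {f. coaction f = monom f 0}"
    by (rule Set.set_eqI) (simp only: mem_Collect_eq weight_space_iff_coaction[of _ 0, unfolded of_nat_0 weight_0])
  show "finite gens" by (rule gens(1))
  \<comment> \<open>The surface is generated over the constants, which are the images of the
    constant polynomials in \<open>t\<close>.\<close>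
  show "T = UNIV" if T: "is_subring T" "range (poly_embed \<iota> t) \<subseteq> T" "gens \<subseteq> T" for T
  proof -
    have "\<iota> c \<in> T" for c using subsetD[OF T(2) rangeI, of "[:c:]"] by (simp only: poly_embed_const)
    then have "range \<iota> \<subseteq> T" by blast
    then have "is_subring hull (range \<iota> \<union> gens) \<subseteq> T" using T by (intro hull_minimal) auto
    then have "UNIV \<subseteq> T" by (subst gens(2))
    then show ?thesis by blast
  qed
  show "x \<in> range to_fract" if "integral_over (range to_fract) x" for x :: "'a fract"
  proof -
    obtain a b where "x = Fract a b" "b \<noteq> 0" by (cases x)
    then have "x \<in> frac_field (UNIV :: 'a set)" unfolding frac_field_def by blast
    moreover have "normal_domain (UNIV :: 'a set)"
      using surface unfolding normal_affine_surface_def by blast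
    ultimately show ?thesis using that unfolding normal_domain_def by blast
  qed
  show "\<not> (p0 \<subset> p1 \<and> p1 \<subset> p2 \<and> p2 \<subset> p3)"
    if "p0 \<in> spec UNIV" "p1 \<in> spec UNIV" "p2 \<in> spec UNIV" "p3 \<in> spec UNIV" for p0 p1 p2 p3 :: "'a set"
    using that by (rule no_chain_of_four)
  show "\<exists>n f. coaction f = monom f n \<and> f \<noteq> 0 \<and> \<not> k dvd n" if "2 \<le> k" for k
    using that by (rule degrees_coprime)
qed

end

section \<open>Equivariant isomorphisms and uniqueness\<close>

lemma poly_embed_tu_eq: "poly_embed const_tu t_var = const_t"
  by (rule ext) (rule poly_embed_tu)

lemma ring_hom_scale_u:
  assumes d: "0 < d" and P: "P \<noteq> 0" and c: "c \<noteq> 0"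
  shows "ring_hom_on (A_plus d P) (A_plus d P) (scale_u c)"
proof -
  have hom: "ring_hom_on UNIV UNIV (rescale c)"
    unfolding rescale_def by (rule ring_hom_substitution)
  have eq: "scale_u c (eval_tu f) = eval_tu (rescale c f)" for f by (rule scale_u_eval_tu[OF c])
  show ?thesis
    unfolding ring_hom_on_def A_plus_eq[OF d P]
  proof (intro conjI ballI)
    show "scale_u c ` eval_tu ` graded_subring d P \<subseteq> eval_tu ` graded_subring d P"
      using rescale_in_graded_subring by (auto simp: eq)
    show "scale_u c 1 = 1"
      using eq[of 1] ring_hom_onD(2)[OF hom] ring_hom_onD(2)[OF ring_hom_eval_tu] by simp
    fix x y assume "x \<in> eval_tu ` graded_subring d P" "y \<in> eval_tu ` graded_subring d P"
    then obtain f g where x: "x = eval_tu f" and y: "y = eval_tu g" by blast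
    show "scale_u c (x + y) = scale_u c x + scale_u c y"
      unfolding x y eval_tu_add[symmetric] eq ring_hom_onD(3)[OF hom UNIV_I UNIV_I] ..
    show "scale_u c (x * y) = scale_u c x * scale_u c y"
      unfolding x y eval_tu_mult[symmetric] eq ring_hom_onD(4)[OF hom UNIV_I UNIV_I] ..
  qed
qed

lemma const_t_in_A_plus: "0 < d \<Longrightarrow> P \<noteq> 0 \<Longrightarrow> const_t p \<in> A_plus d P"
  using fract_poly_in_graded_subring[of d "[:p:]" P] eval_tu_fract_poly[of "[:p:]"]
  unfolding A_plus_eq by (metis imageI)

lemma u_in_A_plus: "0 < d \<Longrightarrow> P \<noteq> 0 \<Longrightarrow> u_var \<in> A_plus d P"
  using fract_poly_in_graded_subring[of d "[:0, 1:]" P] eval_tu_fract_poly[of "[:0, 1:]"]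
  unfolding A_plus_eq u_var_def by (metis imageI)

text \<open>The algebraic side of an equivariant isomorphism over the line. It points from
  \<open>B\<close> to \<open>A\<close>, against the morphism of spectra; commuting with the actions
  stands for preserving degrees.\<close>

definition graded_iso ::
  "'b::idom set \<Rightarrow> (complex poly \<Rightarrow> 'b) \<Rightarrow> (complex \<Rightarrow> 'b \<Rightarrow> 'b) \<Rightarrow>
   'a::idom set \<Rightarrow> (complex poly \<Rightarrow> 'a) \<Rightarrow> (complex \<Rightarrow> 'a \<Rightarrow> 'a) \<Rightarrow> ('b \<Rightarrow> 'a) \<Rightarrow> bool" where
  "graded_iso B \<beta> actB A \<alpha> actA \<theta> \<longleftrightarrow> ring_hom_on B A \<theta> \<and> bij_betw \<theta> B A \<and>
     (\<forall>p. \<theta> (\<beta> p) = \<alpha> p) \<and> (\<forall>c x. c \<noteq> 0 \<longrightarrow> x \<in> B \<longrightarrow> \<theta> (actB c x) = actA c (\<theta> x))"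

text \<open>One direction is functoriality; in the other, the equalities of morphisms are evaluated
  on constant global sections. Only existence is compared, so a morphism is never identified with
  the one induced by its map on global sections.\<close>

lemma scheme_iso_iff_graded_iso:
  fixes A :: "'a::idom set" and B :: "'b::idom set"
  assumes A: "is_subring A" and B: "is_subring B"
    and \<alpha>: "ring_hom_on UNIV A \<alpha>" and \<beta>: "ring_hom_on UNIV B \<beta>"
    and actA: "\<And>c. c \<noteq> 0 \<Longrightarrow> ring_hom_on A A (actA c)"
    and actB: "\<And>c. c \<noteq> 0 \<Longrightarrow> ring_hom_on B B (actB c)"
  shows "(\<exists>\<phi>. scheme_iso A B \<phi> \<and> over_affine_line A \<alpha> B \<beta> \<phi> \<and> equivariant A actA B actB \<phi>) \<longleftrightarrow>
    (\<exists>\<theta>. graded_iso B \<beta> actB A \<alpha> actA \<theta>)"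
    (is "?L \<longleftrightarrow> ?R")
proof
  assume ?R
  then obtain \<theta> where hom: "ring_hom_on B A \<theta>" and bij: "bij_betw \<theta> B A"
    and base: "\<And>p. \<theta> (\<beta> p) = \<alpha> p"
    and equi: "\<And>c x. c \<noteq> 0 \<Longrightarrow> x \<in> B \<Longrightarrow> \<theta> (actB c x) = actA c (\<theta> x)"
    unfolding graded_iso_def by blast
  let ?\<phi> = "spec_map A B \<theta>"
  have "scheme_iso A B ?\<phi>" by (rule scheme_iso_spec_map[OF A B hom bij])
  moreover have "over_affine_line A \<alpha> B \<beta> ?\<phi>"
    unfolding over_affine_line_def by (rule morph_comp_spec_map[OF A B is_subring_UNIV \<beta> hom]) (simp add: base)
  moreover have "equivariant A actA B actB ?\<phi>"
    unfolding equivariant_def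
  proof (intro allI impI)
    fix c :: complex assume c: "c \<noteq> 0"
    have "morph_eq A B (morph_comp A ?\<phi> (spec_map A A (actA c))) (spec_map A B (\<lambda>x. actA c (\<theta> x)))"
      by (rule morph_comp_spec_map[OF A A B hom actA[OF c] refl])
    moreover have "morph_eq A B (morph_comp B (spec_map B B (actB c)) ?\<phi>) (spec_map A B (\<lambda>x. actA c (\<theta> x)))"
      by (rule morph_comp_spec_map[OF A B B actB[OF c] hom]) (simp add: equi[OF c])
    ultimately show "morph_eq A B (morph_comp A ?\<phi> (spec_map A A (actA c))) (morph_comp B (spec_map B B (actB c)) ?\<phi>)"
      using morph_eq_trans morph_eq_sym by metis
  qed
  ultimately show ?L by blast
next
  assume ?L
  then obtain \<phi> where iso: "scheme_iso A B \<phi>" and over: "over_affine_line A \<alpha> B \<beta> \<phi>"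
    and equi: "equivariant A actA B actB \<phi>" by blast
  obtain \<theta> where hom: "ring_hom_on B A \<theta>" and bij: "bij_betw \<theta> B A"
    and sec: "\<forall>b\<in>B. snd \<phi> (spec B) (const_section B b) = const_section A (\<theta> b)"
    by (rule scheme_iso_global_sections[OF A B iso])
  have \<phi>: "scheme_morphism A B \<phi>" using iso unfolding scheme_iso_def by blast
  note preim_\<phi> = preim_spec[OF A B \<phi>]
  have "\<theta> (\<beta> p) = \<alpha> p" for p
  proof -
    let ?U = "UNIV :: complex poly set"
    let ?s = "const_section ?U p"
    have "snd (morph_comp B (spec_map B ?U \<beta>) \<phi>) (spec ?U) ?s = snd (spec_map A ?U \<alpha>) (spec ?U) ?s"
      using over openin_spec[OF is_subring_UNIV] const_in_sections[OF is_subring_UNIV openin_spec[OF is_subring_UNIV] UNIV_I]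
      unfolding over_affine_line_def morph_eq_def by blast
    then have "const_section A (\<theta> (\<beta> p)) = const_section A (\<alpha> p)"
      unfolding morph_comp_def snd_conv preim_spec[OF B is_subring_UNIV scheme_morphism_spec_map[OF B is_subring_UNIV \<beta>]]
        spec_map_global_section[OF B is_subring_UNIV \<beta> UNIV_I] spec_map_global_section[OF A is_subring_UNIV \<alpha> UNIV_I]
        bspec[OF sec ring_hom_onD(1)[OF \<beta> UNIV_I]] .
    then show ?thesis unfolding const_section_eq_iff[OF A] to_fract_eq_iff .
  qed
  moreover have "\<theta> (actB c b) = actA c (\<theta> b)" if c: "c \<noteq> 0" and b: "b \<in> B" for c b
  proof -
    let ?s = "const_section B b"
    have "morph_eq A B (morph_comp A \<phi> (spec_map A A (actA c))) (morph_comp B (spec_map B B (actB c)) \<phi>)"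
      using equi c unfolding equivariant_def by blast
    then have "snd (morph_comp A \<phi> (spec_map A A (actA c))) (spec B) ?s =
        snd (morph_comp B (spec_map B B (actB c)) \<phi>) (spec B) ?s"
      using openin_spec[OF B] const_in_sections[OF B openin_spec[OF B] b] unfolding morph_eq_def by blast
    then have "const_section A (actA c (\<theta> b)) = const_section A (\<theta> (actB c b))"
      unfolding morph_comp_def snd_conv preim_\<phi> preim_spec[OF B B scheme_morphism_spec_map[OF B B actB[OF c]]]
        bspec[OF sec b] spec_map_global_section[OF A A actA[OF c] ring_hom_onD(1)[OF hom b]]
        spec_map_global_section[OF B B actB[OF c] b] bspec[OF sec ring_hom_onD(1)[OF actB[OF c] b]] .
    then show ?thesis unfolding const_section_eq_iff[OF A] to_fract_eq_iff by simp
  qed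
  ultimately show ?R
    unfolding graded_iso_def using hom bij by blast
qed

lemma graded_iso_comp:
  assumes "graded_iso C \<gamma> actC B \<beta> actB \<eta>" "graded_iso B \<beta> actB A \<alpha> actA \<theta>"
  shows "graded_iso C \<gamma> actC A \<alpha> actA (\<lambda>x. \<theta> (\<eta> x))"
proof -
  have "bij_betw (\<lambda>x. \<theta> (\<eta> x)) C A"
    using bij_betw_trans[of \<eta> C B \<theta> A] assms unfolding graded_iso_def by (simp add: o_def)
  moreover have "\<eta> x \<in> B" if "x \<in> C" for x
    using assms(1) that ring_hom_onD(1) unfolding graded_iso_def by blast
  ultimately show ?thesis using assms ring_hom_on_comp[of C B \<eta> A \<theta>] unfolding graded_iso_def by simp
qed

lemma graded_iso_inv:
  assumes iso: "graded_iso B \<beta> actB A \<alpha> actA \<theta>" and B: "is_subring B"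
    and \<beta>: "\<And>p. \<beta> p \<in> B" and actB: "\<And>c x. c \<noteq> 0 \<Longrightarrow> x \<in> B \<Longrightarrow> actB c x \<in> B"
  shows "graded_iso A \<alpha> actA B \<beta> actB (inv_into B \<theta>)"
proof -
  have hom: "ring_hom_on B A \<theta>" and bij: "bij_betw \<theta> B A"
    using iso unfolding graded_iso_def by blast+
  have inv: "inv_into B \<theta> (\<theta> x) = x" if "x \<in> B" for x
    using that bij by (simp add: bij_betw_def)
  have "inv_into B \<theta> (\<alpha> p) = \<beta> p" for p
    using iso inv[OF \<beta>[of p]] unfolding graded_iso_def by simp
  moreover have "inv_into B \<theta> (actA c y) = actB c (inv_into B \<theta> y)" if "c \<noteq> 0" "y \<in> A" for c y
  proof -
    have y: "inv_into B \<theta> y \<in> B" "\<theta> (inv_into B \<theta> y) = y"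
      using that(2) bij by (auto simp: bij_betw_def inv_into_into f_inv_into_f)
    then have "actA c y = \<theta> (actB c (inv_into B \<theta> y))" using iso that(1) unfolding graded_iso_def by simp
    then show ?thesis using inv[OF actB[OF that(1) y(1)]] by simp
  qed
  ultimately show ?thesis
    unfolding graded_iso_def using ring_hom_on_inv_into[OF B hom bij] bij_betw_inv_into[OF bij] by blast
qed

section \<open>Uniqueness of the pair\<close>

lemma condition_star_Gcd:
  "condition_star d P \<Longrightarrow> Gcd (insert d ((\<lambda>x. order x P) ` {x. poly P x = 0})) = 1"
  by (cases "d = 1") (auto simp: condition_star_def)

lemma condition_star_order:
  assumes "condition_star d P" "1 \<le> d" "P \<noteq> 0"
  shows "order x P < d"
proof (cases "d = 1")
  case True
  then show ?thesis using assms(1) by (simp add: condition_star_def order_1_eq_0)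
next
  case False
  then show ?thesis using assms by (cases "poly P x = 0") (auto simp: condition_star_def order_0I)
qed

text \<open>If r = a/b is in lowest terms and r^d P is a polynomial, then b^d divides
  \<open>P\<close>; a root of \<open>b\<close> would have order at least \<open>d\<close> in
  \<open>P\<close>.\<close>

lemma coeff_set_degree_one:
  assumes star: "condition_star d P" and d: "1 \<le> d" and P: "P \<noteq> 0" and r: "r \<in> coeff_set d (to_fract P) 1"
  shows "r \<in> range to_fract"
proof -
  obtain a b where ab: "r = to_fract a / to_fract b" "b \<noteq> 0" "coprime a b" by (rule fract_coprimeE)
  obtain y where "r ^ d * to_fract P = to_fract y" using r unfolding coeff_set_def by auto
  then have "to_fract (a ^ d * P) = to_fract (y * b ^ d)"
    using ab(2) unfolding ab(1) by (simp add: power_divide field_simps to_fract_power)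
  then have "a ^ d * P = y * b ^ d" unfolding to_fract_eq_iff .
  then have "b ^ d dvd a ^ d * P" by simp
  then have dvd: "b ^ d dvd P"
    using ab(3) by (metis coprime_commute coprime_dvd_mult_right_iff coprime_power_left_iff coprime_power_right_iff)
  have "degree b = 0"
  proof (rule ccontr)
    assume "degree b \<noteq> 0"
    then obtain x where "poly b x = 0" using fundamental_theorem_of_algebra[of b] by (auto simp: constant_degree)
    then have "[:- x, 1:] ^ d dvd b ^ d" by (simp add: dvd_power_same poly_eq_0_iff_dvd)
    then have "[:- x, 1:] ^ d dvd P" using dvd by (rule dvd_trans)
    then have "d \<le> order x P" using P by (simp add: order_divides)
    then show False using condition_star_order[OF star d P, of x] by simp
  qed
  then have "b dvd a" using ab(2) is_unit_iff_degree unit_imp_dvd by blast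
  then show ?thesis using ab by (auto elim!: dvdE)
qed

text \<open>An isomorphism multiplies \<open>u\<close> by a unit of \<open>\<complex>[t]\<close>, since \<open>\<complex>[t] u\<close> is the part of
  degree one on both sides.\<close>

lemma graded_iso_coeff_set:
  assumes dP: "1 \<le> d" "P \<noteq> 0" "condition_star d P"
    and dP': "1 \<le> d'" "P' \<noteq> 0" "condition_star d' P'"
    and iso: "graded_iso (A_plus d P) const_t scale_u (A_plus d' P') const_t scale_u \<kappa>"
  shows "coeff_set d (to_fract P) n \<subseteq> coeff_set d' (to_fract P') n"
proof -
  have d: "0 < d" "0 < d'" using dP dP' by auto
  note B = is_subring_A_plus[OF d(1) dP(2)]
  \<comment> \<open>Proved for all data because it is applied to \<open>\<kappa>\<close> and to its
    inverse.\<close>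
  have degree_one: "\<exists>p. \<kappa> u_var = const_t p * u_var"
    if dP: "1 \<le> d" "P \<noteq> 0" and dP': "1 \<le> d'" "P' \<noteq> 0" "condition_star d' P'"
    and iso: "graded_iso (A_plus d P) const_t scale_u (A_plus d' P') const_t scale_u \<kappa>" for d P d' P' \<kappa>
  proof -
    have d: "0 < d" "0 < d'" using dP dP' by auto
    have hom: "ring_hom_on (A_plus d P) (A_plus d' P') \<kappa>" using iso unfolding graded_iso_def by blast
    note u = u_in_A_plus[OF d(1) dP(2)]
    have "\<kappa> u_var \<in> A_plus d' P'" using ring_hom_onD(1)[OF hom u] .
    then obtain f where f: "\<kappa> u_var = eval_tu f" "f \<in> graded_subring d' P'"
      unfolding A_plus_eq[OF d(2) dP'(2)] by blast
    have "eval_tu (monom 1 1) = u_var"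
      using ring_hom_onD(2)[OF ring_hom_fract_ext[OF ring_hom_const_t inj_const_t]] by (simp add: eval_tu_monom)
    \<comment> \<open>One test value is enough: 2^i = 2 only for i = 1, so an element that
      \<open>scale_u 2\<close> doubles is homogeneous of degree one.\<close>
    moreover have "rescale 2 (monom 1 1) = Polynomial.smult (to_fract [:2:]) (monom 1 1)"
      by (rule poly_eqI) (auto simp: coeff_rescale)
    ultimately have "scale_u 2 u_var = const_t [:2:] * u_var"
      by (metis eval_tu_smult scale_u_eval_tu zero_neq_numeral)
    then have "scale_u 2 (\<kappa> u_var) = const_t [:2:] * \<kappa> u_var"
      using iso u ring_hom_onD(4)[OF hom const_t_in_A_plus[OF d(1) dP(2)] u]
      unfolding graded_iso_def by (metis zero_neq_numeral)
    then have "eval_tu (rescale 2 f) = eval_tu (Polynomial.smult (to_fract [:2:]) f)"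
      unfolding f(1) by (simp add: scale_u_eval_tu eval_tu_smult)
    then have eq: "rescale 2 f = Polynomial.smult (to_fract [:2:]) f" using inj_eval_tu by (rule injD[rotated])
    have "coeff f i = 0" if "i \<noteq> 1" for i
    proof -
      have "to_fract [:2:] ^ i * coeff f i = to_fract [:2:] * coeff f i"
        using arg_cong[OF eq, of "\<lambda>q. coeff q i"] by (simp add: coeff_rescale)
      moreover have "to_fract [:2 :: complex:] ^ i \<noteq> to_fract [:2:]"
      proof
        assume "to_fract [:2 :: complex:] ^ i = to_fract [:2:]"
        then have "[:2 :: complex:] ^ i = [:2:]" unfolding to_fract_power[symmetric] to_fract_eq_iff .
        from arg_cong[OF this, of "\<lambda>q. poly q 0"] have "norm ((2 :: complex) ^ i) = norm (2 :: complex)" by simp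
        then have "(2 :: real) ^ i = 2 ^ 1" by (simp add: norm_power)
        then have "i = 1" using power_inject_exp[of "2 :: real" i 1] by linarith
        then show False using that by simp
      qed
      ultimately show ?thesis by simp
    qed
    then have "f = monom (coeff f 1) 1" by (intro poly_eqI) simp
    moreover obtain p where "coeff f 1 = to_fract p"
      using coeff_set_degree_one[OF dP'(3,1,2) in_graded_subringD[OF f(2)]] by blast
    ultimately have "\<kappa> u_var = fract_ext const_t (to_fract p) * u_var"
      unfolding f(1) using eval_tu_monom[of "coeff f 1" 1] by simp
    then show ?thesis by (auto simp: fract_ext_const_t)
  qed
  have hom: "ring_hom_on (A_plus d P) (A_plus d' P') \<kappa>" and bij: "bij_betw \<kappa> (A_plus d P) (A_plus d' P')"
    and base: "\<And>p. \<kappa> (const_t p) = const_t p"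
    using iso unfolding graded_iso_def by blast+
  note ct = const_t_in_A_plus[OF d(1) dP(2)] and u = u_in_A_plus[OF d(1) dP(2)]
  have "graded_iso (A_plus d' P') const_t scale_u (A_plus d P) const_t scale_u (inv_into (A_plus d P) \<kappa>)"
    by (rule graded_iso_inv[OF iso B ct ring_hom_onD(1)[OF ring_hom_scale_u[OF d(1) dP(2)]]])
  then obtain q where q: "inv_into (A_plus d P) \<kappa> u_var = const_t q * u_var"
    using degree_one[OF dP'(1,2) dP] by blast
  obtain p where p: "\<kappa> u_var = const_t p * u_var"
    using degree_one[OF dP(1,2) dP' iso] by blast
  have "u_var = \<kappa> (const_t q * u_var)"
    using q bij u_in_A_plus[OF d(2) dP'(2)] by (metis bij_betw_inv_into_right)
  also have "\<dots> = const_t q * (const_t p * u_var)"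
    using ring_hom_onD(4)[OF hom ct u] by (simp only: base p)
  finally have "const_t (q * p) * u_var = 1 * u_var"
    by (simp add: mult.assoc flip: ring_hom_onD(4)[OF ring_hom_const_t UNIV_I UNIV_I])
  then have "const_t (q * p) = const_t 1"
    using ring_hom_onD(2)[OF ring_hom_const_t] by (simp add: u_var_def)
  then have qp: "q * p = 1" using inj_const_t by (rule injD[rotated])
  show ?thesis
  proof
    fix r assume r: "r \<in> coeff_set d (to_fract P) n"
    obtain a b where ab: "r = to_fract a / to_fract b" "b \<noteq> 0" by (rule fract_coprimeE)
    let ?x = "eval_tu (monom r n)"
    have x: "?x \<in> A_plus d P"
      unfolding A_plus_eq[OF d(1) dP(2)] using monom_in_graded_subring[OF d(1) r] by blast
    have frac: "fract_ext const_t r = const_t a / const_t b"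
      unfolding ab(1) by (rule fract_ext_divide[OF ring_hom_const_t inj_const_t ab(2)])
    \<comment> \<open>\<open>\<kappa>\<close> is known on C[t] and on \<open>u_var\<close>, so the
      denominator of \<open>r\<close> is cleared before it is applied.\<close>
    have "const_t b * ?x = const_t a * u_var ^ n"
      using ab(2) by (simp add: eval_tu_monom frac)
    then have "\<kappa> (const_t b * ?x) = \<kappa> (const_t a * u_var ^ n)" by simp
    then have "const_t b * \<kappa> ?x = const_t a * (const_t p * u_var) ^ n"
      by (simp only: ring_hom_onD(4)[OF hom ct x] ring_hom_onD(4)[OF hom ct subring_power[OF B u]]
          ring_hom_on_power[OF B hom u] base p)
    then have "\<kappa> ?x = fract_ext const_t r * (const_t p) ^ n * u_var ^ n"
      using ab(2) by (simp add: frac field_simps power_mult_distrib)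
    also have "fract_ext const_t r * (const_t p) ^ n = fract_ext const_t (r * to_fract p ^ n)"
      using ring_hom_fract_ext[OF ring_hom_const_t inj_const_t]
      by (simp add: ring_hom_onD(4)[of UNIV UNIV] ring_hom_on_power[OF is_subring_UNIV] fract_ext_const_t)
    finally have "\<kappa> ?x = eval_tu (monom (r * to_fract p ^ n) n)" by (simp only: eval_tu_monom)
    moreover have "\<kappa> ?x \<in> eval_tu ` graded_subring d' P'"
      using ring_hom_onD(1)[OF hom x] unfolding A_plus_eq[OF d(2) dP'(2)] .
    ultimately have "monom (r * to_fract p ^ n) n \<in> graded_subring d' P'"
      using inj_image_mem_iff[OF inj_eval_tu] by metis
    then have "r * to_fract p ^ n \<in> coeff_set d' (to_fract P') n"
      using in_graded_subringD[of _ d' P' n] by fastforce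
    \<comment> \<open>The coefficient has acquired the factor p^n; as q p = 1, multiplication by q^n
      restores \<open>r\<close>.\<close>
    then have "to_fract (q ^ n) * (r * to_fract p ^ n) \<in> coeff_set d' (to_fract P') n"
      by (rule coeff_set_smult)
    also have "to_fract (q ^ n) * (r * to_fract p ^ n) = r * to_fract ((q * p) ^ n)"
      by (simp add: to_fract_power power_mult_distrib)
    finally show "r \<in> coeff_set d' (to_fract P') n" by (simp add: qp)
  qed
qed

text \<open>Once d' ord P = d ord P' at every point, \<open>d\<close> divides d' times each of the
  numbers in the condition for (d, P). Their greatest common divisor is 1, so \<open>d\<close>
  divides d'; by symmetry they are equal, and the orders determine the monic polynomial.\<close>

lemma condition_star_unique:
  assumes dP: "1 \<le> d" "lead_coeff P = 1" "condition_star d P"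
    and dP': "1 \<le> d'" "lead_coeff P' = 1" "condition_star d' P'"
    and eq: "\<And>n. coeff_set d (to_fract P) n = coeff_set d' (to_fract P') n"
  shows "d = d' \<and> P = P'"
proof -
  have le: "d' * order x P \<le> d * order x P'"
    if "1 \<le> d" "lead_coeff P = 1" "1 \<le> d'" "lead_coeff P' = 1"
      "\<And>n. coeff_set d (to_fract P) n = coeff_set d' (to_fract P') n" for d d' P P' x
  proof -
    have P: "P \<noteq> 0" "P' \<noteq> 0" using that by auto
    \<comment> \<open>In degree d d' this fraction satisfies the condition for (d, P) with value
      exactly 1, so it has the deepest poles allowed there; the condition for (d', P') then bounds
      them.\<close>
    let ?r = "1 / to_fract P ^ d'"
    have "?r ^ d * to_fract P ^ (d * d') = 1"
      using P by (simp add: power_divide mult.commute[of d] flip: power_mult)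
    then have "?r \<in> coeff_set d (to_fract P) (d * d')"
      unfolding coeff_set_def using subring_one[OF subring_range_to_fract] by simp
    then have "?r \<in> coeff_set d' (to_fract P') (d * d')" using that(5) by simp
    then obtain y where y: "?r ^ d' * to_fract P' ^ (d * d') = to_fract y" unfolding coeff_set_def by blast
    have "to_fract (P' ^ (d * d')) = to_fract (y * P ^ (d' * d'))"
      using P y by (simp add: power_divide field_simps to_fract_power flip: power_mult)
    then have "P' ^ (d * d') = y * P ^ (d' * d')" unfolding to_fract_eq_iff .
    moreover from this have "y * P ^ (d' * d') \<noteq> 0" using P by (metis power_not_zero)
    ultimately have "(d * d') * order x P' = order x y + (d' * d') * order x P"
      using P by (metis order_mult order_power)
    then have "d' * (d' * order x P) \<le> d' * (d * order x P')" by (simp add: mult_ac)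
    then show ?thesis using that(3) by simp
  qed
  have ord: "d' * order x P = d * order x P'" for x
    using le[OF dP(1,2) dP'(1,2) eq] le[OF dP'(1,2) dP(1,2) eq[symmetric]] by (rule antisym)
  have dvd: "d dvd d'"
    if "condition_star d P" "\<And>x. d' * order x P = d * order x P'" for d d' P P'
  proof -
    let ?Y = "insert d ((\<lambda>x. order x P) ` {x. poly P x = 0})"
    have "d dvd Gcd ((*) d' ` ?Y)" using that(2) by (intro Gcd_greatest) auto
    also have "Gcd ((*) d' ` ?Y) = d'" using condition_star_Gcd[OF that(1)] by (simp add: Gcd_mult del: Gcd_insert image_insert)
    finally show ?thesis .
  qed
  have "d = d'"
    using dvd[OF dP(3) ord] dvd[OF dP'(3) ord[symmetric]] by (rule dvd_antisym)
  moreover from this have "P = P'" using ord dP(1,2) dP'(2) by (intro monic_eqI_order) auto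
  ultimately show ?thesis by blast
qed

section \<open>Existence and uniqueness for the given surface\<close>

context torus_surface
begin

lemma act_eq_sum: "c \<noteq> 0 \<Longrightarrow> act c x = (\<Sum>i\<le>degree (coaction x). coeff (coaction x) i * \<iota> c ^ i)"
  by (simp add: poly_altdef flip: poly_coaction)

text \<open>The isomorphism sends r u^n to r w^n. It passes through the model, which
  \<open>eval_tu\<close> identifies with \<open>A_plus\<close> and evaluation at \<open>w\<close>
  identifies with the given ring, by \<open>graded_structure\<close>.\<close>

lemma graded_iso_exists:
  obtains d P \<theta> where "1 \<le> d" "lead_coeff P = 1" "condition_star d P"
    "graded_iso (A_plus d P) const_t scale_u UNIV (poly_embed \<iota> t) act \<theta>"
proof -
  obtain d P w where dP: "1 \<le> d" "lead_coeff P = 1" "condition_star d P" and w: "uniformizer w"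
    and M: "\<forall>n r. j r * w ^ n \<in> range to_fract \<longleftrightarrow> r \<in> coeff_set d (to_fract P) n"
    by (rule graded_structure) blast
  have d: "0 < d" and P: "P \<noteq> 0" using dP by auto
  let ?R = "graded_subring d P"
  note R = is_subring_graded_subring[OF d, of P]
  have w0: "w \<noteq> 0" and W_iff: "\<And>n f. f \<in> W n \<longleftrightarrow> (\<exists>r. to_fract f = j r * w ^ n)"
    using w unfolding uniformizer_def by auto
  define ev where "ev = eval_ext hF w"
  have hom_ev: "ring_hom_on UNIV UNIV ev" unfolding ev_def by (rule ring_hom_eval_ext[OF hom_hF inj_hF])
  have ev_sum: "ev f = (\<Sum>i\<le>n. j (coeff f i) * w ^ i)" if "degree f \<le> n" for f n
  proof -
    have "ev f = ev (\<Sum>i\<le>n. monom (coeff f i) i)" using that by (simp add: poly_as_sum_of_monoms')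
    then show ?thesis
      unfolding ring_hom_on_sum[OF is_subring_UNIV hom_ev UNIV_I]
      by (simp only: ev_def eval_ext_monom[OF hom_hF inj_hF])
  qed
  \<comment> \<open>Evaluation at \<open>w\<close> takes values in the fraction field; on the graded
    subring they come from elements of the ring, which \<open>\<eta>\<close> picks out.\<close>
  define \<eta> where "\<eta> f = (THE x. to_fract x = ev f)" for f
  have components: "to_fract (\<eta> f) = ev f \<and> (\<forall>i. to_fract (coeff (coaction (\<eta> f)) i) = j (coeff f i) * w ^ i)"
    if f: "f \<in> ?R" for f
  proof -
    have "\<forall>i. \<exists>x. j (coeff f i) * w ^ i = to_fract x"
      using M in_graded_subringD[OF f] by blast
    from choice[OF this] obtain x where x: "\<forall>i. j (coeff f i) * w ^ i = to_fract (x i)" ..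
    have xW: "x i \<in> W i" for i using W_iff x by metis
    let ?y = "\<Sum>i\<le>degree f. x i"
    have y: "to_fract ?y = ev f" using ev_sum[of f "degree f"] x by simp
    have "\<eta> f = ?y" unfolding \<eta>_def y[symmetric] to_fract_eq_iff by (rule the_eq_trivial)
    moreover have "coeff (coaction ?y) i = x i" for i
    proof -
      have "coaction ?y = (\<Sum>k\<le>degree f. monom (x k) k)"
        using xW by (simp add: ring_hom_on_sum[OF is_subring_UNIV hom_coaction] W_def)
      then have c: "coeff (coaction ?y) i = (if i \<le> degree f then x i else 0)"
        by (simp add: coeff_sum)
      have "x i = 0" if "\<not> i \<le> degree f"
      proof -
        have "coeff f i = 0" using that by (simp add: coeff_eq_0)
        then have "to_fract (x i) = 0" using x[rule_format, of i] j_eq_zero_iff[of 0] by simp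
        then show ?thesis by simp
      qed
      then show ?thesis using c by simp
    qed
    ultimately show ?thesis using y x by simp
  qed
  have \<eta>: "to_fract (\<eta> f) = ev f" if "f \<in> ?R" for f using components[OF that] by blast
  have \<eta>_eqI: "\<eta> f = x" if "f \<in> ?R" "ev f = to_fract x" for f x
    using \<eta>[OF that(1)] that(2) by simp
  have hom_\<eta>: "ring_hom_on ?R UNIV \<eta>"
    unfolding ring_hom_on_def
  proof (intro conjI ballI)
    show "\<eta> 1 = 1" using ring_hom_onD(2)[OF hom_ev] by (intro \<eta>_eqI[OF subring_one[OF R]]) simp
    fix f g assume fg: "f \<in> ?R" "g \<in> ?R"
    show "\<eta> (f + g) = \<eta> f + \<eta> g"
      by (rule \<eta>_eqI[OF subring_add[OF R fg]]) (simp add: ring_hom_onD(3)[OF hom_ev] \<eta> fg)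
    show "\<eta> (f * g) = \<eta> f * \<eta> g"
      by (rule \<eta>_eqI[OF subring_mult[OF R fg]]) (simp add: ring_hom_onD(4)[OF hom_ev] \<eta> fg)
  qed simp
  have "inj_on \<eta> ?R"
  proof (rule inj_onI, rule poly_eqI)
    fix f g i assume fg: "f \<in> ?R" "g \<in> ?R" "\<eta> f = \<eta> g"
    then have "j (coeff f i) * w ^ i = j (coeff g i) * w ^ i"
      using components[OF fg(1)] components[OF fg(2)] by metis
    then have "j (coeff f i) = j (coeff g i)" using w0 by simp
    then show "coeff f i = coeff g i" using inj_j by (rule injD[rotated])
  qed
  moreover have "x \<in> \<eta> ` ?R" for x
  proof -
    have "\<forall>i. \<exists>r. to_fract (coeff (coaction x) i) = j r * w ^ i" using coeff_in_W W_iff by blast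
    from choice[OF this] obtain r where r: "\<forall>i. to_fract (coeff (coaction x) i) = j (r i) * w ^ i" ..
    have rin: "r i \<in> coeff_set d (to_fract P) i" for i using M r by (metis rangeI)
    let ?f = "\<Sum>i\<le>degree (coaction x). monom (r i) i"
    have f: "?f \<in> ?R" by (intro subring_sum[OF R] monom_in_graded_subring[OF d] rin)
    have "ev ?f = (\<Sum>i\<le>degree (coaction x). to_fract (coeff (coaction x) i))"
      unfolding ring_hom_on_sum[OF is_subring_UNIV hom_ev UNIV_I]
      by (simp only: ev_def eval_ext_monom[OF hom_hF inj_hF] r)
    also have "\<dots> = to_fract x" by (simp only: sum_components flip: to_fract_sum)
    finally have "\<eta> ?f = x" by (rule \<eta>_eqI[OF f])
    then show ?thesis using imageI[OF f, of \<eta>] by (simp only:)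
  qed
  ultimately have bij_\<eta>: "bij_betw \<eta> ?R UNIV" unfolding bij_betw_def by blast
  have \<eta>_rescale: "\<eta> (rescale c f) = act c (\<eta> f)" if f: "f \<in> ?R" and c: "c \<noteq> 0" for c f
  proof (rule \<eta>_eqI[OF rescale_in_graded_subring[OF f]])
    let ?x = "\<eta> f"
    \<comment> \<open>A common bound on both degrees, so that the two sums run over the same range;
      the added terms vanish.\<close>
    let ?n = "max (degree f) (degree (coaction ?x))"
    have "degree (rescale c f) \<le> ?n"
      by (rule degree_le) (simp add: coeff_rescale coeff_eq_0)
    then have "ev (rescale c f) = (\<Sum>i\<le>?n. j (to_fract [:c:] ^ i * coeff f i) * w ^ i)"
      by (simp only: ev_sum coeff_rescale)
    also have "\<dots> = (\<Sum>i\<le>?n. to_fract (coeff (coaction ?x) i * \<iota> c ^ i))"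
    proof (rule sum.cong[OF refl])
      fix i
      have "to_fract (coeff (coaction ?x) i) = j (coeff f i) * w ^ i" using components[OF f] by blast
      moreover have "j (to_fract [:c:]) = to_fract (\<iota> c)" by (simp add: j_to_fract hF_def poly_embed_const)
      ultimately show "j (to_fract [:c:] ^ i * coeff f i) * w ^ i = to_fract (coeff (coaction ?x) i * \<iota> c ^ i)"
        by (simp add: j_mult j_power to_fract_power)
    qed
    also have "\<dots> = to_fract (\<Sum>i\<le>?n. coeff (coaction ?x) i * \<iota> c ^ i)" by simp
    also have "(\<Sum>i\<le>?n. coeff (coaction ?x) i * \<iota> c ^ i) = act c ?x"
      unfolding act_eq_sum[OF c] by (rule sum.mono_neutral_right) (auto simp: coeff_eq_0)
    finally show "ev (rescale c f) = to_fract (act c ?x)" .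
  qed
  define \<theta> where "\<theta> = \<eta> \<circ> inv_into UNIV eval_tu"
  have \<theta>: "\<theta> (eval_tu f) = \<eta> f" for f by (simp add: \<theta>_def inv_f_f[OF inj_eval_tu])
  note A = A_plus_eq[OF d P]
  have "graded_iso (A_plus d P) const_t scale_u UNIV (poly_embed \<iota> t) act \<theta>"
    unfolding graded_iso_def
  proof (intro conjI allI impI)
    show "ring_hom_on (A_plus d P) UNIV \<theta>"
      unfolding ring_hom_on_def A
    proof (intro conjI ballI)
      show "\<theta> 1 = 1"
        using \<theta>[of 1] ring_hom_onD(2)[OF ring_hom_eval_tu] ring_hom_onD(2)[OF hom_\<eta>] by simp
      fix x y assume "x \<in> eval_tu ` ?R" "y \<in> eval_tu ` ?R"
      then obtain f g where f: "x = eval_tu f" "f \<in> ?R" and g: "y = eval_tu g" "g \<in> ?R" by blast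
      show "\<theta> (x + y) = \<theta> x + \<theta> y"
        unfolding f(1) g(1) eval_tu_add[symmetric] \<theta> by (rule ring_hom_onD(3)[OF hom_\<eta> f(2) g(2)])
      show "\<theta> (x * y) = \<theta> x * \<theta> y"
        unfolding f(1) g(1) eval_tu_mult[symmetric] \<theta> by (rule ring_hom_onD(4)[OF hom_\<eta> f(2) g(2)])
    qed simp
    have "bij_betw eval_tu ?R (A_plus d P)"
      unfolding A bij_betw_def using inj_eval_tu by (auto intro: inj_on_subset)
    then have "bij_betw (inv_into UNIV eval_tu) (A_plus d P) ?R"
      unfolding A bij_betw_def using inv_f_f[OF inj_eval_tu] by (auto simp: inj_on_def image_image)
    then show "bij_betw \<theta> (A_plus d P) UNIV" unfolding \<theta>_def using bij_\<eta> by (rule bij_betw_trans)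
    show "\<theta> (const_t p) = poly_embed \<iota> t p" for p
    proof -
      have "\<theta> (const_t p) = \<eta> (fract_poly [:p:])" unfolding \<theta>[symmetric] eval_tu_fract_poly ..
      also have "\<dots> = poly_embed \<iota> t p"
      proof (rule \<eta>_eqI[OF fract_poly_in_graded_subring[OF d]])
        show "ev (fract_poly [:p:]) = to_fract (poly_embed \<iota> t p)"
          using ev_sum[of "fract_poly [:p:]" 0] by (simp add: fract_poly_pCons j_to_fract hF_def)
      qed
      finally show ?thesis .
    qed
    fix c :: complex and x assume c: "c \<noteq> 0" and x: "x \<in> A_plus d P"
    then obtain f where f: "x = eval_tu f" "f \<in> ?R" unfolding A by blast
    show "\<theta> (scale_u c x) = act c (\<theta> x)"
      unfolding f(1) scale_u_eval_tu[OF c] \<theta> by (rule \<eta>_rescale[OF f(2) c])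
  qed
  then show ?thesis using that dP by blast
qed

text \<open>Passing through the given surface, the inverse of \<open>\<theta>'\<close> after
  \<open>\<theta>\<close> is a graded isomorphism of the standard rings; \<open>sub\<close> holds
  for all data and is used in both directions.\<close>

lemma graded_iso_unique:
  assumes dP: "1 \<le> d" "lead_coeff P = 1" "condition_star d P"
    and \<theta>: "graded_iso (A_plus d P) const_t scale_u UNIV (poly_embed \<iota> t) act \<theta>"
    and dP': "1 \<le> d'" "lead_coeff P' = 1" "condition_star d' P'"
    and \<theta>': "graded_iso (A_plus d' P') const_t scale_u UNIV (poly_embed \<iota> t) act \<theta>'"
  shows "d = d' \<and> P = P'"
proof (rule condition_star_unique[OF dP dP'])
  have sub: "coeff_set d (to_fract P) n \<subseteq> coeff_set d' (to_fract P') n"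
    if dP: "1 \<le> d" "lead_coeff P = 1" "condition_star d P"
      and \<theta>: "graded_iso (A_plus d P) const_t scale_u UNIV (poly_embed \<iota> t) act \<theta>"
      and dP': "1 \<le> d'" "lead_coeff P' = 1" "condition_star d' P'"
      and \<theta>': "graded_iso (A_plus d' P') const_t scale_u UNIV (poly_embed \<iota> t) act \<theta>'"
    for d P \<theta> d' P' \<theta>' n
  proof -
    have d: "0 < d" "0 < d'" and P: "P \<noteq> 0" "P' \<noteq> 0" using dP dP' by auto
    have "graded_iso UNIV (poly_embed \<iota> t) act (A_plus d' P') const_t scale_u (inv_into (A_plus d' P') \<theta>')"
      by (rule graded_iso_inv[OF \<theta>' is_subring_A_plus[OF d(2) P(2)] const_t_in_A_plus[OF d(2) P(2)]
            ring_hom_onD(1)[OF ring_hom_scale_u[OF d(2) P(2)]]])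
    from graded_iso_comp[OF \<theta> this] show ?thesis
      by (rule graded_iso_coeff_set[OF dP(1) P(1) dP(3) dP'(1) P(2) dP'(3)])
  qed
  show "coeff_set d (to_fract P) n = coeff_set d' (to_fract P') n" for n
    using sub[OF dP \<theta> dP' \<theta>'] sub[OF dP' \<theta>' dP \<theta>] by (rule subset_antisym)
qed

end

theorem theorem3p11:
  fixes \<iota> :: "complex \<Rightarrow> 'a::idom"
    and act :: "complex \<Rightarrow> 'a \<Rightarrow> 'a"
    and t :: 'a
  assumes "normal_affine_surface \<iota> (UNIV :: 'a set)"
    and "torus_action \<iota> UNIV act"
    and "effective_action UNIV act"
    and "\<And>i. i < 0 \<Longrightarrow> weight_space \<iota> UNIV act i = {0}"
    and "inj (poly_embed \<iota> t)"
    and "weight_space \<iota> UNIV act 0 = range (poly_embed \<iota> t)"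
  shows "\<exists>!dP. case dP of (d, P) \<Rightarrow>
    1 \<le> d \<and> lead_coeff P = 1 \<and> condition_star d P \<and>
    (\<exists>\<phi>. scheme_iso (UNIV :: 'a set) (A_plus d P) \<phi> \<and>
         over_affine_line UNIV (poly_embed \<iota> t) (A_plus d P) (poly_embed const_tu t_var) \<phi> \<and>
         equivariant UNIV act (A_plus d P) scale_u \<phi>)"
proof -
  interpret torus_surface \<iota> act t using assms by unfold_locales
  let ?iso = "\<lambda>d P \<theta>. graded_iso (A_plus d P) const_t scale_u UNIV (poly_embed \<iota> t) act \<theta>"
  let ?morph = "\<lambda>d P. (\<exists>\<phi>. scheme_iso (UNIV :: 'a set) (A_plus d P) \<phi> \<and>
         over_affine_line UNIV (poly_embed \<iota> t) (A_plus d P) (poly_embed const_tu t_var) \<phi> \<and>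
         equivariant UNIV act (A_plus d P) scale_u \<phi>)"
  \<comment> \<open>That \<open>A_plus d P\<close> is a ring stable under the action is known for
    \<open>1 \<le> d\<close> and monic \<open>P\<close>, so these conjuncts stay on both
    sides.\<close>
  have good_iff: "1 \<le> d \<and> lead_coeff P = 1 \<and> condition_star d P \<and> ?morph d P \<longleftrightarrow>
      1 \<le> d \<and> lead_coeff P = 1 \<and> condition_star d P \<and> (\<exists>\<theta>. ?iso d P \<theta>)" for d P
  proof (cases "1 \<le> d \<and> lead_coeff P = 1")
    case True
    then have d: "0 < d" and P: "P \<noteq> 0" by auto
    have hom: "ring_hom_on UNIV (A_plus d P) const_t"
      using ring_hom_const_t const_t_in_A_plus[OF d P] unfolding ring_hom_on_def by blast
    have "?morph d P \<longleftrightarrow> (\<exists>\<theta>. ?iso d P \<theta>)"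
      unfolding poly_embed_tu_eq
      by (rule scheme_iso_iff_graded_iso[OF is_subring_UNIV is_subring_A_plus[OF d P] hom_poly_embed hom
            hom_act ring_hom_scale_u[OF d P]])
    then show ?thesis by blast
  qed blast
  have unique: "d = d' \<and> P = P'"
    if dP: "1 \<le> d \<and> lead_coeff P = 1 \<and> condition_star d P \<and> (\<exists>\<theta>. ?iso d P \<theta>)"
      and dP': "1 \<le> d' \<and> lead_coeff P' = 1 \<and> condition_star d' P' \<and> (\<exists>\<theta>. ?iso d' P' \<theta>)"
    for d P d' P'
    using that graded_iso_unique[of d P _ d' P'] by blast
  obtain d P \<theta> where dP: "1 \<le> d" "lead_coeff P = 1" "condition_star d P" "?iso d P \<theta>"
    by (rule graded_iso_exists)
  show ?thesis
  proof (rule ex1I[of _ "(d, P)"])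
    show "case (d, P) of (d, P) \<Rightarrow> 1 \<le> d \<and> lead_coeff P = 1 \<and> condition_star d P \<and> ?morph d P"
      unfolding prod.case good_iff using dP by blast
    fix dP' assume "case dP' of (d, P) \<Rightarrow> 1 \<le> d \<and> lead_coeff P = 1 \<and> condition_star d P \<and> ?morph d P"
    then show "dP' = (d, P)"
      using dP unique[of d P "fst dP'" "snd dP'"] unfolding case_prod_beta good_iff by (auto simp: prod_eq_iff)
  qed
qed

end
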